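(* Let $\mathcal C\subseteq NC^{\circ\bullet}$ be a locally colorized category of noncrossing two-colored partitions. Then $\mathcal C$ coincides with one of the following categories (listed according to the case $\mathcal O,\mathcal H,\mathcal S,\mathcal B$ in which $\mathcal C$ lies). - Case $\mathcal O$: $\mathcal O_{\mathrm{loc}}=\langle\emptyset\rangle$. - Case $\mathcal H$: $\mathcal H'_{\mathrm{loc}}=\langle\beta_{\circ\bullet\circ\bullet}\rangle$, or $\mathcal H_{\mathrm{loc}}(k,d)=\langle b_k,\ b_d\otimes\tilde b_d,\ \beta_{\circ\circ\bullet\bullet},\ \beta_{\circ\bullet\circ\bullet}\rangle$ for some $k,d\in\mathbb N_0\setminus\{1,2\}$ with $d\mid k$. - Case $\mathcal S$: $\mathcal S_{\mathrm{loc}}(k,d)=\langle\sigma_\circ^{\otimes k},\ \lambda_d,\ \beta_{\circ\bullet\circ\bullet},\ \sigma_\circ\otimes\sigma_\bullet\rangle$ for some $k,d\in\mathbb N_0\setminus\{1\}$ with $d\mid k$. - Case $\mathcal B$: $\mathcal B_{\mathrm{loc}}(k,d)=\langle\sigma_\circ^{\otimes k},\ \lambda_d,\ \sigma_\circ\otimes\sigma_\bullet\rangle$ for some $k,d\in\mathbb N_0$ with $d\mid k$; or $\mathcal B'_{\mathrm{loc}}(k,d,0)=\langle\sigma_\circ^{\otimes k},\ \lambda_d,\ \mu_0,\ \sigma_\circ\otimes\sigma_\bullet\rangle$ for some $k,d\in\mathbb N_0\setminus\{1\}$ with $d\mid k$; or $\mathcal B'_{\mathrm{loc}}(k,d,\tfrac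 d2)=\langle\sigma_\circ^{\otimes k},\ \lambda_d,\ \mu_r,\ \sigma_\circ\otimes\sigma_\bullet\rangle$ with $r=\tfrac d2$, for some $k\in\mathbb N_0\setminus\{1\}$ and $d\in2\mathbb N_0\setminus\{0,2\}$ with $d\mid k$.
   Context: $\mathbb N_0=\{0,1,2,\dots\}$; $d\mid k$ means $k\in d\mathbb Z$ (so $d$ is a divisor of $k$ if $k\neq0$, and any $d\in\mathbb N_0$ is allowed if $k=0$). Two-colored partitions: for $k,l\in\mathbb N_0$, $P^{\circ\bullet}(k,l)$ is the set of all decompositions into disjoint nonempty blocks of a set consisting of a row of $k$ upper points and a row of $l$ lower points, where each point is moreover colored white ($\circ$) or black ($\bullet$); these two colors are inverse to each other. $P^{\circ\bullet}$ is the collection of all $P^{\circ\bullet}(k,l)$. $NC^{\circ\bullet}\subseteq P^{\circ\bullet}$ consists of the noncrossing partitions, i.e. those whose blocks can be drawn by strings between the two rows without crossings. Operations: the tensor product $p\otimes q$ is horizontal concatenation. The composition $pq\in P^{\circ\bullet}(k,m)$ of $q\in P^{\circ\bullet}(k,l)$ and $p\in P^{\circ\bullet}(l,m)$, defined only if the color of the $j$-th lower point of $q$ equals the color of the $j$-th upper point of $p$ for all $j$, is obtained by placing $p$ below $q$, joining blocks through the $l$ middle points, and removing the middle points. The involution $p^*\in P^{\circ\bullet}(l,k)$ of $p\in P^{\circ\bullet}(k,l)$ is the reflection at the horizontal axis (colors kept). The verticolor reflection $\tilde p$ of $p$ is obtained by reflecting $p$ at the vertical axis and inverting the colors of all points.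 A category of partitions is a collection $\mathcal C$ of subsets $\mathcal C(k,l)\subseteq P^{\circ\bullet}(k,l)$, $k,l\in\mathbb N_0$, closed under tensor product, composition and involution, and containing the pair partitions $\pi_{\circ\bullet},\pi_{\bullet\circ}$ and the identity partitions in $P^{\circ\bullet}(1,1)$ connecting one upper point with one lower point of the same color (both white, or both black). $\langle p_1,\dots,p_n\rangle$ is the smallest category of partitions containing $p_1,\dots,p_n$; $\langle\emptyset\rangle$ is the smallest category of partitions. Special partitions (all on the lower row only, read from left to right): $\pi_{xy}\in P^{\circ\bullet}(0,2)$ is one block of two points colored $x,y$; $\beta_{xyzw}\in P^{\circ\bullet}(0,4)$ is one block of four points colored $x,y,z,w$; $\sigma_\circ,\sigma_\bullet\in P^{\circ\bullet}(0,1)$ are the single white, resp. black, point; $b_s\in P^{\circ\bullet}(0,s)$ is one block of $s$ white points. For $d\in\mathbb N_0$, $\lambda_d\in P^{\circ\bullet}(0,2d+2)$ consists of: $d$ white singletons, then a white point $a$, then $d$ black singletons, then a black point $a'$, where $\{a,a'\}$ is a block. For $r\geq1$, $\mu_r$ consists of: $r+1$ white singletons, then a black point $a$, then $r-1$ black singletons, then a black point $a'$, where $\{a,a'\}$ is a block; $\mu_0\in P^{\circ\bullet}(0,4)$ consists of a white singleton, a black point $a$, a white singleton, a black point $a'$, where $\{a,a'\}$ is a block. By convention $b_0=\emptyset$ and $p^{\otimes0}=\emptyset$ (the empty partition). Cases: $\mathcal C$ is in case $\mathcal O$ if $\sigma_\circ\otimes\sigma_\bullet\notin\mathcal C$ and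 $\beta_{\circ\bullet\circ\bullet}\notin\mathcal C$; in case $\mathcal B$ if $\sigma_\circ\otimes\sigma_\bullet\in\mathcal C$ and $\beta_{\circ\bullet\circ\bullet}\notin\mathcal C$; in case $\mathcal H$ if $\sigma_\circ\otimes\sigma_\bullet\notin\mathcal C$ and $\beta_{\circ\bullet\circ\bullet}\in\mathcal C$; in case $\mathcal S$ if both are in $\mathcal C$. $\mathcal C$ is globally colorized if $\pi_{\circ\circ}\otimes\pi_{\bullet\bullet}\in\mathcal C$, and locally colorized otherwise. *)

theory Defs
  imports Main "HOL.Hull" "HOL-Library.Disjoint_Sets"
begin

datatype color = White | Black

primrec inv_color :: "color \<Rightarrow> color" where
  "inv_color White = Black"
| "inv_color Black = White"

text \<open>Points are numbered from the left, starting with 0, separately in each row.\<close>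

datatype point = Up nat | Lo nat

datatype tpart = TPart (upper: "color list") (lower: "color list") (blocks: "point set set")

definition points :: "tpart \<Rightarrow> point set" where
  "points p = Up ` {..<length (upper p)} \<union> Lo ` {..<length (lower p)}"

definition Partitions :: "nat \<Rightarrow> nat \<Rightarrow> tpart set" where
  "Partitions k l =
    {p. length (upper p) = k \<and> length (lower p) = l \<and> partition_on (points p) (blocks p)}"

definition AllPartitions :: "tpart set" where
  "AllPartitions = (\<Union>k l. Partitions k l)"

text \<open>The points are read around the boundary of the strip between the two rows: the upper row
  from left to right, then the lower row from right to left. Strings inside the strip can be drawn
  without crossings iff no two distinct blocks alternate in this order.\<close>

definition boundary_pos :: "tpart \<Rightarrow> point \<Rightarrow> nat" where
  "boundary_pos p x =
    (case x of Up i \<Rightarrow> i | Lo j \<Rightarrow> length (upper p) + (length (lower p) - 1 - j))"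

definition noncrossing :: "tpart \<Rightarrow> bool" where
  "noncrossing p \<longleftrightarrow>
    \<not> (\<exists>B \<in> blocks p. \<exists>B' \<in> blocks p. B \<noteq> B' \<and>
        (\<exists>a \<in> B. \<exists>b \<in> B'. \<exists>c \<in> B. \<exists>d \<in> B'.
          boundary_pos p a < boundary_pos p b \<and>
          boundary_pos p b < boundary_pos p c \<and>
          boundary_pos p c < boundary_pos p d))"

definition NC :: "tpart set" where
  "NC = {p \<in> AllPartitions. noncrossing p}"


definition empty_part :: tpart where
  "empty_part = TPart [] [] {}"

primrec shift :: "nat \<Rightarrow> nat \<Rightarrow> point \<Rightarrow> point" where
  "shift m n (Up i) = Up (m + i)"
| "shift m n (Lo j) = Lo (n + j)"

definition tensor :: "tpart \<Rightarrow> tpart \<Rightarrow> tpart" (infixr "\<otimes>" 70) where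
  "p \<otimes> q = TPart (upper p @ upper q) (lower p @ lower q)
    (blocks p \<union> (`) (shift (length (upper p)) (length (lower p))) ` blocks q)"

primrec tensor_pow :: "tpart \<Rightarrow> nat \<Rightarrow> tpart" where
  "tensor_pow p 0 = empty_part"
| "tensor_pow p (Suc n) = tensor_pow p n \<otimes> p"

text \<open>For the composite \<open>pq\<close> the diagram of \<open>p\<close> is placed below that of \<open>q\<close>; the lower row of
  \<open>q\<close> and the upper row of \<open>p\<close> become the same row of middle points.\<close>

datatype stack_point = Top nat | Mid nat | Bot nat

primrec place_above :: "point \<Rightarrow> stack_point" where
  "place_above (Up i) = Top i"
| "place_above (Lo j) = Mid j"

primrec place_below :: "point \<Rightarrow> stack_point" where
  "place_below (Up i) = Mid i"
| "place_below (Lo j) = Bot j"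

primrec place_outer :: "point \<Rightarrow> stack_point" where
  "place_outer (Up i) = Top i"
| "place_outer (Lo j) = Bot j"

definition stack_rel :: "tpart \<Rightarrow> tpart \<Rightarrow> (stack_point \<times> stack_point) set" where
  "stack_rel p q =
    (\<Union>B \<in> blocks q. place_above ` B \<times> place_above ` B) \<union>
    (\<Union>B \<in> blocks p. place_below ` B \<times> place_below ` B)"

definition composable :: "tpart \<Rightarrow> tpart \<Rightarrow> bool" where
  "composable p q \<longleftrightarrow> lower q = upper p"

definition composition :: "tpart \<Rightarrow> tpart \<Rightarrow> tpart" where
  "composition p q =
    (let pts = Up ` {..<length (upper q)} \<union> Lo ` {..<length (lower p)}
     in TPart (upper q) (lower p)
          (pts // {(x, y). x \<in> pts \<and> y \<in> pts \<and>
                     (place_outer x, place_outer y) \<in> (stack_rel p q)\<^sup>*}))"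

primrec flip :: "point \<Rightarrow> point" where
  "flip (Up i) = Lo i"
| "flip (Lo j) = Up j"

definition involution :: "tpart \<Rightarrow> tpart" where
  "involution p = TPart (lower p) (upper p) ((`) flip ` blocks p)"

definition mirror :: "tpart \<Rightarrow> point \<Rightarrow> point" where
  "mirror p x = (case x of Up i \<Rightarrow> Up (length (upper p) - 1 - i)
                         | Lo j \<Rightarrow> Lo (length (lower p) - 1 - j))"

definition verticolor :: "tpart \<Rightarrow> tpart" where
  "verticolor p = TPart (rev (map inv_color (upper p))) (rev (map inv_color (lower p)))
    ((`) (mirror p) ` blocks p)"


text \<open>The difference removes the empty set, so that \<open>one_block []\<close> is the empty partition.\<close>

definition one_block :: "color list \<Rightarrow> tpart" where
  "one_block cs = TPart [] cs ({Lo ` {..<length cs}} - {{}})"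

definition pair_part :: "color \<Rightarrow> color \<Rightarrow> tpart" where
  "pair_part x y = one_block [x, y]"

definition beta :: "color \<Rightarrow> color \<Rightarrow> color \<Rightarrow> color \<Rightarrow> tpart" where
  "beta x y z w = one_block [x, y, z, w]"

definition sigma :: "color \<Rightarrow> tpart" where
  "sigma x = one_block [x]"

definition bpart :: "nat \<Rightarrow> tpart" where
  "bpart s = one_block (replicate s White)"

definition id_part :: "color \<Rightarrow> tpart" where
  "id_part x = TPart [x] [x] {{Up 0, Lo 0}}"

text \<open>Lower points colored by \<open>cs\<close>, all singletons except for the block consisting of the points
  number \<open>a\<close> and \<open>a'\<close>.\<close>

definition one_pair :: "color list \<Rightarrow> nat \<Rightarrow> nat \<Rightarrow> tpart" where
  "one_pair cs a a' =
    TPart [] cs (insert {Lo a, Lo a'} ((\<lambda>i. {Lo i}) ` ({..<length cs} - {a, a'})))"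

definition lambda_part :: "nat \<Rightarrow> tpart" where
  "lambda_part d =
    one_pair (replicate d White @ [White] @ replicate d Black @ [Black]) d (2 * d + 1)"

definition mu_part :: "nat \<Rightarrow> tpart" where
  "mu_part r =
    (if r = 0 then one_pair [White, Black, White, Black] 1 3
     else one_pair (replicate (r + 1) White @ [Black] @ replicate (r - 1) Black @ [Black])
            (r + 1) (2 * r + 1))"


text \<open>A collection of subsets \<open>C(k,l)\<close> of \<open>Partitions k l\<close> is encoded by its union; as these sets
  are disjoint for distinct \<open>(k,l)\<close>, \<open>C(k,l)\<close> is recovered as \<open>C \<inter> Partitions k l\<close>.\<close>

definition category :: "tpart set \<Rightarrow> bool" where
  "category C \<longleftrightarrow>
    C \<subseteq> AllPartitions \<and>
    (\<forall>p \<in> C. \<forall>q \<in> C. p \<otimes> q \<in> C) \<and>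
    (\<forall>p \<in> C. \<forall>q \<in> C. composable p q \<longrightarrow> composition p q \<in> C) \<and>
    (\<forall>p \<in> C. involution p \<in> C) \<and>
    pair_part White Black \<in> C \<and> pair_part Black White \<in> C \<and>
    id_part White \<in> C \<and> id_part Black \<in> C"

definition generated :: "tpart set \<Rightarrow> tpart set" where
  "generated G = category hull G"

definition case_O :: "tpart set \<Rightarrow> bool" where
  "case_O C \<longleftrightarrow> sigma White \<otimes> sigma Black \<notin> C \<and> beta White Black White Black \<notin> C"

definition case_B :: "tpart set \<Rightarrow> bool" where
  "case_B C \<longleftrightarrow> sigma White \<otimes> sigma Black \<in> C \<and> beta White Black White Black \<notin> C"

definition case_H :: "tpart set \<Rightarrow> bool" where
  "case_H C \<longleftrightarrow> sigma White \<otimes> sigma Black \<notin> C \<and> beta White Black White Black \<in> C"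

definition case_S :: "tpart set \<Rightarrow> bool" where
  "case_S C \<longleftrightarrow> sigma White \<otimes> sigma Black \<in> C \<and> beta White Black White Black \<in> C"

definition globally_colorized :: "tpart set \<Rightarrow> bool" where
  "globally_colorized C \<longleftrightarrow> pair_part White White \<otimes> pair_part Black Black \<in> C"

definition locally_colorized :: "tpart set \<Rightarrow> bool" where
  "locally_colorized C \<longleftrightarrow> \<not> globally_colorized C"


definition O_loc :: "tpart set" where
  "O_loc = generated {}"

definition H'_loc :: "tpart set" where
  "H'_loc = generated {beta White Black White Black}"

definition H_loc :: "nat \<Rightarrow> nat \<Rightarrow> tpart set" where
  "H_loc k d = generated {bpart k, bpart d \<otimes> verticolor (bpart d),
     beta White White Black Black, beta White Black White Black}"

definition S_loc :: "nat \<Rightarrow> nat \<Rightarrow> tpart set" where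
  "S_loc k d = generated {tensor_pow (sigma White) k, lambda_part d,
     beta White Black White Black, sigma White \<otimes> sigma Black}"

definition B_loc :: "nat \<Rightarrow> nat \<Rightarrow> tpart set" where
  "B_loc k d = generated {tensor_pow (sigma White) k, lambda_part d,
     sigma White \<otimes> sigma Black}"

text \<open>The third parameter is only used for \<open>r = 0\<close> and for \<open>r = d/2\<close> with \<open>d\<close> even.\<close>

definition B'_loc :: "nat \<Rightarrow> nat \<Rightarrow> nat \<Rightarrow> tpart set" where
  "B'_loc k d r = generated {tensor_pow (sigma White) k, lambda_part d, mu_part r,
     sigma White \<otimes> sigma Black}"

end

theory Submission
  imports Defs
begin

text \<open>
A category is determined by its partitions on the lower row, because a point of the upper row can be
bent down to the lower row and back (\<open>category_subset_if_words_subset\<close>). Such a partition is a word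
of colored letters: the label of a letter names its block, and letters without a label are
singletons. On words the category operations amount to inserting a word into another one, capping
two neighbouring letters of opposite colors (which joins their blocks), and reflecting; cyclic
rotation and the projection \<open>project\<close>, which turns a word \<open>wu\<close> into its reflection composed with
itself along \<open>w\<close>, follow. These rules form the locale \<open>word_category\<close>, and the classification is a
computation in it.

To show \<open>C = generated G\<close> it suffices to find \<open>G\<close> inside \<open>C\<close> and to check that every category \<open>D\<close>
containing \<open>G\<close> contains all words of \<open>C\<close>. The second part is always an induction on the word: a
noncrossing word contains a simple piece (an interval that is a block, or two letters of one block
with only singletons between them), a simpler word of \<open>C\<close> is obtained by removing or changing this
piece, and the generators allow this change to be undone inside \<open>D\<close>.

Without singletons and without the four-block \<open>\<circ>\<bullet>\<circ>\<bullet>\<close> all blocks are pairs; a pair of equal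
colors would make the category globally colorized, so only the noncrossing pairings with pairs of
opposite colors remain (\<open>pairings_subset\<close>). With the four-block \<open>\<circ>\<bullet>\<circ>\<bullet>\<close> but without
\<open>\<circ>\<circ>\<bullet>\<bullet>\<close> every interval block alternates in color (\<open>alternating_blocks_subset\<close>). With both
four-blocks any two neighbouring letters can be merged, so that only the color sums of blocks
matter: the color sums of the one-block words form a group \<open>k\<int>\<close>, those numbers \<open>n\<close> for which the
juxtaposition of a block of color sum \<open>n\<close> and its reflection occurs form a group \<open>d\<int>\<close>, and both
groups together determine the category (\<open>merging_subset\<close>).

If singletons occur, every letter can be cut off its block. The color sums of the words consisting
only of singletons form a group \<open>k\<int>\<close>. For two letters \<open>x, y\<close> of one block consider the color sums
\<open>n\<close> of the words between them. For the colors \<open>\<circ>, \<bullet>\<close> these numbers form a group \<open>d\<int>\<close>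
containing \<open>k\<int>\<close>, and for \<open>\<circ>, \<circ>\<close> they form the empty set or a coset of \<open>d\<int>\<close>, such that
\<open>n\<close> in the coset implies \<open>2(n + 1) \<in> d\<int>\<close>. The number 0 lies in the coset iff the category is globally
colorized. Hence the coset is that of \<open>-1\<close> or that of \<open>d/2 - 1\<close>, which is what \<open>\<mu>\<^sub>0\<close> and
\<open>\<mu>\<^sub>r\<close> with \<open>r = d/2\<close> express. The group \<open>k\<int>\<close> and the possible spacings determine the category,
given whether it contains the four-block \<open>\<circ>\<bullet>\<circ>\<bullet>\<close> (\<open>singleton_category_subset\<close>).
\<close>

section \<open>Partitions as fibres of labellings\<close>

definition pts :: "color list \<Rightarrow> color list \<Rightarrow> point set" where
  "pts us ls = Up ` {..<length us} \<union> Lo ` {..<length ls}"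

text \<open>Partitions are handled through labellings, because statements about blocks then become equations
between labels. The type of labels is left open so that each construction can use the sum type
that keeps its parts apart.\<close>

definition kernel_part :: "color list \<Rightarrow> color list \<Rightarrow> (point \<Rightarrow> 'a) \<Rightarrow> tpart" where
  "kernel_part us ls f = TPart us ls ((\<lambda>x. {y \<in> pts us ls. f y = f x}) ` pts us ls)"

lemma Up_in_pts [simp]: "Up i \<in> pts us ls \<longleftrightarrow> i < length us"
  and Lo_in_pts [simp]: "Lo i \<in> pts us ls \<longleftrightarrow> i < length ls"
  by (auto simp: pts_def)

lemma in_ptsE:
  assumes "x \<in> pts us ls"
  obtains i where "x = Up i" "i < length us" | j where "x = Lo j" "j < length ls"
  using assms by (auto simp: pts_def)

lemma upper_kernel_part [simp]: "upper (kernel_part us ls f) = us"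
  and lower_kernel_part [simp]: "lower (kernel_part us ls f) = ls"
  and points_kernel_part [simp]: "points (kernel_part us ls f) = pts us ls"
  by (simp_all add: kernel_part_def points_def pts_def)

lemma kernel_part_cong:
  assumes "\<And>x y. x \<in> pts us ls \<Longrightarrow> y \<in> pts us ls \<Longrightarrow> f x = f y \<longleftrightarrow> g x = g y"
  shows "kernel_part us ls f = kernel_part us ls g"
  unfolding kernel_part_def using assms by (auto intro!: image_cong)

lemma blocks_kernel_part:
  "blocks (kernel_part us ls f) = (\<lambda>x. {y \<in> pts us ls. f y = f x}) ` pts us ls"
  by (simp add: kernel_part_def)

text \<open>Labels can be taken in the natural numbers since a partition has finitely many blocks; this makes
the comparison of two categories a statement about a single type of labellings.\<close>

lemma ex_kernel_part:
  assumes "p \<in> AllPartitions"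
  shows "\<exists>f :: point \<Rightarrow> nat. p = kernel_part (upper p) (lower p) f"
proof -
  let ?P = "pts (upper p) (lower p)"
  have po: "partition_on ?P (blocks p)"
    using assms by (auto simp: AllPartitions_def Partitions_def points_def pts_def)
  have "finite ?P" by (simp add: pts_def)
  then have fin: "finite (blocks p)" using po finite_elements by blast
  from finite_imp_inj_to_nat_seg[OF fin] obtain e :: "point set \<Rightarrow> nat"
    where e: "inj_on e (blocks p)" by blast
  define B where "B x = (THE b. b \<in> blocks p \<and> x \<in> b)" for x
  have Beq: "B x = b" if "b \<in> blocks p" "x \<in> b" for b x
    unfolding B_def using that po
    by (intro the_equality) (auto simp: partition_on_def disjoint_def)
  have BI: "B x \<in> blocks p \<and> x \<in> B x" if "x \<in> ?P" for x
  proof -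
    have "x \<in> \<Union> (blocks p)" using that partition_onD1[OF po] by simp
    then obtain b where "b \<in> blocks p" "x \<in> b" by blast
    then show ?thesis using Beq by auto
  qed
  have fib: "{y \<in> ?P. e (B y) = e (B x)} = B x" if "x \<in> ?P" for x
  proof -
    have x: "B x \<in> blocks p" using BI[OF that] by simp
    have "e (B y) = e (B x) \<longleftrightarrow> y \<in> B x" if y: "y \<in> ?P" for y
    proof
      assume "e (B y) = e (B x)"
      then have "B y = B x" using inj_onD[OF e] x BI[OF y] by blast
      then show "y \<in> B x" using BI[OF y] by simp
    next
      assume "y \<in> B x"
      then show "e (B y) = e (B x)" using Beq[OF x] by simp
    qed
    moreover have "B x \<subseteq> ?P" using x partition_onD1[OF po] by blast
    ultimately show ?thesis by blast
  qed
  have "(\<lambda>x. {y \<in> ?P. e (B y) = e (B x)}) ` ?P = B ` ?P"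
    using fib by (intro image_cong) auto
  also have "\<dots> = blocks p"
  proof
    show "B ` ?P \<subseteq> blocks p" using BI by auto
    show "blocks p \<subseteq> B ` ?P"
    proof
      fix b assume b: "b \<in> blocks p"
      then have "b \<noteq> {}" using partition_onD3[OF po] by auto
      then obtain x where "x \<in> b" by blast
      moreover have "x \<in> ?P" using b \<open>x \<in> b\<close> partition_onD1[OF po] by blast
      ultimately show "b \<in> B ` ?P" using Beq[OF b] by (intro image_eqI[of _ _ x]) auto
    qed
  qed
  finally have "p = kernel_part (upper p) (lower p) (\<lambda>x. e (B x))"
    by (cases p) (simp add: kernel_part_def)
  then show ?thesis by blast
qed

lemma flip_flip [simp]: "flip (flip x) = x"
  by (cases x) auto

lemma flip_in_pts [simp]: "flip x \<in> pts us ls \<longleftrightarrow> x \<in> pts ls us"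
  by (cases x) auto

lemma involution_kernel_part:
  "involution (kernel_part us ls f) = kernel_part ls us (f \<circ> flip)"
proof -
  have im: "flip ` {y \<in> pts us ls. f y = f x} = {y \<in> pts ls us. f (flip y) = f x}" for x
    by (auto intro!: image_eqI[of y flip "flip y" for y])
  have p: "pts us ls = flip ` pts ls us"
    by (auto intro!: image_eqI[of y flip "flip y" for y])
  have "(`) flip ` blocks (kernel_part us ls f) = (\<lambda>x. {y \<in> pts ls us. f (flip y) = f x}) ` pts us ls"
    unfolding blocks_kernel_part image_image im ..
  also have "\<dots> = (\<lambda>x. {y \<in> pts ls us. f (flip y) = f (flip x)}) ` pts ls us"
    by (subst p) (simp add: image_image)
  finally show ?thesis
    by (simp add: involution_def kernel_part_def)
qed

lemma pts_append:
  "pts (us @ us') (ls @ ls') = pts us ls \<union> shift (length us) (length ls) ` pts us' ls'"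
proof (rule set_eqI)
  fix x
  show "x \<in> pts (us @ us') (ls @ ls') \<longleftrightarrow>
        x \<in> pts us ls \<union> shift (length us) (length ls) ` pts us' ls'"
  proof (cases x)
    case (Up i)
    have "Up i \<in> shift (length us) (length ls) ` pts us' ls' \<longleftrightarrow>
      i \<ge> length us \<and> i - length us < length us'"
      by (auto simp: image_iff pts_def intro!: bexI[of _ "Up (i - length us)"])
    then show ?thesis by (auto simp: Up)
  next
    case (Lo i)
    have "Lo i \<in> shift (length us) (length ls) ` pts us' ls' \<longleftrightarrow>
      i \<ge> length ls \<and> i - length ls < length ls'"
      by (auto simp: image_iff pts_def intro!: bexI[of _ "Lo (i - length ls)"])
    then show ?thesis by (auto simp: Lo)
  qed
qed

text \<open>Stated for an arbitrary labelling \<open>h\<close> of the result, so that each use can choose the labels that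
suit the next composition.\<close>

lemma tensor_kernel_part:
  assumes "\<And>x y. x \<in> pts us ls \<Longrightarrow> y \<in> pts us ls \<Longrightarrow> h x = h y \<longleftrightarrow> f x = f y"
    and "\<And>x y. x \<in> pts us' ls' \<Longrightarrow> y \<in> pts us' ls' \<Longrightarrow>
      h (shift (length us) (length ls) x) = h (shift (length us) (length ls) y) \<longleftrightarrow> g x = g y"
    and "\<And>x y. x \<in> pts us ls \<Longrightarrow> y \<in> pts us' ls' \<Longrightarrow> h x \<noteq> h (shift (length us) (length ls) y)"
  shows "kernel_part us ls f \<otimes> kernel_part us' ls' g = kernel_part (us @ us') (ls @ ls') h"
proof -
  let ?s = "shift (length us) (length ls)"
  let ?P = "pts us ls" and ?Q = "pts us' ls'"
  have 1: "{y \<in> ?P. f y = f x} = {y \<in> ?P \<union> ?s ` ?Q. h y = h x}" if "x \<in> ?P" for x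
  proof -
    have "f y = f x \<longleftrightarrow> h y = h x" if "y \<in> ?P" for y using assms(1) \<open>x \<in> ?P\<close> that by metis
    moreover have "h (?s y) \<noteq> h x" if "y \<in> ?Q" for y using assms(3) \<open>x \<in> ?P\<close> that by metis
    ultimately show ?thesis by auto
  qed
  have 2: "?s ` {y \<in> ?Q. g y = g x} = {y \<in> ?P \<union> ?s ` ?Q. h y = h (?s x)}" if "x \<in> ?Q" for x
  proof -
    have "g y = g x \<longleftrightarrow> h (?s y) = h (?s x)" if "y \<in> ?Q" for y using assms(2) \<open>x \<in> ?Q\<close> that by metis
    moreover have "h y \<noteq> h (?s x)" if "y \<in> ?P" for y using assms(3) \<open>x \<in> ?Q\<close> that by metis
    ultimately show ?thesis by auto
  qed
  have "(\<lambda>x. {y \<in> ?P \<union> ?s ` ?Q. h y = h x}) ` (?P \<union> ?s ` ?Q) =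
      (\<lambda>x. {y \<in> ?P. f y = f x}) ` ?P \<union> (\<lambda>x. ?s ` {y \<in> ?Q. g y = g x}) ` ?Q"
    unfolding image_Un image_image using 1 2 by (intro arg_cong2[of _ _ _ _ "(\<union>)"] image_cong) auto
  then show ?thesis
    by (simp add: tensor_def kernel_part_def pts_append image_image)
qed

lemma UN_fibres_square:
  "(\<Union>B \<in> (\<lambda>x. {y \<in> P. f y = f x}) ` P. g ` B \<times> g ` B) =
    {(g x, g y) | x y. x \<in> P \<and> y \<in> P \<and> f x = f y}"
proof (rule set_eqI; rule iffI)
  fix z assume "z \<in> (\<Union>B \<in> (\<lambda>x. {y \<in> P. f y = f x}) ` P. g ` B \<times> g ` B)"
  then obtain w x y where "w \<in> P" "x \<in> P" "y \<in> P" "f x = f w" "f y = f w" "z = (g x, g y)"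
    by auto
  then show "z \<in> {(g x, g y) | x y. x \<in> P \<and> y \<in> P \<and> f x = f y}"
    by (intro CollectI exI[of _ x] exI[of _ y]) simp
qed auto

lemma stack_rel_above:
  assumes "x \<in> pts us ms" "y \<in> pts us ms" "f x = f y"
  shows "(place_above x, place_above y) \<in> stack_rel p (kernel_part us ms f)"
  using assms by (auto simp: stack_rel_def blocks_kernel_part)

lemma stack_rel_below:
  assumes "x \<in> pts ms ls" "y \<in> pts ms ls" "g x = g y"
  shows "(place_below x, place_below y) \<in> stack_rel (kernel_part ms ls g) q"
  using assms by (auto simp: stack_rel_def blocks_kernel_part)

lemma sym_stack_rel: "sym (stack_rel p q)"
  by (auto simp: stack_rel_def sym_def)

text \<open>A labelling \<open>H\<close> of the stacked diagram that is constant on the blocks of both layers can only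
merge too much. Equality of labels is shown to imply connectedness by moving every outer point to
an anchor that is connected to it and lies in a part of the diagram where labels are understood.\<close>

lemma composition_kernel_part:
  fixes H :: "stack_point \<Rightarrow> 'c" and anchor :: "point \<Rightarrow> stack_point"
  assumes above: "\<And>x y. x \<in> pts us ms \<Longrightarrow> y \<in> pts us ms \<Longrightarrow> f x = f y \<Longrightarrow>
      H (place_above x) = H (place_above y)"
    and below: "\<And>x y. x \<in> pts ms ls \<Longrightarrow> y \<in> pts ms ls \<Longrightarrow> g x = g y \<Longrightarrow>
      H (place_below x) = H (place_below y)"
    and anchor: "\<And>x. x \<in> pts us ls \<Longrightarrow>
      (place_outer x, anchor x) \<in> (stack_rel (kernel_part ms ls g) (kernel_part us ms f))\<^sup>*"
    and complete: "\<And>x y. x \<in> pts us ls \<Longrightarrow> y \<in> pts us ls \<Longrightarrow>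
      H (place_outer x) = H (place_outer y) \<Longrightarrow>
      (anchor x, anchor y) \<in> (stack_rel (kernel_part ms ls g) (kernel_part us ms f))\<^sup>*"
  shows "composition (kernel_part ms ls g) (kernel_part us ms f) =
    kernel_part us ls (H \<circ> place_outer)"
proof -
  let ?R = "stack_rel (kernel_part ms ls g) (kernel_part us ms f)"
  have step: "H s = H t" if "(s, t) \<in> ?R" for s t
  proof -
    from that consider
        x y where "s = place_above x" "t = place_above y" "x \<in> pts us ms" "y \<in> pts us ms" "f x = f y"
      | x y where "s = place_below x" "t = place_below y" "x \<in> pts ms ls" "y \<in> pts ms ls" "g x = g y"
      unfolding stack_rel_def blocks_kernel_part UN_fibres_square by blast
    then show ?thesis
    proof cases
      case 1
      then show ?thesis using above[of x y] by simp
    next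
      case 2
      then show ?thesis using below[of x y] by simp
    qed
  qed
  have sound: "H s = H t" if "(s, t) \<in> ?R\<^sup>*" for s t
    using that by induction (auto dest: step)
  have sym: "(t, s) \<in> ?R\<^sup>*" if "(s, t) \<in> ?R\<^sup>*" for s t
    using that sym_rtrancl[OF sym_stack_rel] by (auto simp: sym_def)
  have iff: "(place_outer x, place_outer y) \<in> ?R\<^sup>* \<longleftrightarrow> H (place_outer x) = H (place_outer y)"
    if "x \<in> pts us ls" "y \<in> pts us ls" for x y
    using sound complete[OF that] anchor[OF that(1)] sym[OF anchor[OF that(2)]]
    by (meson rtrancl_trans)
  have "pts us ls // {(x, y). x \<in> pts us ls \<and> y \<in> pts us ls \<and>
      (place_outer x, place_outer y) \<in> ?R\<^sup>*} =
    (\<lambda>x. {y \<in> pts us ls. H (place_outer y) = H (place_outer x)}) ` pts us ls"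
    unfolding quotient_def UNION_singleton_eq_range
    by (rule image_cong[OF refl]) (auto simp: iff)
  then show ?thesis
    by (simp add: composition_def Let_def kernel_part_def pts_def)
qed

section \<open>Inserting, capping and rotating inside a category\<close>

lemma inv_color_inv_color [simp]: "inv_color (inv_color x) = x"
  by (cases x) auto

primrec column :: "point \<Rightarrow> nat" where
  "column (Up i) = i"
| "column (Lo j) = j"

text \<open>Labels of \<open>id \<otimes> p \<otimes> id\<close> where \<open>a\<close> points precede \<open>p\<close>, and \<open>p\<close> has \<open>m\<close> upper and \<open>n\<close>
lower points: the \<open>Inl\<close> labels number the vertical strings from the left, the \<open>Inr\<close> labels are those
of \<open>p\<close>.\<close>

primrec sandwich :: "nat \<Rightarrow> nat \<Rightarrow> nat \<Rightarrow> (point \<Rightarrow> 'a) \<Rightarrow> point \<Rightarrow> nat + 'a" where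
  "sandwich a m n g (Up i) =
    (if i < a then Inl i else if i < a + m then Inr (g (Up (i - a))) else Inl (i - m))"
| "sandwich a m n g (Lo j) =
    (if j < a then Inl j else if j < a + n then Inr (g (Lo (j - a))) else Inl (j - n))"

lemma kernel_tensor_assoc_sandwich:
  "kernel_part u u column \<otimes> (kernel_part us ls g \<otimes> kernel_part v v column) =
    kernel_part (u @ us @ v) (u @ ls @ v) (sandwich (length u) (length us) (length ls) g)"
proof -
  have 1: "kernel_part us ls g \<otimes> kernel_part v v column =
      kernel_part (us @ v) (ls @ v) (sandwich 0 (length us) (length ls) g)"
  proof (rule tensor_kernel_part)
    fix x y assume "x \<in> pts us ls" "y \<in> pts us ls"
    then show "sandwich 0 (length us) (length ls) g x = sandwich 0 (length us) (length ls) g y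
        \<longleftrightarrow> g x = g y"
      by (elim in_ptsE) auto
  next
    fix x y assume "x \<in> pts v v" "y \<in> pts v v"
    then show "sandwich 0 (length us) (length ls) g (shift (length us) (length ls) x) =
        sandwich 0 (length us) (length ls) g (shift (length us) (length ls) y)
        \<longleftrightarrow> column x = column y"
      by (elim in_ptsE) auto
  next
    fix x y assume "x \<in> pts us ls" "y \<in> pts v v"
    then show "sandwich 0 (length us) (length ls) g x \<noteq>
        sandwich 0 (length us) (length ls) g (shift (length us) (length ls) y)"
      by (elim in_ptsE) auto
  qed
  show ?thesis
    unfolding 1
  proof (rule tensor_kernel_part)
    let ?h = "sandwich (length u) (length us) (length ls) g"
    fix x y assume "x \<in> pts u u" "y \<in> pts u u"
    then show "?h x = ?h y \<longleftrightarrow> column x = column y"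
      by (elim in_ptsE) auto
  next
    let ?h = "sandwich (length u) (length us) (length ls) g"
    let ?k = "sandwich 0 (length us) (length ls) g"
    fix x y assume xy: "x \<in> pts (us @ v) (ls @ v)" "y \<in> pts (us @ v) (ls @ v)"
    have h: "?h (shift (length u) (length u) z) = map_sum ((+) (length u)) id (?k z)" for z
      by (cases z) auto
    have inj: "inj (map_sum ((+) (length u)) (id :: 'a \<Rightarrow> 'a))"
      by (rule sum.inj_map) auto
    show "?h (shift (length u) (length u) x) = ?h (shift (length u) (length u) y) \<longleftrightarrow> ?k x = ?k y"
      unfolding h by (rule inj_eq[OF inj])
  next
    let ?h = "sandwich (length u) (length us) (length ls) g"
    fix x y assume "x \<in> pts u u" "y \<in> pts (us @ v) (ls @ v)"
    then show "?h x \<noteq> ?h (shift (length u) (length u) y)"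
      by (elim in_ptsE) auto
  qed
qed

lemma one_block_kernel: "cs \<noteq> [] \<Longrightarrow> one_block cs = kernel_part [] cs (\<lambda>_. ())"
proof -
  assume "cs \<noteq> []"
  have "(\<lambda>x::point. {y \<in> pts [] cs. () = ()}) ` pts [] cs = {Lo ` {..<length cs}}"
    using \<open>cs \<noteq> []\<close> by (auto simp: pts_def)
  then show ?thesis using \<open>cs \<noteq> []\<close> by (auto simp: one_block_def kernel_part_def)
qed

locale partition_category =
  fixes C :: "tpart set"
  assumes category: "category C"
begin

lemma tensor_in: "p \<in> C \<Longrightarrow> q \<in> C \<Longrightarrow> p \<otimes> q \<in> C"
  and involution_in: "p \<in> C \<Longrightarrow> involution p \<in> C"
  and in_All: "p \<in> C \<Longrightarrow> p \<in> AllPartitions"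
  using category by (auto simp: category_def)

lemma composition_in:
  "kernel_part ms ls g \<in> C \<Longrightarrow> kernel_part us ms f \<in> C \<Longrightarrow>
    composition (kernel_part ms ls g) (kernel_part us ms f) \<in> C"
  using category by (auto simp: category_def composable_def)

lemma pair_in: "kernel_part [] [x, inv_color x] (\<lambda>_. ()) \<in> C"
proof -
  have "pair_part x (inv_color x) \<in> C"
    using category by (cases x) (auto simp: category_def)
  then show ?thesis by (simp add: pair_part_def one_block_kernel)
qed

lemma cap_in: "kernel_part [x, inv_color x] [] (\<lambda>_. ()) \<in> C"
  using involution_in[OF pair_in[of x]] by (simp add: involution_kernel_part o_def)

text \<open>Capping off a pair partition leaves nothing.\<close>

lemma empty_in: "kernel_part [] [] f \<in> C"
proof -
  have "composition (kernel_part [White, inv_color White] [] (\<lambda>_. ()))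
      (kernel_part [] [White, inv_color White] (\<lambda>_. ())) \<in> C"
    by (intro composition_in pair_in cap_in)
  also have "composition (kernel_part [White, inv_color White] [] (\<lambda>_. ()))
      (kernel_part [] [White, inv_color White] (\<lambda>_. ())) = kernel_part [] [] f"
    by (simp add: composition_def Let_def kernel_part_def pts_def quotient_def)
  finally show ?thesis .
qed

lemma identity_in: "kernel_part u u column \<in> C"
proof (induction u)
  case Nil
  show ?case by (rule empty_in)
next
  case (Cons x u)
  have "id_part x = kernel_part [x] [x] column"
    by (auto simp: id_part_def kernel_part_def pts_def)
  then have "kernel_part [x] [x] column \<in> C"
    using category by (cases x) (auto simp: category_def)
  then have "kernel_part [x] [x] column \<otimes> kernel_part u u column \<in> C"
    using Cons by (rule tensor_in)
  also have "kernel_part [x] [x] column \<otimes> kernel_part u u column =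
      kernel_part ([x] @ u) ([x] @ u) column"
  proof (rule tensor_kernel_part)
    fix p q assume "p \<in> pts u u" "q \<in> pts u u"
    then show "column (shift (length [x]) (length [x]) p) = column (shift (length [x]) (length [x]) q)
        \<longleftrightarrow> column p = column q"
      by (elim in_ptsE) auto
  next
    fix p q assume "p \<in> pts [x] [x]" "q \<in> pts u u"
    then show "column p \<noteq> column (shift (length [x]) (length [x]) q)"
      by (elim in_ptsE) auto
  qed auto
  finally show ?case by simp
qed

lemma sandwich_in:
  assumes "kernel_part us ls g \<in> C"
  shows "kernel_part (u @ us @ v) (u @ ls @ v) (sandwich (length u) (length us) (length ls) g) \<in> C"
  unfolding kernel_tensor_assoc_sandwich[symmetric]
  by (intro tensor_in identity_in assms)

text \<open>The composite of \<open>id \<otimes> p \<otimes> id\<close>, where \<open>p\<close> has labelling \<open>g\<close>, with a partition without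
upper points.\<close>

lemma insert_kernel_part:
  fixes f :: "point \<Rightarrow> 'a" and g :: "point \<Rightarrow> 'b"
  assumes uv: "kernel_part [] (u @ v) f \<in> C" and z: "kernel_part [] z g \<in> C"
  shows "kernel_part [] (u @ z @ v)
    (\<lambda>x. case sandwich (length u) 0 (length z) g x of Inl c \<Rightarrow> Inl (f (Lo c)) | Inr l \<Rightarrow> Inr l) \<in> C"
proof -
  let ?s = "sandwich (length u) 0 (length z) g"
  let ?F = "case_sum (\<lambda>c. Inl (f (Lo c))) Inr :: nat + 'b \<Rightarrow> 'a + 'b"
  define H where "H s = (case s of Top i \<Rightarrow> Inl (f (Lo 0)) | Mid i \<Rightarrow> ?F (Inl i) | Bot j \<Rightarrow> ?F (?s (Lo j)))"
    for s
  define anchor where "anchor x = (case ?s x of Inl c \<Rightarrow> Mid c | Inr _ \<Rightarrow> place_outer x)" for x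
  have bot: "kernel_part (u @ v) (u @ z @ v) ?s \<in> C"
    using sandwich_in[OF z, of u v] by simp
  have H_below: "H (place_below x) = ?F (?s x)" for x
    by (cases x) (auto simp: H_def)
  have "composition (kernel_part (u @ v) (u @ z @ v) ?s) (kernel_part [] (u @ v) f) =
      kernel_part [] (u @ z @ v) (H \<circ> place_outer)"
  proof (rule composition_kernel_part[where anchor = anchor])
    fix x y assume "x \<in> pts [] (u @ v)" "y \<in> pts [] (u @ v)" "f x = f y"
    then show "H (place_above x) = H (place_above y)"
      by (elim in_ptsE) (auto simp: H_def)
  next
    fix x y assume "?s x = ?s y"
    then show "H (place_below x) = H (place_below y)" by (simp add: H_below)
  next
    let ?R = "stack_rel (kernel_part (u @ v) (u @ z @ v) ?s) (kernel_part [] (u @ v) f)"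
    fix x assume x: "x \<in> pts [] (u @ z @ v)"
    then obtain j where j: "x = Lo j" "j < length (u @ z @ v)" by (elim in_ptsE) auto
    show "(place_outer x, anchor x) \<in> ?R\<^sup>*"
    proof (cases "?s x")
      case (Inl c)
      have "c < length (u @ v)" using Inl j by (auto split: if_splits)
      then have "(place_below (Lo j), place_below (Up c)) \<in> ?R"
        using Inl j by (intro stack_rel_below) auto
      then show ?thesis using j Inl by (simp add: anchor_def r_into_rtrancl)
    qed (simp add: anchor_def)
  next
    let ?R = "stack_rel (kernel_part (u @ v) (u @ z @ v) ?s) (kernel_part [] (u @ v) f)"
    fix x y assume x: "x \<in> pts [] (u @ z @ v)" and y: "y \<in> pts [] (u @ z @ v)"
      and eq: "H (place_outer x) = H (place_outer y)"
    have F: "?F (?s x) = ?F (?s y)" using eq x y by (auto simp: H_def elim!: in_ptsE)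
    have len: "c < length (u @ v)" if "?s x' = Inl c" "x' \<in> pts [] (u @ z @ v)" for x' c
      using that by (auto split: if_splits elim!: in_ptsE)
    show "(anchor x, anchor y) \<in> ?R\<^sup>*"
    proof (cases "?s x")
      case (Inl c)
      then obtain c' where c': "?s y = Inl c'" "f (Lo c) = f (Lo c')"
        using F by (cases "?s y") auto
      have "(place_above (Lo c), place_above (Lo c')) \<in> ?R"
        using len[OF Inl x] len[OF c'(1) y] c' by (intro stack_rel_above) auto
      then show ?thesis using Inl c' by (auto simp: anchor_def)
    next
      case (Inr l)
      then have "?s y = Inr l" using F by (cases "?s y") auto
      then have "(place_below x, place_below y) \<in> ?R"
        using Inr x y by (intro stack_rel_below) (auto elim!: in_ptsE)
      then show ?thesis using Inr \<open>?s y = Inr l\<close> x y by (auto simp: anchor_def elim!: in_ptsE)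
    qed
  qed
  then have "kernel_part [] (u @ z @ v) (H \<circ> place_outer) \<in> C"
    using composition_in[OF bot uv] by simp
  also have "kernel_part [] (u @ z @ v) (H \<circ> place_outer) = kernel_part [] (u @ z @ v) (\<lambda>x. ?F (?s x))"
    by (rule kernel_part_cong) (auto simp: H_def elim!: in_ptsE)
  finally show ?thesis .
qed

text \<open>The composite of \<open>id \<otimes> \<pi>\<^sup>* \<otimes> id\<close> with a partition without upper points joins the blocks of the two
neighbouring points that meet \<open>\<pi>\<^sup>*\<close>.\<close>

lemma cap_kernel_part:
  fixes f :: "point \<Rightarrow> 'a"
  assumes p: "kernel_part [] (u @ [x, inv_color x] @ v) f \<in> C"
  defines "m \<equiv> \<lambda>l. if l = f (Lo (length u)) then f (Lo (Suc (length u))) else l"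
  shows "kernel_part [] (u @ v)
    (\<lambda>x. m (f (Lo (if column x < length u then column x else column x + 2)))) \<in> C"
proof -
  let ?a = "length u"
  let ?ms = "u @ [x, inv_color x] @ v"
  let ?s = "sandwich ?a 2 0 (\<lambda>_. ())"
  define up where "up j = (if j < ?a then j else j + 2)" for j
  define H where "H s = (case s of Top i \<Rightarrow> f (Lo 0) | Mid i \<Rightarrow> m (f (Lo i)) | Bot j \<Rightarrow> m (f (Lo (up j))))"
    for s
  have bot: "kernel_part ?ms (u @ v) ?s \<in> C"
    using sandwich_in[OF cap_in, of u x v] by (simp add: numeral_2_eq_2)
  let ?R = "stack_rel (kernel_part ?ms (u @ v) ?s) (kernel_part [] ?ms f)"
  have edge: "(Mid i, Mid j) \<in> ?R" if "i < length ?ms" "j < length ?ms" "f (Lo i) = f (Lo j)" for i j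
    using stack_rel_above[of "Lo i" "[]" ?ms "Lo j" f] that by simp
  have link: "(Mid ?a, Mid (Suc ?a)) \<in> ?R" "(Mid (Suc ?a), Mid ?a) \<in> ?R"
    using stack_rel_below[of "Up ?a" ?ms "u @ v" "Up (Suc ?a)" ?s]
      stack_rel_below[of "Up (Suc ?a)" ?ms "u @ v" "Up ?a" ?s] by simp_all
  have "composition (kernel_part ?ms (u @ v) ?s) (kernel_part [] ?ms f) =
      kernel_part [] (u @ v) (H \<circ> place_outer)"
  proof (rule composition_kernel_part[where anchor = "\<lambda>x. Mid (up (column x))"])
    fix x y assume "x \<in> pts [] ?ms" "y \<in> pts [] ?ms" "f x = f y"
    then show "H (place_above x) = H (place_above y)"
      by (elim in_ptsE) (auto simp: H_def)
  next
    have H_below: "H (place_below z) = (case ?s z of Inl c \<Rightarrow> m (f (Lo (up c))) | Inr _ \<Rightarrow> f (Lo (Suc ?a)))"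
      if "z \<in> pts ?ms (u @ v)" for z
      using that
    proof (cases rule: in_ptsE)
      case (1 i)
      consider "i < ?a" | "i = ?a" | "i = Suc ?a" | k where "i = k + ?a + 2"
        using less_imp_Suc_add[of "Suc ?a" i] by (fastforce simp: less_Suc_eq_le not_less)
      then show ?thesis using 1 by cases (auto simp: H_def up_def m_def)
    qed (auto simp: H_def)
    fix y z assume "y \<in> pts ?ms (u @ v)" "z \<in> pts ?ms (u @ v)" "?s y = ?s z"
    then show "H (place_below y) = H (place_below z)" by (simp add: H_below)
  next
    fix y assume "y \<in> pts [] (u @ v)"
    then obtain j where j: "y = Lo j" "j < length (u @ v)" by (elim in_ptsE) auto
    have "(place_below (Lo j), place_below (Up (up j))) \<in> ?R"
      using j by (intro stack_rel_below) (auto simp: up_def)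
    then show "(place_outer y, Mid (up (column y))) \<in> ?R\<^sup>*"
      using j by auto
  next
    fix y z assume "y \<in> pts [] (u @ v)" "z \<in> pts [] (u @ v)"
      and eq: "H (place_outer y) = H (place_outer z)"
    then obtain i j where i: "y = Lo i" "i < length (u @ v)" and j: "z = Lo j" "j < length (u @ v)"
      by (elim in_ptsE) auto
    have l: "up i < length ?ms" "up j < length ?ms" "?a < length ?ms" "Suc ?a < length ?ms"
      using i j by (auto simp: up_def)
    have "m (f (Lo (up i))) = m (f (Lo (up j)))" using eq i j by (simp add: H_def)
    then consider "f (Lo (up i)) = f (Lo (up j))"
      | "f (Lo (up i)) = f (Lo ?a)" "f (Lo (up j)) = f (Lo (Suc ?a))"
      | "f (Lo (up i)) = f (Lo (Suc ?a))" "f (Lo (up j)) = f (Lo ?a)"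
      unfolding m_def by metis
    then show "(Mid (up (column y)), Mid (up (column z))) \<in> ?R\<^sup>*"
    proof cases
      case 1
      then show ?thesis using edge[OF l(1,2)] i j by auto
    next
      case 2
      have "(Mid (up i), Mid ?a) \<in> ?R" "(Mid (Suc ?a), Mid (up j)) \<in> ?R"
        using edge[OF l(1,3)] edge[OF l(4,2)] 2 by auto
      then have "(Mid (up i), Mid (up j)) \<in> ?R\<^sup>*" using link(1)
        by (meson r_into_rtrancl rtrancl_into_rtrancl)
      then show ?thesis using i j by simp
    next
      case 3
      have "(Mid (up i), Mid (Suc ?a)) \<in> ?R" "(Mid ?a, Mid (up j)) \<in> ?R"
        using edge[OF l(1,4)] edge[OF l(3,2)] 3 by auto
      then have "(Mid (up i), Mid (up j)) \<in> ?R\<^sup>*" using link(2)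
        by (meson r_into_rtrancl rtrancl_into_rtrancl)
      then show ?thesis using i j by simp
    qed
  qed
  then have "kernel_part [] (u @ v) (H \<circ> place_outer) \<in> C"
    using composition_in[OF bot p] by simp
  also have "kernel_part [] (u @ v) (H \<circ> place_outer) =
      kernel_part [] (u @ v) (\<lambda>x. m (f (Lo (up (column x)))))"
    by (rule kernel_part_cong) (auto simp: H_def elim!: in_ptsE)
  finally show ?thesis by (simp add: up_def)
qed

end

primrec rotate_labels :: "(point \<Rightarrow> 'a) \<Rightarrow> point \<Rightarrow> 'a" where
  "rotate_labels f (Up i) = f (Up (Suc i))"
| "rotate_labels f (Lo j) = (if j = 0 then f (Up 0) else f (Lo (j - 1)))"

context partition_category
begin

text \<open>Tensoring the identity string of the inverse color on the left and bending it up with a pair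
partition moves the leftmost upper point to the lower row.\<close>

lemma rotate_kernel_part:
  fixes f :: "point \<Rightarrow> 'a"
  assumes p: "kernel_part (x # us) ls f \<in> C"
  shows "kernel_part us (inv_color x # ls) (rotate_labels f) \<in> C"
proof -
  let ?ms = "inv_color x # x # us"
  let ?t = "sandwich 0 0 2 (\<lambda>_. ())" and ?b = "sandwich 1 (Suc (length us)) (length ls) f"
  define H where "H s = (case s of Top i \<Rightarrow> f (Up (Suc i)) | Mid i \<Rightarrow> f (Up (i - 1))
      | Bot j \<Rightarrow> if j = 0 then f (Up 0) else f (Lo (j - 1)))" for s
  define anchor where "anchor y = (case y of Up i \<Rightarrow> Mid (i + 2) | Lo j \<Rightarrow> if j = 0 then Mid 1 else Bot j)"
    for y
  have top: "kernel_part us ?ms ?t \<in> C"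
    using sandwich_in[OF pair_in[of "inv_color x"], of "[]" us] by (simp add: numeral_2_eq_2)
  have bot: "kernel_part ?ms (inv_color x # ls) ?b \<in> C"
    using sandwich_in[OF p, of "[inv_color x]" "[]"] by simp
  let ?R = "stack_rel (kernel_part ?ms (inv_color x # ls) ?b) (kernel_part us ?ms ?t)"
  have "composition (kernel_part ?ms (inv_color x # ls) ?b) (kernel_part us ?ms ?t) =
      kernel_part us (inv_color x # ls) (H \<circ> place_outer)"
  proof (rule composition_kernel_part[where anchor = anchor])
    have H_above: "H (place_above y) = (case ?t y of Inl c \<Rightarrow> f (Up (Suc c)) | Inr _ \<Rightarrow> f (Up 0))"
      for y
    proof (cases y)
      case (Lo j)
      consider "j = 0" | "j = 1" | k where "j = k + 2"
        by (metis One_nat_def add_2_eq_Suc' not0_implies_Suc)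
      then show ?thesis by cases (auto simp: H_def Lo)
    qed (simp add: H_def)
    fix y z assume "?t y = ?t z"
    then show "H (place_above y) = H (place_above z)" by (simp add: H_above)
  next
    fix y z assume "y \<in> pts ?ms (inv_color x # ls)" "z \<in> pts ?ms (inv_color x # ls)" "?b y = ?b z"
    then show "H (place_below y) = H (place_below z)"
      by (elim in_ptsE) (auto simp: H_def split: if_splits)
  next
    fix y assume "y \<in> pts us (inv_color x # ls)"
    then show "(place_outer y, anchor y) \<in> ?R\<^sup>*"
    proof (cases rule: in_ptsE)
      case (1 i)
      have "(place_above (Up i), place_above (Lo (i + 2))) \<in> ?R"
        using 1 by (intro stack_rel_above) auto
      then show ?thesis using 1 by (auto simp: anchor_def)
    next
      case (2 j)
      have "(place_below (Lo 0), place_below (Up 0)) \<in> ?R" by (intro stack_rel_below) auto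
      moreover have "(place_above (Lo 0), place_above (Lo 1)) \<in> ?R" by (intro stack_rel_above) auto
      ultimately have "(Bot 0, Mid 1) \<in> ?R\<^sup>*" by (auto intro: rtrancl_into_rtrancl)
      then show ?thesis using 2 by (auto simp: anchor_def)
    qed
  next
    fix y z assume y: "y \<in> pts us (inv_color x # ls)" and z: "z \<in> pts us (inv_color x # ls)"
      and eq: "H (place_outer y) = H (place_outer z)"
    have src: "\<exists>q \<in> pts ?ms (inv_color x # ls). anchor w = place_below q \<and> ?b q = Inr (H (place_outer w))"
      if "w \<in> pts us (inv_color x # ls)" for w
      using that
    proof (cases rule: in_ptsE)
      case (1 i)
      then show ?thesis by (intro bexI[of _ "Up (i + 2)"]) (auto simp: anchor_def H_def)
    next
      case (2 j)
      show ?thesis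
      proof (cases "j = 0")
        case True
        then show ?thesis using 2 by (intro bexI[of _ "Up 1"]) (auto simp: anchor_def H_def)
      next
        case False
        then show ?thesis using 2 by (intro bexI[of _ "Lo j"]) (auto simp: anchor_def H_def)
      qed
    qed
    from src[OF y] src[OF z] eq show "(anchor y, anchor z) \<in> ?R\<^sup>*"
      by (auto intro!: r_into_rtrancl stack_rel_below)
  qed
  then have "kernel_part us (inv_color x # ls) (H \<circ> place_outer) \<in> C"
    using composition_in[OF bot top] by simp
  also have "kernel_part us (inv_color x # ls) (H \<circ> place_outer) =
      kernel_part us (inv_color x # ls) (rotate_labels f)"
    by (rule kernel_part_cong) (auto simp: H_def elim!: in_ptsE)
  finally show ?thesis .
qed

text \<open>The involution exchanges the two rows, so moving a point up is moving a point down, seen upside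
down.\<close>

lemma unrotate_kernel_part:
  assumes "kernel_part us (inv_color x # ls) (rotate_labels f) \<in> C"
  shows "kernel_part (x # us) ls f \<in> C"
proof -
  have "kernel_part (inv_color x # ls) us (rotate_labels f \<circ> flip) \<in> C"
    using involution_in[OF assms] by (simp add: involution_kernel_part)
  from involution_in[OF rotate_kernel_part[OF this]]
  have "kernel_part (x # us) ls (rotate_labels (rotate_labels f \<circ> flip) \<circ> flip) \<in> C"
    by (simp add: involution_kernel_part)
  also have "rotate_labels (rotate_labels f \<circ> flip) \<circ> flip = f"
  proof
    fix y show "(rotate_labels (rotate_labels f \<circ> flip) \<circ> flip) y = f y" by (cases y) auto
  qed
  finally show ?thesis .
qed

lemma unroll_kernel_part:
  "kernel_part us ls f \<in> C \<Longrightarrow> kernel_part [] (rev (map inv_color us) @ ls)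
    (\<lambda>y. if column y < length us then f (Up (length us - 1 - column y))
         else f (Lo (column y - length us))) \<in> C"
proof (induction us arbitrary: ls f)
  case Nil
  have "kernel_part [] ls f = kernel_part [] ls (\<lambda>y. f (Lo (column y)))"
    by (rule kernel_part_cong) (auto elim!: in_ptsE)
  then show ?case using Nil by simp
next
  case (Cons x us)
  let ?n = "length us"
  let ?f = "\<lambda>y. if column y < ?n then rotate_labels f (Up (?n - 1 - column y))
         else rotate_labels f (Lo (column y - ?n))"
  let ?g = "\<lambda>y. if column y < Suc ?n then f (Up (Suc ?n - 1 - column y))
         else f (Lo (column y - Suc ?n))"
  have "kernel_part [] (rev (map inv_color us) @ inv_color x # ls) ?f \<in> C"
    by (rule Cons.IH[OF rotate_kernel_part[OF Cons.prems]])
  moreover have "?f = ?g"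
    by (rule ext) (auto simp: less_Suc_eq Suc_diff_Suc)
  ultimately have "kernel_part [] (rev (map inv_color us) @ inv_color x # ls) ?g \<in> C"
    by (simp only:)
  then show ?case
    by (simp only: list.map rev.simps append.assoc append_Cons append_Nil length_Cons)
qed

end

lemma category_subset_if_lower_subset:
  assumes "category C" "category D"
    and lower: "\<And>ls (f :: point \<Rightarrow> nat). kernel_part [] ls f \<in> C \<Longrightarrow> kernel_part [] ls f \<in> D"
  shows "C \<subseteq> D"
proof
  interpret C: partition_category C by unfold_locales fact
  interpret D: partition_category D by unfold_locales fact
  have main: "kernel_part us ls f \<in> D" if "kernel_part us ls f \<in> C" for us ls and f :: "point \<Rightarrow> nat"
    using that
    by (induction us arbitrary: ls f)
      (auto intro: lower D.unrotate_kernel_part C.rotate_kernel_part)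
  fix p assume "p \<in> C"
  moreover obtain f :: "point \<Rightarrow> nat" where "p = kernel_part (upper p) (lower p) f"
    using ex_kernel_part[OF C.in_All[OF \<open>p \<in> C\<close>]] by blast
  ultimately show "p \<in> D" using main by metis
qed

section \<open>Words of labelled letters\<close>

text \<open>The letter of a singleton may carry no label. This makes sequences of singletons literally
constant in their labels, so that no fresh names have to be managed for them.\<close>

type_synonym letter = "color \<times> nat option"

primrec word_label :: "letter list \<Rightarrow> point \<Rightarrow> nat + nat" where
  "word_label w (Up i) = Inr i"
| "word_label w (Lo j) = (case snd (w ! j) of None \<Rightarrow> Inr j | Some a \<Rightarrow> Inl a)"

definition word_part :: "letter list \<Rightarrow> tpart" where
  "word_part w = kernel_part [] (map fst w) (word_label w)"

definition same_block :: "letter list \<Rightarrow> nat \<Rightarrow> nat \<Rightarrow> bool" where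
  "same_block w i j \<longleftrightarrow> i = j \<or> snd (w ! i) = snd (w ! j) \<and> snd (w ! i) \<noteq> None"

definition labels :: "letter list \<Rightarrow> nat set" where
  "labels w = {a. Some a \<in> snd ` set w}"

definition relabel :: "(nat \<Rightarrow> nat) \<Rightarrow> letter list \<Rightarrow> letter list" where
  "relabel f w = map (apsnd (map_option f)) w"

definition reflect :: "letter list \<Rightarrow> letter list" where
  "reflect w = rev (map (apfst inv_color) w)"

lemma labels_simps [simp]:
  "labels [] = {}"
  "labels ((x, None) # w) = labels w"
  "labels ((x, Some a) # w) = insert a (labels w)"
  "labels (u @ v) = labels u \<union> labels v"
  by (auto simp: labels_def)

lemma finite_labels [simp]: "finite (labels w)"
proof -
  have "labels w \<subseteq> the ` snd ` set w" by (force simp: labels_def)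
  then show ?thesis by (rule finite_subset) simp
qed

lemma word_label_eq_iff: "word_label w (Lo i) = word_label w (Lo j) \<longleftrightarrow> same_block w i j"
  by (auto simp: same_block_def split: option.splits)

lemma kernel_part_eq_word_part:
  assumes "map fst w = cs"
    and "\<And>i j. i < length w \<Longrightarrow> j < length w \<Longrightarrow> f (Lo i) = f (Lo j) \<longleftrightarrow> same_block w i j"
  shows "kernel_part [] cs f = word_part w"
proof -
  have "length cs = length w" using assms(1) by auto
  then show ?thesis
    unfolding word_part_def assms(1)
    using assms(2) by (intro kernel_part_cong) (auto simp: word_label_eq_iff simp del: word_label.simps elim!: in_ptsE)
qed

lemma word_part_cong:
  assumes "map fst w = map fst w'"
    and "\<And>i j. i < length w \<Longrightarrow> j < length w \<Longrightarrow> same_block w i j \<longleftrightarrow> same_block w' i j"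
  shows "word_part w = word_part w'"
proof -
  have "length w = length w'" using assms(1) by (metis length_map)
  then show ?thesis
    using assms unfolding word_part_def[of w]
    by (intro kernel_part_eq_word_part) (auto simp: word_label_eq_iff simp del: word_label.simps)
qed

text \<open>The operations of a category, read on words. A cap that involves a singleton merely deletes: the
other letter leaves its block. All later arguments about categories use only these rules.\<close>

locale word_category =
  fixes L :: "letter list set"
  assumes pair_in: "[(x, Some a), (inv_color x, Some a)] \<in> L"
    and insert_in: "u @ v \<in> L \<Longrightarrow> z \<in> L \<Longrightarrow> labels z \<inter> labels (u @ v) = {} \<Longrightarrow> u @ z @ v \<in> L"
    and cap_None_left: "u @ [(x, None), (inv_color x, l)] @ v \<in> L \<Longrightarrow> u @ v \<in> L"
    and cap_None_right: "u @ [(x, l), (inv_color x, None)] @ v \<in> L \<Longrightarrow> u @ v \<in> L"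
    and cap_Some: "u @ [(x, Some a), (inv_color x, Some b)] @ v \<in> L \<Longrightarrow>
      relabel (\<lambda>c. if c = a then b else c) (u @ v) \<in> L"
    and relabel_in: "w \<in> L \<Longrightarrow> inj_on f (labels w) \<Longrightarrow> relabel f w \<in> L"
    and reflect_in: "w \<in> L \<Longrightarrow> reflect w \<in> L"
    and singleton_iff: "a \<notin> labels (u @ v) \<Longrightarrow> u @ [(x, Some a)] @ v \<in> L \<longleftrightarrow> u @ [(x, None)] @ v \<in> L"

definition words :: "tpart set \<Rightarrow> letter list set" where
  "words C = {w. word_part w \<in> C}"

lemma labelsI: "i < length w \<Longrightarrow> snd (w ! i) = Some a \<Longrightarrow> a \<in> labels w"
  unfolding labels_def by (metis (mono_tags) image_eqI mem_Collect_eq nth_mem)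

text \<open>A label that occurs only once names a singleton, just as the missing label does.\<close>

lemma word_singleton:
  assumes "a \<notin> labels (u @ v)"
  shows "word_part (u @ [(x, Some a)] @ v) = word_part (u @ [(x, None)] @ v)"
proof (rule word_part_cong)
  let ?W = "u @ [(x, Some a)] @ v" and ?W' = "u @ [(x, None)] @ v"
  have other: "?W ! i = ?W' ! i \<and> snd (?W ! i) \<noteq> Some a" if "i \<noteq> length u" "i < length ?W" for i
  proof -
    have "i < length u \<or> (\<exists>k < length v. i = Suc (length u) + k)"
    proof (cases "i < length u")
      case False
      then show ?thesis using that by (intro disjI2 exI[of _ "i - Suc (length u)"]) auto
    qed simp
    then show ?thesis using assms labelsI[of i u a] labelsI[of _ v a]
      by (auto simp: nth_append)
  qed
  fix i j assume ij: "i < length ?W" "j < length ?W"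
  show "same_block ?W i j \<longleftrightarrow> same_block ?W' i j"
    using other[OF _ ij(1)] other[OF _ ij(2)]
    by (cases "i = length u"; cases "j = length u") (auto simp: same_block_def)
qed simp

context partition_category
begin

lemma word_insert:
  assumes uv: "word_part (u @ v) \<in> C" and z: "word_part z \<in> C"
    and disj: "labels z \<inter> labels (u @ v) = {}"
  shows "word_part (u @ z @ v) \<in> C"
proof -
  let ?s = "sandwich (length u) 0 (length z) (word_label z)"
  let ?F = "case_sum (\<lambda>c. Inl (word_label (u @ v) (Lo c))) Inr"
  let ?W = "u @ z @ v"
  have sb: "?F (?s (Lo i)) = ?F (?s (Lo j)) \<longleftrightarrow> same_block ?W i j" if "i < length ?W" "j < length ?W" for i j
  proof -
    have pos: "(\<exists>k < length (u @ v). ?s (Lo i) = Inl k \<and> snd (?W ! i) = snd ((u @ v) ! k) \<and>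
        i = (if k < length u then k else k + length z)) \<or>
        (\<exists>k < length z. ?s (Lo i) = Inr (word_label z (Lo k)) \<and> snd (?W ! i) = snd (z ! k) \<and>
        i = length u + k)" if "i < length ?W" for i
    proof -
      consider "i < length u" | k where "i = length u + k" "k < length z"
        | k where "i = length u + length z + k" "k < length v"
        using \<open>i < length ?W\<close> by (metis add.assoc add_less_cancel_left le_Suc_ex length_append not_le)
      then show ?thesis
      proof cases
        case 1
        then show ?thesis by (auto simp: nth_append)
      next
        case (2 k)
        then show ?thesis by (auto simp: nth_append)
      next
        case (3 k)
        then show ?thesis
          by (intro disjI1 exI[of _ "length u + k"]) (auto simp: nth_append)
      qed
    qed
    have ne: "snd (z ! k) \<noteq> snd ((u @ v) ! k') \<or> snd (z ! k) = None"
      if "k < length z" "k' < length (u @ v)" for k k'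
      using labelsI[OF that(1)] labelsI[OF that(2)] disj by (metis disjoint_iff option.exhaust)
    from pos[OF that(1)] pos[OF that(2)] show ?thesis
    proof (elim disjE exE conjE)
      fix k k' assume *: "k < length (u @ v)" "?s (Lo i) = Inl k" "snd (?W ! i) = snd ((u @ v) ! k)"
        "i = (if k < length u then k else k + length z)"
        "k' < length (u @ v)" "?s (Lo j) = Inl k'" "snd (?W ! j) = snd ((u @ v) ! k')"
        "j = (if k' < length u then k' else k' + length z)"
      have "i = j \<longleftrightarrow> k = k'" using *(4,8) by (auto split: if_splits)
      then have "same_block ?W i j \<longleftrightarrow> same_block (u @ v) k k'"
        unfolding same_block_def *(3,7) by blast
      then show ?thesis unfolding *(2,6) by (simp add: word_label_eq_iff del: word_label.simps)
    next
      fix k k' assume *: "k < length z" "?s (Lo i) = Inr (word_label z (Lo k))" "snd (?W ! i) = snd (z ! k)"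
        "i = length u + k"
        "k' < length z" "?s (Lo j) = Inr (word_label z (Lo k'))" "snd (?W ! j) = snd (z ! k')"
        "j = length u + k'"
      have "same_block ?W i j \<longleftrightarrow> same_block z k k'"
        unfolding same_block_def *(3,7) using *(4,8) by auto
      then show ?thesis unfolding *(2,6) by (simp add: word_label_eq_iff del: word_label.simps)
    next
      fix k k' assume *: "k < length (u @ v)" "?s (Lo i) = Inl k" "snd (?W ! i) = snd ((u @ v) ! k)"
        "i = (if k < length u then k else k + length z)"
        "k' < length z" "?s (Lo j) = Inr (word_label z (Lo k'))" "snd (?W ! j) = snd (z ! k')"
        "j = length u + k'"
      have "i \<noteq> j" using *(4,5,8) by (auto split: if_splits)
      then have "\<not> same_block ?W i j"
        unfolding same_block_def *(3,7) using ne[OF *(5,1)] by auto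
      then show ?thesis unfolding *(2,6) by simp
    next
      fix k k' assume *: "k' < length (u @ v)" "?s (Lo j) = Inl k'" "snd (?W ! j) = snd ((u @ v) ! k')"
        "j = (if k' < length u then k' else k' + length z)"
        "k < length z" "?s (Lo i) = Inr (word_label z (Lo k))" "snd (?W ! i) = snd (z ! k)"
        "i = length u + k"
      have "i \<noteq> j" using *(4,5,8) by (auto split: if_splits)
      then have "\<not> same_block ?W i j"
        unfolding same_block_def *(3,7) using ne[OF *(5,1)] by auto
      then show ?thesis unfolding *(2,6) by simp
    qed
  qed
  have "kernel_part [] (map fst u @ map fst z @ map fst v) (\<lambda>x. ?F (?s x)) \<in> C"
    using insert_kernel_part[of "map fst u" "map fst v" "word_label (u @ v)" "map fst z" "word_label z"]
      uv z by (simp add: word_part_def)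
  also have "kernel_part [] (map fst u @ map fst z @ map fst v) (\<lambda>x. ?F (?s x)) = word_part ?W"
    using sb by (intro kernel_part_eq_word_part) auto
  finally show ?thesis .
qed

text \<open>The exact labels after a cap depend on whether the two letters carry labels, so the resulting word
\<open>w\<close> is described by its blocks: those of \<open>l\<close> and \<open>l'\<close> become one.\<close>

lemma word_cap:
  assumes p: "word_part (u @ [(x, l), (inv_color x, l')] @ v) \<in> C"
    and w: "map fst w = map fst (u @ v)"
    and same: "\<And>i j. i < length (u @ v) \<Longrightarrow> j < length (u @ v) \<Longrightarrow>
      same_block w i j \<longleftrightarrow> same_block (u @ v) i j \<or>
        (l \<noteq> None \<and> l' \<noteq> None \<and> {snd ((u @ v) ! i), snd ((u @ v) ! j)} \<subseteq> {l, l'})"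
  shows "word_part w \<in> C"
proof -
  let ?W = "u @ [(x, l), (inv_color x, l')] @ v"
  let ?a = "length u"
  define up where "up j = (if j < ?a then j else j + 2)" for j
  let ?f = "word_label ?W"
  let ?m = "\<lambda>l. if l = ?f (Lo ?a) then ?f (Lo (Suc ?a)) else l"
  have fa: "?f (Lo ?a) = (case l of None \<Rightarrow> Inr ?a | Some b \<Rightarrow> Inl b)"
    by (simp add: nth_append)
  have fb: "?f (Lo (Suc ?a)) = (case l' of None \<Rightarrow> Inr (Suc ?a) | Some b \<Rightarrow> Inl b)"
    by (simp add: nth_append)
  have fup: "?f (Lo (up i)) = (case snd ((u @ v) ! i) of None \<Rightarrow> Inr (up i) | Some b \<Rightarrow> Inl b)" for i
    by (auto simp: nth_append up_def split: option.split)
  have up: "up i \<noteq> ?a" "up i \<noteq> Suc ?a" "up i = up j \<longleftrightarrow> i = j" for i j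
    by (auto simp: up_def)
  have len: "length w = length (u @ v)" using w by (metis length_map)
  have "kernel_part [] (map fst (u @ v)) (\<lambda>y. ?m (?f (Lo (up (column y))))) \<in> C"
    using cap_kernel_part[of "map fst u" x "map fst v" ?f] p
    by (simp add: word_part_def up_def if_distrib cong: if_cong)
  also have "kernel_part [] (map fst (u @ v)) (\<lambda>y. ?m (?f (Lo (up (column y))))) = word_part w"
  proof (rule kernel_part_eq_word_part[OF w])
    fix i j assume ij: "i < length w" "j < length w"
    show "(?m (?f (Lo (up (column (Lo i))))) = ?m (?f (Lo (up (column (Lo j)))))) = same_block w i j"
      unfolding same[OF ij[unfolded len]]
      unfolding column.simps fa fb fup same_block_def
      using up(1)[of i] up(1)[of j] up(2)[of i] up(2)[of j] up(3)[of i j]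
      by (auto split: option.splits)
  qed
  finally show ?thesis .
qed

text \<open>The involution moves all points to the upper row, and bending them down again reverses their order
and inverts their colors.\<close>

lemma word_reflect:
  assumes "word_part w \<in> C"
  shows "word_part (reflect w) \<in> C"
proof -
  let ?n = "length w" and ?cs = "map fst w" and ?f = "word_label w"
  have "kernel_part ?cs [] (?f \<circ> flip) \<in> C"
    using involution_in[OF assms] by (simp add: word_part_def involution_kernel_part)
  from unroll_kernel_part[OF this]
  have "kernel_part [] (rev (map inv_color ?cs)) (\<lambda>y. if column y < length ?cs
      then (?f \<circ> flip) (Up (length ?cs - 1 - column y)) else (?f \<circ> flip) (Lo (column y - length ?cs))) \<in> C"
    (is "kernel_part _ _ ?g \<in> C") by (simp only: append_Nil2)
  also have "kernel_part [] (rev (map inv_color ?cs)) ?g = word_part (reflect w)"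
  proof (rule kernel_part_eq_word_part)
    show "map fst (reflect w) = rev (map inv_color ?cs)"
      by (simp add: reflect_def rev_map comp_def)
    fix i j assume ij: "i < length (reflect w)" "j < length (reflect w)"
    have "same_block (reflect w) i j \<longleftrightarrow> same_block w (?n - 1 - i) (?n - 1 - j)"
      using ij by (auto simp: same_block_def reflect_def rev_nth)
    then show "?g (Lo i) = ?g (Lo j) \<longleftrightarrow> same_block (reflect w) i j"
      using ij by (simp add: reflect_def word_label_eq_iff del: word_label.simps)
  qed
  finally show ?thesis .
qed

lemma word_relabel:
  assumes "word_part w \<in> C" "inj_on f (labels w)"
  shows "word_part (relabel f w) \<in> C"
proof -
  have "word_part w = word_part (relabel f w)"
  proof (rule word_part_cong)
    fix i j assume ij: "i < length w" "j < length w"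
    then show "same_block w i j \<longleftrightarrow> same_block (relabel f w) i j"
      using assms(2) labelsI[OF ij(1)] labelsI[OF ij(2)]
      by (cases "snd (w ! i)"; cases "snd (w ! j)") (auto simp: same_block_def relabel_def inj_on_eq_iff)
  qed (simp add: relabel_def)
  then show ?thesis using assms(1) by simp
qed

lemma word_category_words: "word_category (words C)"
proof
  fix x a
  have "kernel_part [] [x, inv_color x] (\<lambda>_. ()) = word_part [(x, Some a), (inv_color x, Some a)]"
    by (rule kernel_part_eq_word_part) (auto simp: same_block_def less_Suc_eq)
  then show "[(x, Some a), (inv_color x, Some a)] \<in> words C"
    using pair_in[of x] by (simp add: words_def)
next
  fix u v z assume "u @ v \<in> words C" "z \<in> words C" "labels z \<inter> labels (u @ v) = {}"
  then show "u @ z @ v \<in> words C" unfolding words_def mem_Collect_eq by (rule word_insert)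
next
  fix u x l v assume "u @ [(x, None), (inv_color x, l)] @ v \<in> words C"
  then show "u @ v \<in> words C" unfolding words_def by (auto intro: word_cap)
next
  fix u x l v assume "u @ [(x, l), (inv_color x, None)] @ v \<in> words C"
  then show "u @ v \<in> words C" unfolding words_def by (auto intro: word_cap)
next
  fix u x a b v assume p: "u @ [(x, Some a), (inv_color x, Some b)] @ v \<in> words C"
  let ?f = "\<lambda>c. if c = a then b else c"
  have "word_part (relabel ?f (u @ v)) \<in> C"
  proof (rule word_cap)
    show "word_part (u @ [(x, Some a), (inv_color x, Some b)] @ v) \<in> C" using p by (simp add: words_def)
    show "map fst (relabel ?f (u @ v)) = map fst (u @ v)" by (simp add: relabel_def)
    fix i j assume "i < length (u @ v)" "j < length (u @ v)"
    then have "snd (relabel ?f (u @ v) ! i) = map_option ?f (snd ((u @ v) ! i))"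
      "snd (relabel ?f (u @ v) ! j) = map_option ?f (snd ((u @ v) ! j))"
      unfolding relabel_def by (simp_all only: nth_map snd_apsnd length_append)
    then show "same_block (relabel ?f (u @ v)) i j \<longleftrightarrow> same_block (u @ v) i j \<or>
        (Some a \<noteq> None \<and> Some b \<noteq> None \<and> {snd ((u @ v) ! i), snd ((u @ v) ! j)} \<subseteq> {Some a, Some b})"
      unfolding same_block_def
      by (cases "snd ((u @ v) ! i)"; cases "snd ((u @ v) ! j)") auto
  qed
  then show "relabel ?f (u @ v) \<in> words C" by (simp add: words_def)
next
  fix w and f :: "nat \<Rightarrow> nat" assume "w \<in> words C" "inj_on f (labels w)"
  then show "relabel f w \<in> words C" unfolding words_def by (auto intro: word_relabel)
next
  fix w assume "w \<in> words C"
  then show "reflect w \<in> words C" unfolding words_def by (auto intro: word_reflect)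
next
  fix a u v x assume "a \<notin> labels (u @ v)"
  then show "u @ [(x, Some a)] @ v \<in> words C \<longleftrightarrow> u @ [(x, None)] @ v \<in> words C"
    unfolding words_def mem_Collect_eq using word_singleton by simp
qed

end

text \<open>By rotation every partition is equivalent to one with an empty upper row.\<close>

lemma category_subset_if_words_subset:
  assumes "category C" "category D" "words C \<subseteq> words D"
  shows "C \<subseteq> D"
proof (rule category_subset_if_lower_subset[OF assms(1,2)])
  fix ls :: "color list" and f :: "point \<Rightarrow> nat"
  let ?w = "map (\<lambda>i. (ls ! i, Some (f (Lo i)))) [0..<length ls]"
  have "kernel_part [] ls f = word_part ?w"
    by (rule kernel_part_eq_word_part) (auto simp: same_block_def comp_def map_nth)
  then show "kernel_part [] ls f \<in> C \<Longrightarrow> kernel_part [] ls f \<in> D"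
    using assms(3) by (auto simp: words_def)
qed

section \<open>Calculus of words\<close>

lemma relabel_simps [simp]:
  "relabel f [] = []"
  "relabel f ((x, None) # w) = (x, None) # relabel f w"
  "relabel f ((x, Some a) # w) = (x, Some (f a)) # relabel f w"
  "relabel f (u @ v) = relabel f u @ relabel f v"
  by (simp_all add: relabel_def)

lemma word_induct [case_names Nil None Some]:
  assumes "P []" "\<And>x w. P w \<Longrightarrow> P ((x, None) # w)" "\<And>x a w. P w \<Longrightarrow> P ((x, Some a) # w)"
  shows "P (w :: letter list)"
proof (induction w)
  case (Cons p w)
  then show ?case using assms by (cases p; cases "snd p") auto
qed (rule assms)

lemma relabel_cong: "(\<And>a. a \<in> labels w \<Longrightarrow> f a = g a) \<Longrightarrow> relabel f w = relabel g w"
  by (induction w rule: word_induct) auto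

lemma relabel_ident: "(\<And>a. a \<in> labels w \<Longrightarrow> f a = a) \<Longrightarrow> relabel f w = w"
  by (induction w rule: word_induct) auto

lemma relabel_fresh [simp]: "c \<notin> labels w \<Longrightarrow> relabel (\<lambda>d. if d = c then a else d) w = w"
  by (rule relabel_ident) auto

lemma relabel_relabel: "relabel f (relabel g w) = relabel (f \<circ> g) w"
  by (induction w rule: word_induct) auto

lemma labels_relabel [simp]: "labels (relabel f w) = f ` labels w"
  by (induction w rule: word_induct) auto

lemma reflect_simps [simp]:
  "reflect [] = []"
  "reflect ((x, l) # w) = reflect w @ [(inv_color x, l)]"
  "reflect (u @ v) = reflect v @ reflect u"
  by (simp_all add: reflect_def)

lemma labels_reflect [simp]: "labels (reflect w) = labels w"
  by (auto simp: labels_def reflect_def image_iff)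

definition solid :: "nat \<Rightarrow> color list \<Rightarrow> letter list" where
  "solid a v = map (\<lambda>x. (x, Some a)) v"

definition singles :: "color list \<Rightarrow> letter list" where
  "singles v = map (\<lambda>x. (x, None)) v"

definition opposite :: "color list \<Rightarrow> color list" where
  "opposite v = rev (map inv_color v)"

primrec charge :: "color \<Rightarrow> int" where
  "charge White = 1"
| "charge Black = -1"

definition color_sum :: "color list \<Rightarrow> int" where
  "color_sum v = sum_list (map charge v)"

lemma solid_simps [simp]:
  "solid a [] = []" "solid a (x # v) = (x, Some a) # solid a v"
  "solid a (u @ v) = solid a u @ solid a v"
  by (simp_all add: solid_def)

lemma singles_simps [simp]:
  "singles [] = []" "singles (x # v) = (x, None) # singles v"
  "singles (u @ v) = singles u @ singles v"
  by (simp_all add: singles_def)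

lemma labels_singles [simp]: "labels (singles v) = {}"
  by (induction v) auto

lemma labels_solid: "labels (solid a v) = (if v = [] then {} else {a})"
  by (induction v) auto

lemma relabel_singles [simp]: "relabel f (singles v) = singles v"
  by (induction v) auto

lemma relabel_solid [simp]: "relabel f (solid a v) = solid (f a) v"
  by (induction v) auto

lemma opposite_simps [simp]:
  "opposite [] = []" "opposite (x # v) = opposite v @ [inv_color x]"
  "opposite (u @ v) = opposite v @ opposite u" "opposite v = [] \<longleftrightarrow> v = []"
  by (simp_all add: opposite_def)

lemma opposite_opposite [simp]: "opposite (opposite v) = v"
  by (induction v) auto

lemma reflect_singles [simp]: "reflect (singles v) = singles (opposite v)"
  by (induction v) auto

lemma reflect_solid [simp]: "reflect (solid a v) = solid a (opposite v)"
  by (induction v) auto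

lemma charge_inv_color [simp]: "charge (inv_color x) = - charge x"
  by (cases x) auto

lemma color_sum_simps [simp]:
  "color_sum [] = 0" "color_sum (x # v) = charge x + color_sum v"
  "color_sum (u @ v) = color_sum u + color_sum v"
  by (simp_all add: color_sum_def)

lemma color_sum_opposite [simp]: "color_sum (opposite v) = - color_sum v"
  by (induction v) auto

lemma color_sum_replicate [simp]: "color_sum (replicate n x) = int n * charge x"
  by (induction n) (auto simp: algebra_simps)

lemma ex_color_sum: "\<exists>v. color_sum v = n"
proof (cases "n \<ge> 0")
  case True
  then show ?thesis by (intro exI[of _ "replicate (nat n) White"]) simp
next
  case False
  then show ?thesis by (intro exI[of _ "replicate (nat (- n)) Black"]) simp
qed

lemma inv_color_neq [simp]: "inv_color x \<noteq> x" "x \<noteq> inv_color x"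
  by (cases x; simp)+

lemma neq_iff_inv_color: "x \<noteq> y \<longleftrightarrow> y = inv_color x"
  by (cases x; cases y) auto

lemma constant_or_adjacent_opposite:
  "v = replicate (length v) (hd v) \<or> (\<exists>v1 x v2. v = v1 @ [x, inv_color x] @ v2)"
proof (induction v)
  case (Cons x v)
  show ?case
  proof (cases v)
    case (Cons y v')
    show ?thesis
    proof (cases "x = y")
      case True
      from \<open>v = replicate (length v) (hd v) \<or> _\<close> show ?thesis
      proof
        assume "v = replicate (length v) (hd v)"
        then show ?thesis using True Cons by simp
      next
        assume "\<exists>v1 x v2. v = v1 @ [x, inv_color x] @ v2"
        then obtain v1 z v2 where "v = v1 @ [z, inv_color z] @ v2" by blast
        then have "x # v = (x # v1) @ [z, inv_color z] @ v2" by simp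
        then show ?thesis by blast
      qed
    next
      case False
      then have "x # v = [] @ [x, inv_color x] @ v'" using Cons neq_iff_inv_color by auto
      then show ?thesis by blast
    qed
  qed simp
qed simp

text \<open>A nonempty word of color sum zero is not constant, hence contains two neighbours of opposite
colors. This turns every cancellation of words of color sum zero into a sequence of caps.\<close>

lemma color_sum_zero_induct [consumes 1, case_names Nil Insert]:
  assumes "color_sum z = 0" and "P []"
    and "\<And>z1 x z2. color_sum (z1 @ z2) = 0 \<Longrightarrow> P (z1 @ z2) \<Longrightarrow> P (z1 @ [x, inv_color x] @ z2)"
  shows "P z"
  using assms(1)
proof (induction "length z" arbitrary: z rule: less_induct)
  case less
  show ?case
  proof (cases "z = []")
    case False
    have "z \<noteq> replicate (length z) (hd z)"
    proof
      assume "z = replicate (length z) (hd z)"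
      then have "color_sum z = int (length z) * charge (hd z)" by (metis color_sum_replicate)
      then show False using less.prems False by (cases "hd z") auto
    qed
    then obtain z1 x z2 where z: "z = z1 @ [x, inv_color x] @ z2"
      using constant_or_adjacent_opposite by blast
    have "color_sum (z1 @ z2) = 0" using less.prems by (simp add: z)
    moreover have "P (z1 @ z2)" using less.hyps[of "z1 @ z2"] less.prems by (simp add: z)
    ultimately show ?thesis unfolding z by (rule assms(3))
  qed (use assms in simp)
qed

lemma ex_fresh: "\<exists>c. c \<notin> labels w"
  using ex_new_if_finite[OF infinite_UNIV_nat finite_labels] by blast

context word_category
begin

lemma Nil_in: "[] \<in> L"
  using cap_Some[of "[]" White 0 0 "[]"] pair_in[of White 0] by simp

lemma append_in: "u \<in> L \<Longrightarrow> v \<in> L \<Longrightarrow> labels u \<inter> labels v = {} \<Longrightarrow> u @ v \<in> L"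
  using insert_in[of u "[]" v] by auto

lemma cap_equal: "u @ [(x, Some a), (inv_color x, Some a)] @ v \<in> L \<Longrightarrow> u @ v \<in> L"
  using cap_Some[of u x a a v] by (simp add: relabel_ident del: relabel_simps)

lemma insert_pair_in:
  assumes "u @ v \<in> L" "c \<notin> labels (u @ v)"
  shows "u @ [(x, Some c), (inv_color x, Some c)] @ v \<in> L"
  using assms pair_in by (intro insert_in) auto

text \<open>The letter \<open>x\<close> can be moved around the word \<open>w\<close> by inserting \<open>x # w\<close> into a pair whose left point is
then capped with \<open>x\<close>.\<close>

lemma rotate_one:
  assumes "(x, l) # w \<in> L"
  shows "w @ [(x, l)] \<in> L"
proof -
  obtain c where c: "c \<notin> labels ((x, l) # w)" using ex_fresh by blast
  then have cw: "c \<notin> labels w" by (cases l) auto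
  have "[(inv_color x, Some c)] @ ((x, l) # w) @ [(x, Some c)] \<in> L"
    using assms c pair_in[of "inv_color x" c] by (intro insert_in) (auto simp: insert_commute)
  then have *: "[] @ [(inv_color x, Some c), (inv_color (inv_color x), l)] @ (w @ [(x, Some c)]) \<in> L" by simp
  show ?thesis
  proof (cases l)
    case None
    then have "w @ [(x, Some c)] \<in> L" using cap_None_right[of "[]" "inv_color x" "Some c"] * by simp
    then show ?thesis using singleton_iff[of c w "[]" x] cw None by simp
  next
    case (Some a)
    have "relabel (\<lambda>d. if d = c then a else d) w = w" using cw by (intro relabel_ident) auto
    then show ?thesis using cap_Some[of "[]" "inv_color x" c a "w @ [(x, Some c)]"] * Some by simp
  qed
qed

lemma rotate: "u @ v \<in> L \<Longrightarrow> v @ u \<in> L"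
proof (induction u arbitrary: v)
  case (Cons p u)
  then show ?case using rotate_one[of "fst p" "snd p" "u @ v"] Cons.IH[of "v @ [p]"] by simp
qed simp

lemma rotate_iff: "u @ v \<in> L \<longleftrightarrow> v @ u \<in> L"
  using rotate by blast

lemma solid_in_iff: "solid a v \<in> L \<longleftrightarrow> solid b v \<in> L"
  using relabel_in[of "solid a v" "\<lambda>_. b"] relabel_in[of "solid b v" "\<lambda>_. a"]
  by (auto simp: labels_solid)

text \<open>Opposite neighbours among singletons can be capped without effect on the other letters.\<close>

lemma singles_remove:
  assumes "color_sum z = 0" "u @ singles z @ w \<in> L"
  shows "u @ w \<in> L"
  using assms
proof (induction rule: color_sum_zero_induct)
  case (Insert z1 x z2)
  then show ?case using cap_None_left[of "u @ singles z1" x None "singles z2 @ w"] by simp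
qed simp

lemma solid_remove:
  assumes "color_sum z = 0" "u @ solid a z @ w \<in> L"
  shows "u @ w \<in> L"
  using assms
proof (induction rule: color_sum_zero_induct)
  case (Insert z1 x z2)
  then show ?case using cap_equal[of "u @ solid a z1" x a "solid a z2 @ w"] by simp
qed simp

text \<open>One letter of \<open>w\<close> after the other is capped with its mirror image. The function \<open>f\<close> gives the current
label of the mirror image of a block: it is the fresh label \<open>a + N\<close> until a letter of the block \<open>a\<close>
has been capped, and \<open>a\<close> afterwards.\<close>

lemma project_aux:
  assumes "relabel f (reflect u) @ relabel f (reflect w) @ w @ u \<in> L"
    and "\<And>a. a \<in> labels (w @ u) \<Longrightarrow> f a = a \<or> f a = a + N"
    and "labels (w @ u) \<subseteq> {..<N}"
  shows "relabel (\<lambda>a. if a \<in> labels w then a else f a) (reflect u) @ u \<in> L"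
  using assms
proof (induction w arbitrary: f)
  case (Cons p w)
  obtain x l where p: "p = (x, l)" by fastforce
  show ?case
  proof (cases l)
    case None
    have "relabel f (reflect u) @ relabel f (reflect w) @ w @ u \<in> L"
      using cap_None_left[of "relabel f (reflect u) @ relabel f (reflect w)" "inv_color x" None "w @ u"]
        Cons.prems(1) by (simp add: p None)
    then show ?thesis using Cons.IH[of f] Cons.prems by (simp add: p None)
  next
    case (Some a)
    let ?g = "\<lambda>c. if c = f a then a else c"
    have less: "c < N" if "c \<in> labels (w @ u) \<union> {a}" for c
      using Cons.prems(3) that by (auto simp: p Some)
    have f: "f c = c \<or> f c = c + N" if "c \<in> labels (w @ u) \<union> {a}" for c
      using Cons.prems(2)[of c] that by (auto simp: p Some)
    have gf: "?g (f c) = (f(a := a)) c" if "c \<in> labels (w @ u)" for c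
      using f[of c] f[of a] less[of c] less[of a] that by auto
    have g: "?g c = c" if "c \<in> labels (w @ u)" for c
      using f[of a] less[of c] that by auto
    have 1: "relabel ?g (relabel f (reflect y)) = relabel (f(a := a)) (reflect y)"
      if "labels y \<subseteq> labels (w @ u)" for y
      unfolding relabel_relabel
    proof (rule relabel_cong)
      fix d assume "d \<in> labels (reflect y)"
      then show "(?g \<circ> f) d = (f(a := a)) d"
        using gf[of d] that unfolding o_apply labels_reflect by blast
    qed
    have 2: "relabel ?g y = y" if "labels y \<subseteq> labels (w @ u)" for y
    proof (rule relabel_ident)
      fix d assume "d \<in> labels y"
      then show "?g d = d" using g[of d] that by blast
    qed
    have "relabel ?g ((relabel f (reflect u) @ relabel f (reflect w)) @ w @ u) \<in> L"
      using cap_Some[of "relabel f (reflect u) @ relabel f (reflect w)" "inv_color x" "f a" a "w @ u"]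
        Cons.prems(1) by (simp add: p Some)
    then have "relabel (f(a := a)) (reflect u) @ relabel (f(a := a)) (reflect w) @ w @ u \<in> L"
      using 1[of u] 1[of w] 2[of u] 2[of w] by simp
    then have "relabel (\<lambda>b. if b \<in> labels w then b else (f(a := a)) b) (reflect u) @ u \<in> L"
    proof (rule Cons.IH)
      show "labels (w @ u) \<subseteq> {..<N}" using Cons.prems(3) by (simp add: p Some)
      fix c assume "c \<in> labels (w @ u)"
      then show "(f(a := a)) c = c \<or> (f(a := a)) c = c + N" using f[of c] by simp
    qed
    also have "(\<lambda>b. if b \<in> labels w then b else (f(a := a)) b) =
        (\<lambda>b. if b \<in> labels (p # w) then b else f b)"
      by (auto simp: p Some)
    finally show ?thesis .
  qed
qed simp

text \<open>The word \<open>wu\<close> is composed with its own reflection along \<open>w\<close>: blocks of \<open>u\<close> that reach into \<open>w\<close> are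
joined to their mirror images, the other blocks of \<open>u\<close> are merely duplicated. This isolates the
part \<open>u\<close> of a partition.\<close>

lemma project:
  assumes "w @ u \<in> L"
  shows "\<exists>N. labels (w @ u) \<subseteq> {..<N} \<and>
    relabel (\<lambda>a. if a \<in> labels w then a else a + N) (reflect u) @ u \<in> L"
proof -
  obtain N where N: "labels (w @ u) \<subseteq> {..<N}"
    using finite_labels[of "w @ u"] unfolding finite_nat_set_iff_bounded by blast
  have "relabel (\<lambda>a. a + N) (reflect (w @ u)) \<in> L"
    by (intro relabel_in reflect_in assms) (auto simp: inj_on_def)
  then have "relabel (\<lambda>a. a + N) (reflect (w @ u)) @ (w @ u) \<in> L"
    using N by (intro append_in assms) auto
  then have "relabel (\<lambda>a. if a \<in> labels w then a else a + N) (reflect u) @ u \<in> L"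
    using N by (intro project_aux[where N = N]) auto
  then show ?thesis using N by blast
qed

text \<open>Projecting onto a singleton leaves the singleton and its mirror image.\<close>

lemma singleton_pair_in:
  assumes "u @ [(x, None)] @ v \<in> L"
  shows "singles [White, Black] \<in> L"
proof -
  have "(v @ u) @ [(x, None)] \<in> L" using rotate[of "u @ [(x, None)]" v] assms by simp
  from project[OF this] have "[(inv_color x, None)] @ [(x, None)] \<in> L" by auto
  then show ?thesis using rotate by (cases x) fastforce+
qed

lemma two_solids_relabel:
  assumes "solid a v @ solid b w \<in> L" "a \<noteq> b" "c \<noteq> d"
  shows "solid c v @ solid d w \<in> L"
proof -
  let ?f = "\<lambda>e. if e = a then c else d"
  have sub: "labels (solid a v @ solid b w) \<subseteq> {a, b}" by (auto simp: labels_solid)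
  have inj: "inj_on ?f {a, b}" using assms by (auto simp: inj_on_def)
  have "relabel ?f (solid a v @ solid b w) \<in> L"
    by (rule relabel_in[OF assms(1) inj_on_subset[OF inj sub]])
  then show ?thesis using assms by simp
qed

lemma project_block:
  assumes "u @ solid a v @ w \<in> L" "a \<notin> labels (u @ w)" "c \<noteq> d"
  shows "solid c (opposite v) @ solid d v \<in> L"
proof (cases "v = []")
  case False
  have "(w @ u) @ solid a v \<in> L" using rotate[of "u @ solid a v" w] assms by simp
  from project[OF this] obtain N where "a < N" "solid (a + N) (opposite v) @ solid a v \<in> L"
    using assms False by (auto simp: labels_solid)
  then show ?thesis using two_solids_relabel[of "a + N" "opposite v" a v c d] assms by simp
qed (simp add: Nil_in)

lemma project_block_part:
  assumes "u @ solid a v @ w \<in> L" "a \<in> labels (u @ w)"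
  shows "solid a (opposite v @ v) \<in> L"
proof -
  have "(w @ u) @ solid a v \<in> L" using rotate[of "u @ solid a v" w] assms by simp
  from project[OF this] show ?thesis using assms by auto
qed

text \<open>A four-block with the colors \<open>x y\<close> and their inverses acts as a partition with two upper and two
lower points in one block, hence it joins two neighbours of colors \<open>x\<close> and \<open>y\<close>.\<close>

lemma merge_in:
  assumes block: "solid 0 [x, y, inv_color y, inv_color x] \<in> L"
    and p: "u @ [(x, Some a), (y, Some b)] @ v \<in> L"
  shows "relabel (\<lambda>c. if c = a then b else c) (u @ [(x, Some a), (y, Some b)] @ v) \<in> L"
proof -
  obtain c where c: "c \<notin> labels (u @ [(x, Some a), (y, Some b)] @ v)" using ex_fresh by blast
  let ?g = "\<lambda>d. if d = c then a else d"
  have "solid c [x, y, inv_color y, inv_color x] \<in> L" using solid_in_iff block by blast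
  then have "u @ solid c [x, y, inv_color y, inv_color x] @ [(x, Some a), (y, Some b)] @ v \<in> L"
    using c p insert_in[of u "[(x, Some a), (y, Some b)] @ v" "solid c [x, y, inv_color y, inv_color x]"]
    by (simp add: labels_solid)
  then have "relabel ?g ((u @ solid c [x, y, inv_color y]) @ [(y, Some b)] @ v) \<in> L"
    using cap_Some[of "u @ solid c [x, y, inv_color y]" "inv_color x" c a "[(y, Some b)] @ v"] by simp
  moreover have "relabel ?g u = u" "relabel ?g v = v" "b \<noteq> c"
    using c by (auto intro!: relabel_ident)
  ultimately have "(u @ solid a [x, y]) @ [(inv_color y, Some a), (inv_color (inv_color y), Some b)] @ v \<in> L"
    by simp
  from cap_Some[OF this] show ?thesis by simp
qed

lemma merge_in':
  assumes "solid 0 [x, y, inv_color y, inv_color x] \<in> L"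
    and "u @ [(x, Some a), (y, Some b)] @ v \<in> L"
  shows "relabel (\<lambda>c. if c = b then a else c) (u @ [(x, Some a), (y, Some b)] @ v) \<in> L"
proof -
  let ?W = "u @ [(x, Some a), (y, Some b)] @ v"
  let ?f = "\<lambda>c. if c = a then b else c" and ?g = "\<lambda>c. if c = b then a else c"
  have inj: "inj_on ?g (labels (relabel ?f ?W))" by (auto simp: inj_on_def split: if_splits)
  have "relabel ?g (relabel ?f ?W) \<in> L" by (rule relabel_in[OF merge_in[OF assms] inj])
  moreover have "?g \<circ> ?f = ?g" by auto
  ultimately show ?thesis unfolding relabel_relabel by simp
qed

end

section \<open>Noncrossing words\<close>

text \<open>The boundary order reads the lower row from right to left. Reading from left to right forbids the
same patterns, since the roles of the two blocks may be exchanged.\<close>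

definition crossing_free :: "letter list \<Rightarrow> bool" where
  "crossing_free w \<longleftrightarrow> \<not> (\<exists>i j k l a b. i < j \<and> j < k \<and> k < l \<and> l < length w \<and> a \<noteq> b \<and>
    snd (w ! i) = Some a \<and> snd (w ! k) = Some a \<and> snd (w ! j) = Some b \<and> snd (w ! l) = Some b)"

lemma crossing_freeD:
  assumes "crossing_free w" "i < j" "j < k" "k < l" "l < length w"
    "snd (w ! i) = Some a" "snd (w ! k) = Some a" "snd (w ! j) = Some b" "snd (w ! l) = Some b"
  shows "a = b"
  using assms unfolding crossing_free_def by blast

lemma noncrossingD:
  assumes "noncrossing p" "B \<in> blocks p" "B' \<in> blocks p" "a \<in> B" "b \<in> B'" "c \<in> B" "d \<in> B'"
    "boundary_pos p a < boundary_pos p b" "boundary_pos p b < boundary_pos p c"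
    "boundary_pos p c < boundary_pos p d"
  shows "B = B'"
proof (rule ccontr)
  assume "B \<noteq> B'"
  then have "\<exists>B \<in> blocks p. \<exists>B' \<in> blocks p. B \<noteq> B' \<and> (\<exists>a \<in> B. \<exists>b \<in> B'. \<exists>c \<in> B. \<exists>d \<in> B'.
      boundary_pos p a < boundary_pos p b \<and> boundary_pos p b < boundary_pos p c \<and>
      boundary_pos p c < boundary_pos p d)"
    by (intro bexI[of _ B] bexI[of _ B'] bexI[of _ a] bexI[of _ b] bexI[of _ c] bexI[of _ d] conjI assms)
  then show False using assms(1) by (simp add: noncrossing_def)
qed

lemma crossing_free_if_NC:
  assumes "word_part w \<in> NC"
  shows "crossing_free w"
proof (rule ccontr)
  let ?p = "word_part w" and ?n = "length w"
  define block where "block i = {y \<in> pts [] (map fst w). word_label w y = word_label w (Lo i)}" for i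
  assume "\<not> crossing_free w"
  then obtain i j k l a b where *: "i < j" "j < k" "k < l" "l < ?n" "a \<noteq> b"
    "snd (w ! i) = Some a" "snd (w ! k) = Some a" "snd (w ! j) = Some b" "snd (w ! l) = Some b"
    unfolding crossing_free_def by blast
  have blk: "block m \<in> blocks ?p" if "m < ?n" for m
    using that unfolding word_part_def blocks_kernel_part block_def
    by (intro image_eqI[of _ _ "Lo m"]) simp_all
  have mem: "Lo m' \<in> block m \<longleftrightarrow> snd (w ! m') = Some c" if "snd (w ! m) = Some c" "m' < ?n" for m m' c
    using that by (auto simp: block_def split: option.splits)
  have pos: "boundary_pos ?p (Lo m) = ?n - 1 - m" for m
    by (simp add: boundary_pos_def word_part_def)
  have "Lo i \<in> block i" "Lo i \<notin> block l" using * by (simp_all add: mem[of i a] mem[of l b])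
  then have "block l \<noteq> block i" by auto
  have mem': "Lo l \<in> block l" "Lo k \<in> block i" "Lo j \<in> block l" "Lo i \<in> block i"
    using * by (simp_all add: mem[of i a] mem[of l b])
  have less: "boundary_pos ?p (Lo l) < boundary_pos ?p (Lo k)"
    "boundary_pos ?p (Lo k) < boundary_pos ?p (Lo j)" "boundary_pos ?p (Lo j) < boundary_pos ?p (Lo i)"
    using * unfolding pos by auto
  have "block l \<in> blocks ?p" "block i \<in> blocks ?p" using * by (auto intro: blk)
  moreover have "noncrossing ?p" using assms by (simp add: NC_def)
  ultimately have "block l = block i" using mem' less by (intro noncrossingD[of ?p "block l" "block i" "Lo l" "Lo k" "Lo j" "Lo i"])
  then show False using \<open>block l \<noteq> block i\<close> by simp
qed

lemma split_at_two:
  assumes "i < j" "j < length w"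
  shows "w = take i w @ [w ! i] @ take (j - Suc i) (drop (Suc i) w) @ [w ! j] @ drop (Suc j) w"
proof -
  have "w = take i w @ w ! i # drop (Suc i) w"
    using assms by (intro id_take_nth_drop) simp
  also have "drop (Suc i) w = take (j - Suc i) (drop (Suc i) w) @ w ! j # drop (Suc j) w"
    using id_take_nth_drop[of "j - Suc i" "drop (Suc i) w"] assms by simp
  finally show ?thesis by simp
qed

lemma all_None_singles: "(\<And>p. p \<in> set w \<Longrightarrow> snd p = None) \<Longrightarrow> w = singles (map fst w)"
  unfolding singles_def map_map by (rule map_idI[symmetric]) (simp add: prod_eq_iff)

lemma all_Some_solid: "(\<And>p. p \<in> set w \<Longrightarrow> snd p = Some a) \<Longrightarrow> w = solid a (map fst w)"
  unfolding solid_def map_map by (rule map_idI[symmetric]) (simp add: prod_eq_iff)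

text \<open>Take two letters of one block at minimal distance. A labelled letter between them shares its block
with a further letter, which is either closer or makes the blocks cross.\<close>

lemma ex_nearest_pair:
  assumes nc: "crossing_free w"
    and multiple: "\<And>i a. i < length w \<Longrightarrow> snd (w ! i) = Some a \<Longrightarrow>
      \<exists>j < length w. j \<noteq> i \<and> snd (w ! j) = Some a"
    and "labels w \<noteq> {}"
  shows "\<exists>u x a m y v. w = u @ [(x, Some a)] @ singles m @ [(y, Some a)] @ v"
proof -
  let ?P = "\<lambda>(i, j). i < j \<and> j < length w \<and> (\<exists>a. snd (w ! i) = Some a \<and> snd (w ! j) = Some a)"
  obtain k b where "k < length w" "snd (w ! k) = Some b"
    using assms(3) by (force simp: labels_def in_set_conv_nth)
  moreover from multiple[OF this] obtain k' where "k' < length w" "k' \<noteq> k" "snd (w ! k') = Some b"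
    by blast
  ultimately have "?P (min k k', max k k')" by (auto simp: min_def max_def)
  from ex_has_least_nat[of ?P, OF this, of "\<lambda>(i, j). j - i"] obtain p
    where p: "?P p" and least_p: "\<And>q. ?P q \<Longrightarrow> (case p of (i, j) \<Rightarrow> j - i) \<le> (case q of (i, j) \<Rightarrow> j - i)"
    by blast
  obtain i j where "p = (i, j)" by fastforce
  then obtain a where ij: "i < j" "j < length w" "snd (w ! i) = Some a" "snd (w ! j) = Some a"
    using p by auto
  have least: "j - i \<le> j' - i'" if "i' < j'" "j' < length w" "snd (w ! i') = Some c" "snd (w ! j') = Some c"
    for i' j' c
    using least_p[of "(i', j')"] that \<open>p = (i, j)\<close> by simp
  have None: "snd (w ! k) = None" if k: "i < k" "k < j" for k
  proof (rule ccontr)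
    assume "snd (w ! k) \<noteq> None"
    then obtain b where b: "snd (w ! k) = Some b" by blast
    have "b \<noteq> a" using least[OF k(1) _ ij(3)] b k ij by fastforce
    obtain k' where k': "k' < length w" "k' \<noteq> k" "snd (w ! k') = Some b"
      using multiple[of k b] b k ij by auto
    have "k' \<noteq> i" "k' \<noteq> j" using k' ij \<open>b \<noteq> a\<close> by auto
    then consider "k' < i" | "i < k'" "k' < k" | "k < k'" "k' < j" | "j < k'"
      using k'(2) by linarith
    then show False
    proof cases
      case 1
      then show ?thesis using crossing_freeD[OF nc 1 k(1,2) ij(2) k'(3) b ij(3,4)] \<open>b \<noteq> a\<close> by simp
    next
      case 2
      then show ?thesis using least[of k' k b] k' b k ij by fastforce
    next
      case 3
      then show ?thesis using least[of k k' b] k' b k ij by fastforce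
    next
      case 4
      then show ?thesis using crossing_freeD[OF nc k(1,2) 4 k'(1) ij(3,4) b k'(3)] \<open>b \<noteq> a\<close> by simp
    qed
  qed
  let ?m = "take (j - Suc i) (drop (Suc i) w)"
  have "?m = singles (map fst ?m)"
  proof (rule all_None_singles)
    fix p assume "p \<in> set ?m"
    then obtain k where "k < length ?m" "p = ?m ! k" by (metis in_set_conv_nth)
    then show "snd p = None" using None[of "Suc i + k"] ij by simp
  qed
  moreover have "w ! i = (fst (w ! i), Some a)" "w ! j = (fst (w ! j), Some a)"
    using ij by (auto intro: prod_eqI)
  ultimately have "w = take i w @ [(fst (w ! i), Some a)] @ singles (map fst ?m) @
      [(fst (w ! j), Some a)] @ drop (Suc j) w"
    using split_at_two[OF ij(1,2)] by metis
  then show ?thesis by blast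
qed

lemma ex_first_last:
  assumes "k < length w" "snd (w ! k) = Some b"
  shows "\<exists>i j. i \<le> k \<and> k \<le> j \<and> j < length w \<and> snd (w ! i) = Some b \<and> snd (w ! j) = Some b \<and>
    (\<forall>k' < length w. snd (w ! k') = Some b \<longrightarrow> i \<le> k' \<and> k' \<le> j)"
proof -
  let ?S = "{k'. k' < length w \<and> snd (w ! k') = Some b}"
  have fin: "finite ?S" and ne: "?S \<noteq> {}" using assms by auto
  have "Min ?S \<in> ?S" "Max ?S \<in> ?S" using Min_in[OF fin ne] Max_in[OF fin ne] by auto
  moreover have "Min ?S \<le> k' \<and> k' \<le> Max ?S" if "k' \<in> ?S" for k'
    using fin that by auto
  ultimately show ?thesis using assms by (intro exI[of _ "Min ?S"] exI[of _ "Max ?S"]) auto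
qed

text \<open>Take a block whose first and last letters are at minimal distance. A letter of another block
between them would span a block that is nested inside.\<close>

lemma ex_interval_block:
  assumes nc: "crossing_free w" and "w \<noteq> []" and all: "\<And>p. p \<in> set w \<Longrightarrow> snd p \<noteq> None"
  shows "\<exists>u a v z. w = u @ solid a v @ z \<and> v \<noteq> [] \<and> a \<notin> labels (u @ z)"
proof -
  let ?P = "\<lambda>(i, j). i \<le> j \<and> j < length w \<and> (\<exists>a. snd (w ! i) = Some a \<and> snd (w ! j) = Some a \<and>
    (\<forall>k < length w. snd (w ! k) = Some a \<longrightarrow> i \<le> k \<and> k \<le> j))"
  have some: "\<exists>b. snd (w ! k) = Some b" if "k < length w" for k
    using all[of "w ! k"] that by auto
  obtain b where b: "snd (w ! 0) = Some b" using some[of 0] \<open>w \<noteq> []\<close> by auto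
  obtain i0 j0 where "?P (i0, j0)" using ex_first_last[of 0 w b] b \<open>w \<noteq> []\<close> by (auto intro: that)
  from ex_has_least_nat[of ?P, OF this, of "\<lambda>(i, j). j - i"] obtain p
    where p: "?P p" and least_p: "\<And>q. ?P q \<Longrightarrow> (case p of (i, j) \<Rightarrow> j - i) \<le> (case q of (i, j) \<Rightarrow> j - i)"
    by blast
  obtain i j where "p = (i, j)" by fastforce
  then obtain a where ij: "i \<le> j" "j < length w" "snd (w ! i) = Some a" "snd (w ! j) = Some a"
    and span: "\<And>k. k < length w \<Longrightarrow> snd (w ! k) = Some a \<Longrightarrow> i \<le> k \<and> k \<le> j"
    using p by auto
  have least: "j - i \<le> j' - i'"
    if "i' \<le> j'" "j' < length w" "snd (w ! i') = Some c" "snd (w ! j') = Some c"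
      "\<forall>k < length w. snd (w ! k) = Some c \<longrightarrow> i' \<le> k \<and> k \<le> j'" for i' j' c
    using least_p[of "(i', j')"] that \<open>p = (i, j)\<close> by simp
  have const: "snd (w ! k) = Some a" if k: "i \<le> k" "k \<le> j" for k
  proof (rule ccontr)
    assume "snd (w ! k) \<noteq> Some a"
    then obtain b where b: "snd (w ! k) = Some b" "b \<noteq> a" using some[of k] k ij by auto
    then have k_less: "i < k" "k < j" using k ij by (metis le_neq_implies_less option.inject)+
    obtain i' j' where ij': "i' \<le> k" "k \<le> j'" "j' < length w" "snd (w ! i') = Some b"
        "snd (w ! j') = Some b" "\<forall>k' < length w. snd (w ! k') = Some b \<longrightarrow> i' \<le> k' \<and> k' \<le> j'"
      using ex_first_last[of k w b] b k ij by auto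
    have "\<not> i' < i"
      using crossing_freeD[OF nc _ k_less ij(2) ij'(4) b(1) ij(3,4)] b(2) by blast
    moreover have "\<not> j < j'"
      using crossing_freeD[OF nc k_less _ ij'(3) ij(3,4) b(1) ij'(5)] b(2) by blast
    moreover have "i' \<noteq> i" "j' \<noteq> j" using b(2) ij ij' by auto
    ultimately have "i < i'" "j' < j" by auto
    moreover have "j - i \<le> j' - i'" using least[of i' j' b] ij' by simp
    ultimately show False using ij'(1,2) by linarith
  qed
  let ?m = "take (Suc j - i) (drop i w)"
  have m: "?m = solid a (map fst ?m)"
  proof (rule all_Some_solid)
    fix p assume "p \<in> set ?m"
    then obtain k where "k < length ?m" "p = ?m ! k" by (metis in_set_conv_nth)
    then show "snd p = Some a" using const[of "i + k"] ij by simp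
  qed
  have w: "w = take i w @ ?m @ drop (Suc j) w"
    using ij append_take_drop_id[of i w] append_take_drop_id[of "Suc j - i" "drop i w"] by simp
  have "a \<notin> labels (take i w)"
  proof
    assume "a \<in> labels (take i w)"
    then obtain k where "k < i" "k < length w" "snd (w ! k) = Some a"
      by (force simp: labels_def in_set_conv_nth)
    then show False using span[of k] by simp
  qed
  moreover have "a \<notin> labels (drop (Suc j) w)"
  proof
    assume "a \<in> labels (drop (Suc j) w)"
    then obtain k where k: "k < length w - Suc j" "snd (drop (Suc j) w ! k) = Some a"
      by (force simp: labels_def in_set_conv_nth)
    then have "Suc j + k < length w" by simp
    then show False using span[of "Suc j + k"] k(2) by simp
  qed
  moreover have "map fst ?m \<noteq> []" using ij by simp
  ultimately show ?thesis using w m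
    by (intro exI[of _ "take i w"] exI[of _ a] exI[of _ "map fst ?m"] exI[of _ "drop (Suc j) w"]) auto
qed

section \<open>No singletons: pairings and alternating blocks\<close>

context word_category
begin

lemma no_singletons:
  assumes "singles [White, Black] \<notin> L" "w \<in> L" "i < length w"
  shows "\<exists>a. snd (w ! i) = Some a \<and> (\<exists>j < length w. j \<noteq> i \<and> snd (w ! j) = Some a)"
proof (rule ccontr)
  assume contr: "\<not> ?thesis"
  let ?u = "take i w" and ?v = "drop (Suc i) w"
  obtain x where "?u @ [(x, None)] @ ?v \<in> L"
  proof (cases "snd (w ! i)")
    case None
    then have "w ! i = (fst (w ! i), None)" by (simp add: prod_eqI)
    then show ?thesis using that[of "fst (w ! i)"] id_take_nth_drop[OF assms(3)] assms(2) by simp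
  next
    case (Some a)
    then have "w ! i = (fst (w ! i), Some a)" by (simp add: prod_eqI)
    then have "?u @ [(fst (w ! i), Some a)] @ ?v \<in> L" using id_take_nth_drop[OF assms(3)] assms(2) by simp
    moreover have "a \<notin> labels (?u @ ?v)"
    proof
      assume "a \<in> labels (?u @ ?v)"
      then consider k where "k < i" "k < length w" "snd (w ! k) = Some a"
        | k where "k < length w - Suc i" "snd (w ! (Suc i + k)) = Some a"
        by (force simp: labels_def in_set_conv_nth)
      then show False
      proof cases
        case (1 k)
        then show ?thesis using contr Some by blast
      next
        case (2 k)
        then have "Suc i + k < length w" "Suc i + k \<noteq> i" using assms(3) by simp_all
        then show ?thesis using contr Some 2(2) by blast
      qed
    qed
    ultimately show ?thesis using that singleton_iff by blast
  qed
  then show False using singleton_pair_in assms(1) by blast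
qed

lemma alternating_rotate: "solid 0 [White, Black, White, Black] \<in> L \<longleftrightarrow> solid 0 [x, inv_color x, x, inv_color x] \<in> L"
  using rotate_iff[of "solid 0 [White]" "solid 0 [Black, White, Black]"] by (cases x) auto

lemma double_rotate: "solid 0 [White, White, Black, Black] \<in> L \<longleftrightarrow> solid 0 [x, x, inv_color x, inv_color x] \<in> L"
  using rotate_iff[of "solid 0 [White, White]" "solid 0 [Black, Black]"] by (cases x) auto

text \<open>Two rotated copies of the four-block are placed side by side and joined at their boundary by a cap;
a second cap removes the surplus points.\<close>

lemma alternating_if_double:
  assumes "solid 0 [x, x, inv_color x, inv_color x] \<in> L"
  shows "solid 0 [White, Black, White, Black] \<in> L"
proof -
  let ?y = "inv_color x"
  have 0: "solid 0 [?y, x, x, ?y] \<in> L"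
    using rotate[of "solid 0 [x, x, ?y]" "solid 0 [?y]"] assms by simp
  have "solid 0 [x, ?y, ?y, x] \<in> L"
    using rotate[of "solid 0 [x]" "solid 0 [x, ?y, ?y]"] assms by simp
  then have 1: "solid 1 [x, ?y, ?y, x] \<in> L" using solid_in_iff by blast
  have "solid 0 [?y, x, x, ?y] @ solid 1 [x, ?y, ?y, x] \<in> L"
    using append_in[OF 0 1] by (simp add: labels_solid)
  then have "solid 0 [?y, x, x] @ [(?y, Some 0), (inv_color ?y, Some 1)] @ solid 1 [?y, ?y, x] \<in> L" by simp
  from cap_Some[OF this] have "solid 1 [?y, x] @ [(x, Some 1), (?y, Some 1)] @ solid 1 [?y, x] \<in> L" by simp
  from cap_equal[OF this] have "solid 1 [?y, x, ?y, x] \<in> L" by simp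
  then have "solid 0 [?y, inv_color ?y, ?y, inv_color ?y] \<in> L" using solid_in_iff[of 0 "[?y, x, ?y, x]" 1] by simp
  then show ?thesis using alternating_rotate[of ?y] by blast
qed

lemma pairs_opposite:
  assumes "solid 0 [x, x] @ solid 1 [inv_color x, inv_color x] \<in> L"
  shows "solid 0 [White, White] @ solid 1 [Black, Black] \<in> L"
proof (cases x)
  case Black
  then have "solid 1 [White, White] @ solid 0 [Black, Black] \<in> L" using rotate[OF assms] by simp
  then show ?thesis by (rule two_solids_relabel) auto
qed (use assms in simp)

end

text \<open>Two neighbouring letters of the same block are a whole block, as otherwise projecting onto them
yields a four-block and then \<open>\<circ>\<bullet>\<circ>\<bullet>\<close>; and they have opposite colors, as otherwise projecting onto them yields the
partition that makes the category globally colorized. Such a pair can be removed and inserted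
again.\<close>

lemma pairings_subset:
  assumes "word_category L" "word_category L'"
    and nc: "\<And>w. w \<in> L \<Longrightarrow> crossing_free w"
    and no_singles: "singles [White, Black] \<notin> L"
    and no_block: "solid 0 [White, Black, White, Black] \<notin> L"
    and no_equal_pairs: "solid 0 [White, White] @ solid 1 [Black, Black] \<notin> L"
  shows "L \<subseteq> L'"
proof
  interpret L: word_category L by fact
  interpret L': word_category L' by fact
  fix w assume "w \<in> L"
  then show "w \<in> L'"
  proof (induction "length w" arbitrary: w rule: less_induct)
    case less
    note mult = L.no_singletons[OF no_singles less.prems]
    show ?case
    proof (cases "w = []")
      case True
      then show ?thesis by (simp add: L'.Nil_in)
    next
      case False
      have "labels w \<noteq> {}" using mult[of 0] labelsI[of 0 w] False by auto
      moreover have "\<exists>j < length w. j \<noteq> i \<and> snd (w ! j) = Some a"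
        if "i < length w" "snd (w ! i) = Some a" for i a using mult[of i] that by auto
      ultimately obtain u x a m y v where w: "w = u @ [(x, Some a)] @ singles m @ [(y, Some a)] @ v"
        using ex_nearest_pair[OF nc[OF less.prems]] by blast
      have "m = []"
      proof (cases m)
        case (Cons c m')
        then show ?thesis using mult[of "Suc (length u)"] by (simp add: w nth_append)
      qed simp
      then have uv: "u @ solid a [x, y] @ v \<in> L" using less.prems w by simp
      show ?thesis
      proof (cases "a \<in> labels (u @ v)")
        case True
        from L.project_block_part[OF uv True]
        have "solid 0 [inv_color y, inv_color x, x, y] \<in> L" using L.solid_in_iff[of 0 "[inv_color y, inv_color x, x, y]" a] by simp
        then have "solid 0 [White, Black, White, Black] \<in> L"
          using L.alternating_rotate[of x] L.alternating_if_double[of "inv_color x"]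
          by (cases "x = y") (auto simp: neq_iff_inv_color)
        then show ?thesis using no_block by blast
      next
        case False
        show ?thesis
        proof (cases "x = y")
          case True
          then have "solid 0 [inv_color x, inv_color x] @ solid 1 [x, x] \<in> L"
            using L.project_block[OF uv False, of 0 1] by simp
          then show ?thesis using L.pairs_opposite[of "inv_color x"] no_equal_pairs by simp
        next
          case neq: False
          then have y: "y = inv_color x" by (simp add: neq_iff_inv_color)
          then have "u @ v \<in> L" using L.cap_equal uv by simp
          then have "u @ v \<in> L'" using less.hyps w by simp
          then show ?thesis using L'.insert_pair_in[OF _ False, of x] w \<open>m = []\<close> y by simp
        qed
      qed
    qed
  qed
qed

text \<open>The letters of an alternating word cancel in pairs from the left, leaving at most the last one.\<close>

lemma no_double_color_sum:
  assumes "\<And>v1 x v2. v \<noteq> v1 @ [x, x] @ v2" "v \<noteq> []"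
  shows "color_sum v = 0 \<or> (\<exists>v' x. v = v' @ [x] \<and> color_sum v' = 0)"
  using assms
proof (induction v rule: rev_induct)
  case (snoc x v)
  have nd: "v \<noteq> v1 @ [y, y] @ v2" for v1 y v2
    using snoc.prems(1)[of v1 y "v2 @ [x]"] by auto
  show ?case
  proof (cases "v = []")
    case False
    from snoc.IH[OF nd False] show ?thesis
    proof
      assume "\<exists>v' y. v = v' @ [y] \<and> color_sum v' = 0"
      then obtain v' y where v: "v = v' @ [y]" "color_sum v' = 0" by blast
      then have "x = inv_color y" using snoc.prems(1)[of v' y "[]"] neq_iff_inv_color by auto
      then show ?thesis using v by simp
    qed auto
  qed auto
qed simp

context word_category
begin

lemma alternating_solid_in:
  assumes "solid 0 [White, Black, White, Black] \<in> L"
    and "\<And>v1 x v2. v \<noteq> v1 @ [x, x] @ v2" "color_sum v = 0"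
  shows "solid 0 v \<in> L"
  using assms(2,3)
proof (induction "length v" arbitrary: v rule: less_induct)
  case less
  consider "v = []" | x where "v = [x]" | x y v' where "v = x # y # v'"
    by (metis list.exhaust)
  then show ?case
  proof cases
    case 3
    then have y: "y = inv_color x" using less.prems(1)[of "[]" x v'] neq_iff_inv_color by auto
    have "v' \<noteq> v1 @ [z, z] @ v2" for v1 z v2 using less.prems(1)[of "x # y # v1" z v2] 3 by auto
    then have v': "solid 0 v' \<in> L" using less 3 y by simp
    show ?thesis
    proof (cases v')
      case Nil
      then show ?thesis using pair_in[of x 0] 3 y by simp
    next
      case (Cons z v'')
      then have z: "z = x" using less.prems(1)[of "[x]" y v''] neq_iff_inv_color[of y z] 3 y by auto
      have "solid 1 [x, y] @ solid 0 v' \<in> L"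
        using append_in[of "solid 1 [x, y]", OF _ v'] pair_in[of x 1] y by (simp add: labels_solid)
      then have "[(x, Some 1)] @ [(y, Some 1), (x, Some 0)] @ solid 0 v'' \<in> L"
        by (simp add: Cons z)
      from merge_in[OF _ this] show ?thesis
        using 3 y Cons z alternating_rotate[of y] assms(1) by simp
    qed
  next
    case 2
    then show ?thesis using less.prems(2) by (cases x) auto
  qed (simp_all add: Nil_in)
qed

end

text \<open>Projecting onto an interval block \<open>v\<close> gives the reflection of \<open>v\<close> next to \<open>v\<close>; these two blocks meet in
opposite colors and can be merged. Equal neighbours in \<open>v\<close> would thus produce a four-block
\<open>\<circ>\<circ>\<bullet>\<bullet>\<close>, and an odd alternating \<open>v\<close> would leave a singleton. So \<open>v\<close> cancels completely, and it
can be restored since alternating blocks of even length arise from pairs by merging.\<close>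

lemma alternating_blocks_subset:
  assumes "word_category L" "word_category L'"
    and nc: "\<And>w. w \<in> L \<Longrightarrow> crossing_free w"
    and no_singles: "singles [White, Black] \<notin> L"
    and block: "solid 0 [White, Black, White, Black] \<in> L"
    and no_double: "solid 0 [White, White, Black, Black] \<notin> L"
    and block': "solid 0 [White, Black, White, Black] \<in> L'"
  shows "L \<subseteq> L'"
proof
  interpret L: word_category L by fact
  interpret L': word_category L' by fact
  fix w assume "w \<in> L"
  then show "w \<in> L'"
  proof (induction "length w" arbitrary: w rule: less_induct)
    case less
    show ?case
    proof (cases "w = []")
      case True
      then show ?thesis by (simp add: L'.Nil_in)
    next
      case False
      have "snd p \<noteq> None" if "p \<in> set w" for p
        using L.no_singletons[OF no_singles less.prems] that by (fastforce simp: in_set_conv_nth)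
      then obtain u a v z where w: "w = u @ solid a v @ z" "v \<noteq> []" "a \<notin> labels (u @ z)"
        using ex_interval_block[OF nc[OF less.prems] False] by blast
      have vv: "solid 0 (opposite v) @ solid 1 v \<in> L"
        using L.project_block[of u a v z 0 1] less.prems w by simp
      obtain c v' where c: "v = c # v'" using w(2) by (cases v) auto
      have "solid 0 (opposite v') @ [(inv_color c, Some 0), (c, Some 1)] @ solid 1 v' \<in> L"
        using vv c by simp
      from L.merge_in[OF _ this] have merged: "solid 1 (opposite v @ v) \<in> L"
        using c block L.alternating_rotate[of "inv_color c"] by simp
      \<comment> \<open>Otherwise the merged block cancels down to the four-block with equal neighbours.\<close>
      have nd: "v \<noteq> v1 @ [x, x] @ v2" for v1 x v2
      proof
        assume v: "v = v1 @ [x, x] @ v2"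
        let ?y = "inv_color x"
        have "solid 1 (opposite v2 @ [?y, ?y]) @ solid 1 (opposite v1 @ v1) @ solid 1 ([x, x] @ v2) \<in> L"
          using merged v by simp
        then have "solid 1 (opposite v2) @ solid 1 ([?y, ?y, x, x] @ v2) \<in> L"
          using L.solid_remove[of "opposite v1 @ v1"] by fastforce
        then have "solid 1 [?y, ?y, x, x] @ solid 1 (v2 @ opposite v2) @ [] \<in> L"
          using L.rotate by fastforce
        then have "solid 1 [?y, ?y, x, x] @ [] \<in> L"
          by (rule L.solid_remove[rotated]) simp
        then have "solid 0 [?y, ?y, x, x] \<in> L" using L.solid_in_iff[of 0 "[?y, ?y, x, x]" 1] by simp
        then show False using L.double_rotate[of ?y] no_double by simp
      qed
      \<comment> \<open>Otherwise \<open>v\<close> and its reflection cancel down to one letter each, which are singletons.\<close>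
      have sum: "color_sum v = 0"
      proof (rule ccontr)
        assume "color_sum v \<noteq> 0"
        then obtain v'' x where v: "v = v'' @ [x]" "color_sum v'' = 0"
          using no_double_color_sum[OF nd w(2)] by auto
        then have "[(inv_color x, Some 0)] @ solid 0 (opposite v'') @ solid 1 (v'' @ [x]) \<in> L"
          using vv by simp
        then have "[(inv_color x, Some 0)] @ solid 1 (v'' @ [x]) \<in> L"
          by (rule L.solid_remove[rotated]) (simp add: v)
        then have "[(inv_color x, Some 0)] @ solid 1 v'' @ [(x, Some 1)] \<in> L" by simp
        then have "[(inv_color x, Some 0)] @ [(x, Some 1)] @ [] \<in> L"
          using L.solid_remove[OF v(2), of "[(inv_color x, Some 0)]" 1 "[(x, Some 1)]"] by simp
        then have "[(inv_color x, Some 0)] @ [(x, None)] @ [] \<in> L"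
          by (subst (asm) L.singleton_iff) auto
        then show False using L.singleton_pair_in no_singles by blast
      qed
      then have "u @ z \<in> L" using L.solid_remove less.prems w by blast
      then have uz: "u @ z \<in> L'" using less.hyps w by (simp add: solid_def)
      have "solid 0 v \<in> L'" using L'.alternating_solid_in[OF block' nd sum] .
      then have "solid a v \<in> L'" using L'.solid_in_iff by blast
      then show ?thesis unfolding w(1) using w(3) uz by (intro L'.insert_in) (auto simp: labels_solid)
    qed
  qed
qed

section \<open>No singletons: blocks of arbitrary coloring\<close>

text \<open>The subgroups of the integers; the least positive element generates.\<close>

lemma int_subgroup_multiples:
  fixes S :: "int set"
  assumes "0 \<in> S" and diff: "\<And>a b. a \<in> S \<Longrightarrow> b \<in> S \<Longrightarrow> a - b \<in> S"
  shows "\<exists>k::nat. S = {n. int k dvd n}"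
proof (cases "S \<subseteq> {0}")
  case True
  then show ?thesis using assms(1) by (intro exI[of _ 0]) auto
next
  case False
  have neg: "- a \<in> S" if "a \<in> S" for a using diff[OF assms(1) that] by simp
  have plus: "a + b \<in> S" if "a \<in> S" "b \<in> S" for a b using diff[OF that(1) neg[OF that(2)]] by simp
  obtain a where a: "a \<in> S" "a \<noteq> 0" using False by blast
  have "\<bar>a\<bar> \<in> S" using a neg by (simp add: abs_if)
  then have ex: "\<exists>k. 0 < k \<and> int k \<in> S" using a(2) by (intro exI[of _ "nat \<bar>a\<bar>"]) auto
  define k where "k = (LEAST k. 0 < k \<and> int k \<in> S)"
  have k: "0 < k" "int k \<in> S" using LeastI_ex[OF ex] by (auto simp: k_def)
  have least: "k \<le> j" if "0 < j" "int j \<in> S" for j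
    unfolding k_def using that by (intro Least_le) simp
  have mult_nat: "int j * int k \<in> S" for j
    by (induction j) (use assms(1) k(2) plus in \<open>auto simp: algebra_simps\<close>)
  have mult: "j * int k \<in> S" for j
  proof (cases "j \<ge> 0")
    case True
    then show ?thesis using mult_nat[of "nat j"] by simp
  next
    case False
    then show ?thesis using neg[OF mult_nat[of "nat (- j)"]] by simp
  qed
  have "int k dvd n" if "n \<in> S" for n
  proof (rule ccontr)
    assume "\<not> int k dvd n"
    then have pos: "n mod int k > 0"
      using k(1) by (metis dvd_eq_mod_eq_0 of_nat_0_less_iff order_le_less pos_mod_sign)
    have "n mod int k \<in> S" using diff[OF that mult[of "n div int k"]] by (simp add: minus_div_mult_eq_mod)
    then have "k \<le> nat (n mod int k)" using least[of "nat (n mod int k)"] pos by simp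
    moreover have "n mod int k < int k" using k(1) by simp
    ultimately show False using pos by linarith
  qed
  moreover have "n \<in> S" if "int k dvd n" for n
    using that mult by (metis dvdE mult.commute)
  ultimately show ?thesis by blast
qed

definition block_sums :: "letter list set \<Rightarrow> int set" where
  "block_sums L = {n. \<exists>v. v \<noteq> [] \<and> color_sum v = n \<and> solid 0 v \<in> L}"

text \<open>The reflection of a block \<open>v\<close> has the color word \<open>opposite v\<close>, so for \<open>v\<close> consisting of \<open>d\<close> white
points the condition says that the tensor product of \<open>b\<^sub>d\<close> and its verticolor reflection is in
the category.\<close>

definition opposite_block_sums :: "letter list set \<Rightarrow> int set" where
  "opposite_block_sums L =
    {n. \<exists>v. v \<noteq> [] \<and> color_sum v = n \<and> solid 0 v @ solid 1 (opposite v) \<in> L}"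

locale merging_category = word_category +
  assumes four_block_in: "solid 0 [x, y, inv_color y, inv_color x] \<in> L"
begin

lemma merge_solids:
  assumes "u @ solid a v @ solid b v' @ w \<in> L" "v \<noteq> []" "v' \<noteq> []" "b \<notin> labels (u @ w)"
  shows "u @ solid a (v @ v') @ w \<in> L"
proof -
  obtain v0 x where v: "v = v0 @ [x]" using assms(2) by (cases v rule: rev_cases) auto
  obtain y v1 where v': "v' = y # v1" using assms(3) by (cases v') auto
  have "(u @ solid a v0) @ [(x, Some a), (y, Some b)] @ solid b v1 @ w \<in> L"
    using assms(1) by (simp add: v v')
  from merge_in'[OF four_block_in this]
  have "relabel (\<lambda>c. if c = b then a else c) ((u @ solid a v0) @ [(x, Some a), (y, Some b)] @ solid b v1 @ w) \<in> L" .
  moreover have "relabel (\<lambda>c. if c = b then a else c) u = u" "relabel (\<lambda>c. if c = b then a else c) w = w"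
    using assms(4) by (auto intro!: relabel_ident)
  moreover have "(if a = b then a else a) = a" by simp
  ultimately show ?thesis by (simp add: v v')
qed

lemma solid_extend:
  assumes "color_sum z = 0" "u @ solid a v @ w \<in> L" "v \<noteq> []"
  shows "u @ solid a (v @ z) @ w \<in> L"
  using assms(1)
proof (induction rule: color_sum_zero_induct)
  case Nil
  then show ?case using assms by simp
next
  case (Insert z1 x z2)
  obtain c where c: "c \<notin> labels (u @ solid a (v @ z1 @ z2) @ w)" using ex_fresh by blast
  have "(u @ solid a (v @ z1)) @ [(x, Some c), (inv_color x, Some c)] @ solid a z2 @ w \<in> L"
    using Insert(2) c by (intro insert_pair_in) auto
  then have "u @ solid a (v @ z1) @ solid c [x, inv_color x] @ solid a z2 @ w \<in> L" by simp
  then have "u @ solid a ((v @ z1) @ [x, inv_color x]) @ solid a z2 @ w \<in> L"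
    by (rule merge_solids) (use assms c in auto)
  then show ?case by simp
qed

text \<open>Only the color sum of a nonempty stretch of one block matters: the stretch \<open>v\<close> is extended by a word
of color sum zero ending in \<open>v'\<close>, and the rest cancels.\<close>

lemma solid_swap:
  assumes "u @ solid a v @ w \<in> L" "v \<noteq> []" "v' \<noteq> []" "color_sum v = color_sum v'"
  shows "u @ solid a v' @ w \<in> L"
proof -
  have "u @ solid a (v @ opposite v' @ v') @ w \<in> L"
    using assms by (intro solid_extend) auto
  then have "u @ solid a (v @ opposite v') @ solid a v' @ w \<in> L" by simp
  then show ?thesis by (rule solid_remove[rotated]) (use assms in simp)
qed

lemma block_sums_iff: "v \<noteq> [] \<Longrightarrow> color_sum v \<in> block_sums L \<longleftrightarrow> solid 0 v \<in> L"
  unfolding block_sums_def using solid_swap[of "[]" 0 _ "[]" v] by auto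

lemma opposite_block_sums_iff:
  assumes "v \<noteq> []"
  shows "color_sum v \<in> opposite_block_sums L \<longleftrightarrow> solid 0 v @ solid 1 (opposite v) \<in> L"
proof
  assume "color_sum v \<in> opposite_block_sums L"
  then obtain v0 where v0: "v0 \<noteq> []" "color_sum v0 = color_sum v" "solid 0 v0 @ solid 1 (opposite v0) \<in> L"
    by (auto simp: opposite_block_sums_def)
  then have "[] @ solid 0 v @ solid 1 (opposite v0) \<in> L"
    using assms solid_swap[of "[]" 0 v0 "solid 1 (opposite v0)" v] by simp
  then have "solid 0 v @ solid 1 (opposite v0) @ [] \<in> L" by simp
  then have "solid 0 v @ solid 1 (opposite v) @ [] \<in> L"
    by (rule solid_swap) (use v0 assms in auto)
  then show "solid 0 v @ solid 1 (opposite v) \<in> L" by simp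
qed (use assms in \<open>auto simp: opposite_block_sums_def\<close>)

lemma block_sums_multiples: "\<exists>k::nat. block_sums L = {n. int k dvd n}"
proof (rule int_subgroup_multiples)
  show "0 \<in> block_sums L" using block_sums_iff[of "[White, Black]"] pair_in[of White 0] by simp
  fix n m assume "n \<in> block_sums L" "m \<in> block_sums L"
  then obtain v v' where v: "v \<noteq> []" "n = color_sum v" "solid 0 v \<in> L"
    and v': "v' \<noteq> []" "m = color_sum v'" "solid 0 v' \<in> L" by (auto simp: block_sums_def)
  have "solid 1 (opposite v') \<in> L" using reflect_in[OF v'(3)] solid_in_iff by auto
  then have "[] @ solid 0 v @ solid 1 (opposite v') @ [] \<in> L"
    using append_in[OF v(3)] by (simp add: labels_solid)
  then have "solid 0 (v @ opposite v') \<in> L" using merge_solids v v' by fastforce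
  then show "n - m \<in> block_sums L" using block_sums_iff[of "v @ opposite v'"] v v' by simp
qed

text \<open>Nesting the two blocks for \<open>m\<close> between those for \<open>n\<close> and merging on both sides gives the two blocks for
the difference.\<close>

lemma opposite_block_sums_multiples: "\<exists>d::nat. opposite_block_sums L = {n. int d dvd n}"
proof (rule int_subgroup_multiples)
  have "solid 0 [White, Black] @ solid 1 [White, Black] \<in> L"
    using append_in[of "solid 0 [White, Black]" "solid 1 [White, Black]"]
      pair_in[of White 0] pair_in[of White 1] by simp
  then show "0 \<in> opposite_block_sums L" using opposite_block_sums_iff[of "[White, Black]"] by simp
  fix n m assume "n \<in> opposite_block_sums L" "m \<in> opposite_block_sums L"
  then obtain v v' where v: "v \<noteq> []" "n = color_sum v" "solid 0 v @ solid 1 (opposite v) \<in> L"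
    and v': "v' \<noteq> []" "m = color_sum v'" "solid 0 v' @ solid 1 (opposite v') \<in> L"
    by (auto simp: opposite_block_sums_def)
  have "solid 1 (opposite v') @ solid 0 v' \<in> L" by (rule rotate[OF v'(3)])
  then have "solid 2 (opposite v') @ solid 3 v' \<in> L" by (rule two_solids_relabel) auto
  then have "solid 0 v @ (solid 2 (opposite v') @ solid 3 v') @ solid 1 (opposite v) \<in> L"
    using v(3) by (intro insert_in) (auto simp: labels_solid)
  then have "[] @ solid 0 v @ solid 2 (opposite v') @ solid 3 v' @ solid 1 (opposite v) \<in> L" by simp
  then have "[] @ solid 0 (v @ opposite v') @ solid 3 v' @ solid 1 (opposite v) \<in> L"
    by (rule merge_solids) (use v v' in \<open>auto simp: labels_solid\<close>)
  then have "solid 0 (v @ opposite v') @ solid 3 v' @ solid 1 (opposite v) @ [] \<in> L" by simp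
  then have "solid 0 (v @ opposite v') @ solid 3 (v' @ opposite v) @ [] \<in> L"
    by (rule merge_solids) (use v v' in \<open>auto simp: labels_solid\<close>)
  then have "solid 0 (v @ opposite v') @ solid 3 (v' @ opposite v) \<in> L" by simp
  then have "solid 0 (v @ opposite v') @ solid 1 (v' @ opposite v) \<in> L"
    by (rule two_solids_relabel) auto
  then show "n - m \<in> opposite_block_sums L"
    using opposite_block_sums_iff[of "v @ opposite v'"] v v' by simp
qed

lemma block_sums_subset_opposite: "block_sums L \<subseteq> opposite_block_sums L"
proof
  fix n assume "n \<in> block_sums L"
  then obtain v where v: "v \<noteq> []" "n = color_sum v" "solid 0 v \<in> L" by (auto simp: block_sums_def)
  have "solid 1 (opposite v) \<in> L" using reflect_in[OF v(3)] solid_in_iff by auto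
  then have "solid 0 v @ solid 1 (opposite v) \<in> L" using append_in[OF v(3)] by (simp add: labels_solid)
  then show "n \<in> opposite_block_sums L" using opposite_block_sums_iff v by simp
qed

text \<open>Insert \<open>v\<close> as a separate block followed by its reflection. The reflection is merged into the block
\<open>b\<close> and there cancels against the old copy of \<open>v\<close>, whose place is taken by the new block.\<close>

lemma split_block:
  assumes p: "solid b v @ [(y, Some b)] @ r \<in> L" and "v \<noteq> []"
    and "color_sum v \<in> opposite_block_sums L" and a: "a \<notin> labels ([(y, Some b)] @ r)"
  shows "solid a v @ [(y, Some b)] @ r \<in> L"
proof -
  obtain e where e: "e \<notin> labels ([(y, Some a)] @ [(y, Some b)] @ r)" using ex_fresh by blast
  have "solid 0 v @ solid 1 (opposite v) \<in> L" using assms opposite_block_sums_iff by blast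
  then have "solid a v @ solid e (opposite v) \<in> L" by (rule two_solids_relabel) (use e in auto)
  then have "(solid a v @ solid e (opposite v)) @ solid b v @ [(y, Some b)] @ r \<in> L"
    using p a e append_in[of "solid a v @ solid e (opposite v)" "solid b v @ [(y, Some b)] @ r"]
    by (auto simp: labels_solid split: if_splits)
  then have "solid a v @ solid e (opposite v) @ solid b (v @ [y]) @ r \<in> L" by simp
  moreover obtain x v1 where v: "v = x # v1" using assms(2) by (cases v) auto
  ultimately have "(solid a v @ solid e (opposite v1)) @ [(inv_color x, Some e), (x, Some b)] @
      solid b (v1 @ [y]) @ r \<in> L" by simp
  from merge_in[OF four_block_in this]
  have "relabel (\<lambda>c. if c = e then b else c)
      (solid a v @ solid e (opposite v) @ solid b (v @ [y]) @ r) \<in> L" by (simp add: v)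
  then have "solid a v @ solid b (opposite v @ v) @ [(y, Some b)] @ r \<in> L"
    using e by (auto split: if_splits)
  then show ?thesis by (rule solid_remove[rotated]) simp
qed

end

text \<open>An interval block is merged with the letter next to it, which lowers the number of blocks. This
can be undone in \<open>L'\<close> because projecting onto the interval block shows its color sum to be admissible.\<close>

lemma merging_subset:
  assumes "merging_category L" "merging_category L'"
    and nc: "\<And>w. w \<in> L \<Longrightarrow> crossing_free w"
    and no_singles: "singles [White, Black] \<notin> L"
    and sums: "block_sums L \<subseteq> block_sums L'" "opposite_block_sums L \<subseteq> opposite_block_sums L'"
  shows "L \<subseteq> L'"
proof
  interpret L: merging_category L by fact
  interpret L': merging_category L' by fact
  fix w assume "w \<in> L"
  then show "w \<in> L'"
  proof (induction "card (labels w)" arbitrary: w rule: less_induct)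
    case less
    show ?case
    proof (cases "w = []")
      case True
      then show ?thesis by (simp add: L'.Nil_in)
    next
      case False
      have some: "snd p \<noteq> None" if "p \<in> set w" for p
        using L.no_singletons[OF no_singles less.prems] that by (fastforce simp: in_set_conv_nth)
      then obtain u a v z where w: "w = u @ solid a v @ z" "v \<noteq> []" "a \<notin> labels (u @ z)"
        using ex_interval_block[OF nc[OF less.prems] False] by blast
      show ?thesis
      proof (cases "z @ u")
        case Nil
        then have "solid 0 v \<in> L" using less.prems w L.solid_in_iff[of 0 v a] by simp
        then have "solid 0 v \<in> L'"
          using L.block_sums_iff[OF w(2)] L'.block_sums_iff[OF w(2)] sums by blast
        then show ?thesis using w Nil L'.solid_in_iff[of 0 v a] by simp
      next
        case (Cons p r)
        have "p \<in> set (z @ u)" using Cons by simp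
        then have "p \<in> set w" using w by auto
        then obtain b where "snd p = Some b" using some by blast
        then obtain y where p: "p = (y, Some b)" by (cases p) auto
        have a: "a \<notin> labels ([(y, Some b)] @ r)" using w(3) Cons p by (metis Un_commute append_Cons append_Nil labels_simps(4))
        have in_L: "solid a v @ [(y, Some b)] @ r \<in> L"
          using L.rotate[of u "solid a v @ z"] less.prems w Cons p by simp
        have "solid 0 (opposite (opposite v)) @ solid 1 (opposite v) \<in> L"
          using L.rotate[OF L.project_block[of u a v z 1 0]] less.prems w by simp
        then have "color_sum v \<in> opposite_block_sums L'"
          using L.opposite_block_sums_iff[OF w(2)] sums by auto
        moreover have "solid b v @ [(y, Some b)] @ r \<in> L'"
        proof (rule less.hyps)
          obtain v0 x where v: "v = v0 @ [x]" using w(2) by (cases v rule: rev_cases) auto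
          have "solid a v0 @ [(x, Some a), (y, Some b)] @ r \<in> L" using in_L v by simp
          from L.merge_in[OF L.four_block_in this]
          show "solid b v @ [(y, Some b)] @ r \<in> L"
            using a by (auto simp: v split: if_splits)
          have "labels (solid b v @ [(y, Some b)] @ r) = labels w - {a}"
          proof -
            have "labels w = labels (solid a v) \<union> labels (z @ u)" using w(1) by auto
            also have "\<dots> = insert a (labels ([(y, Some b)] @ r))" using Cons p w(2) by (auto simp: labels_solid)
            finally show ?thesis using a by (auto simp: labels_solid)
          qed
          moreover have "a \<in> labels w" using w by (simp add: labels_solid)
          ultimately show "card (labels (solid b v @ [(y, Some b)] @ r)) < card (labels w)"
            by (metis card_Diff1_less finite_labels)
        qed
        ultimately have "solid a v @ [(y, Some b)] @ r \<in> L'" using L'.split_block a w(2) by blast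
        then have "solid a v @ z @ u \<in> L'" using Cons p by simp
        then show ?thesis using L'.rotate[of "solid a v @ z" u] w(1) by simp
      qed
    qed
  qed
qed

section \<open>Singletons\<close>

definition single_sums :: "letter list set \<Rightarrow> int set" where
  "single_sums L = {n. \<exists>v. color_sum v = n \<and> singles v \<in> L}"

text \<open>If \<open>y\<close> is the inverse of \<open>x\<close>, such a word is a string of color \<open>x\<close> that can be moved past singletons
of color sum \<open>n\<close>. The singletons \<open>v'\<close> make the total color sum zero, so that words of this form can be
composed and inserted without changing total color sums.\<close>

definition pair_spacing :: "letter list set \<Rightarrow> color \<Rightarrow> int \<Rightarrow> color \<Rightarrow> bool" where
  "pair_spacing L x n y \<longleftrightarrow> (\<exists>v v'. color_sum v = n \<and> color_sum v' = - n - charge x - charge y \<and>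
    [(x, Some 0)] @ singles v @ [(y, Some 0)] @ singles v' \<in> L)"

locale singleton_category = word_category +
  assumes singles_in: "singles [White, Black] \<in> L"
begin

lemma opposite_singles_in: "singles [x, inv_color x] \<in> L"
  using singles_in rotate[of "singles [White]" "singles [Black]"] by (cases x) auto

lemma singles_insert:
  assumes "color_sum z = 0" "u @ w \<in> L"
  shows "u @ singles z @ w \<in> L"
  using assms(1)
proof (induction rule: color_sum_zero_induct)
  case Nil
  then show ?case using assms by simp
next
  case (Insert z1 x z2)
  have "(u @ singles z1) @ singles [x, inv_color x] @ (singles z2 @ w) \<in> L"
    using Insert(2) opposite_singles_in by - (rule insert_in; auto)
  then show ?case by simp
qed

lemma singles_swap:
  assumes "u @ singles v @ w \<in> L" "color_sum v = color_sum v'"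
  shows "u @ singles v' @ w \<in> L"
proof -
  have "(u @ singles v) @ singles (opposite v' @ v') @ w \<in> L"
    using assms(1) by - (rule singles_insert; auto)
  then have "u @ singles (v @ opposite v') @ singles v' @ w \<in> L" by simp
  then show ?thesis by (rule singles_remove[rotated]) (use assms in simp)
qed

text \<open>Insert a pair of singletons before the letter and cap the second one with it.\<close>

lemma cut:
  assumes "u @ [(x, l)] @ v \<in> L"
  shows "u @ [(x, None)] @ v \<in> L"
proof -
  have "u @ singles [x, inv_color x] @ [(x, l)] @ v \<in> L"
    using assms by - (rule singles_insert; auto)
  then have "(u @ [(x, None)]) @ [(inv_color x, None), (inv_color (inv_color x), l)] @ v \<in> L" by simp
  from cap_None_left[OF this] show ?thesis by simp
qed

lemma cut_word: "u @ w @ v \<in> L \<Longrightarrow> u @ singles (map fst w) @ v \<in> L"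
proof (induction w arbitrary: u)
  case (Cons p w)
  have "u @ [(fst p, snd p)] @ (w @ v) \<in> L" using Cons.prems by simp
  then have "(u @ [(fst p, None)]) @ w @ v \<in> L" using cut by fastforce
  from Cons.IH[OF this] show ?case by simp
qed simp

lemma single_sums_iff: "color_sum v \<in> single_sums L \<longleftrightarrow> singles v \<in> L"
  unfolding single_sums_def using singles_swap[of "[]" _ "[]" v] by auto

lemma total_in_single_sums: "w \<in> L \<Longrightarrow> color_sum (map fst w) \<in> single_sums L"
  using cut_word[of "[]" w "[]"] by (simp add: single_sums_iff)

lemma single_sums_diff: "n \<in> single_sums L \<Longrightarrow> m \<in> single_sums L \<Longrightarrow> n - m \<in> single_sums L"
proof -
  assume "n \<in> single_sums L" "m \<in> single_sums L"
  then obtain v v' where v: "n = color_sum v" "singles v \<in> L" and v': "m = color_sum v'" "singles v' \<in> L"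
    by (auto simp: single_sums_def)
  have "singles v @ singles (opposite v') \<in> L"
    using append_in[OF v(2)] reflect_in[OF v'(2)] by simp
  then show ?thesis using single_sums_iff[of "v @ opposite v'"] v v' by simp
qed

lemma zero_in_single_sums: "0 \<in> single_sums L"
  using single_sums_iff[of "[]"] Nil_in by simp

lemma single_sums_multiples: "\<exists>k::nat. single_sums L = {n. int k dvd n}"
  using zero_in_single_sums single_sums_diff by (rule int_subgroup_multiples)

lemma pair_spacing_iff:
  assumes "color_sum v' = - color_sum v - charge x - charge y"
  shows "pair_spacing L x (color_sum v) y \<longleftrightarrow>
    [(x, Some a)] @ singles v @ [(y, Some a)] @ singles v' \<in> L"
proof -
  have label: "[(x, Some b)] @ singles v @ [(y, Some b)] @ singles v' \<in> L \<Longrightarrow>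
      [(x, Some c)] @ singles v @ [(y, Some c)] @ singles v' \<in> L" for b c
    using relabel_in[of "[(x, Some b)] @ singles v @ [(y, Some b)] @ singles v'" "\<lambda>_. c"] by simp
  have "[(x, Some 0)] @ singles v @ [(y, Some 0)] @ singles v' \<in> L" if spacing: "pair_spacing L x (color_sum v) y"
  proof -
    obtain w w' where w: "color_sum w = color_sum v" "color_sum w' = color_sum v'"
      "[(x, Some 0)] @ singles w @ [(y, Some 0)] @ singles w' \<in> L"
      using spacing assms by (auto simp: pair_spacing_def)
    have "[(x, Some 0)] @ singles v @ [(y, Some 0)] @ singles w' \<in> L"
      using singles_swap[OF w(3,1)] .
    then have "([(x, Some 0)] @ singles v @ [(y, Some 0)]) @ singles w' @ [] \<in> L" by simp
    then show ?thesis using singles_swap[OF _ w(2)] by fastforce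
  qed
  then show ?thesis using label[of 0 a] label[of a 0] assms by (auto simp: pair_spacing_def)
qed

lemma pair_spacingE:
  assumes "pair_spacing L x n y"
  obtains v v' where "color_sum v = n" "color_sum v' = - n - charge x - charge y"
    "[(x, Some a)] @ singles v @ [(y, Some a)] @ singles v' \<in> L"
proof -
  obtain v v' where v: "color_sum v = n" "color_sum v' = - n - charge x - charge y"
    using ex_color_sum by metis
  then show ?thesis using that[OF v] pair_spacing_iff[of v' v x y a] assms by simp
qed

lemma pair_spacing_rotate: "pair_spacing L x n y \<Longrightarrow> pair_spacing L y (- n - charge x - charge y) x"
proof -
  assume "pair_spacing L x n y"
  then obtain v v' where v: "color_sum v = n" "color_sum v' = - n - charge x - charge y"
    "[(x, Some 0)] @ singles v @ [(y, Some 0)] @ singles v' \<in> L" by (rule pair_spacingE)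
  have "[(y, Some 0)] @ singles v' @ [(x, Some 0)] @ singles v \<in> L"
    using rotate[of "[(x, Some 0)] @ singles v" "[(y, Some 0)] @ singles v'"] v(3) by simp
  then show ?thesis using pair_spacing_iff[of v v' y x 0] v by simp
qed

lemma pair_spacing_reflect: "pair_spacing L x n y \<Longrightarrow> pair_spacing L (inv_color y) (- n) (inv_color x)"
proof -
  assume "pair_spacing L x n y"
  then obtain v v' where v: "color_sum v = n" "color_sum v' = - n - charge x - charge y"
    "[(x, Some 0)] @ singles v @ [(y, Some 0)] @ singles v' \<in> L" by (rule pair_spacingE)
  from reflect_in[OF v(3)] have "singles (opposite v') @ [(inv_color y, Some 0)] @ singles (opposite v) @
      [(inv_color x, Some 0)] \<in> L" by simp
  then have "[(inv_color y, Some 0)] @ singles (opposite v) @ [(inv_color x, Some 0)] @ singles (opposite v') \<in> L"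
    using rotate by fastforce
  then show ?thesis
    using pair_spacing_iff[of "opposite v'" "opposite v" "inv_color y" "inv_color x" 0] v by simp
qed

text \<open>Concatenation of strings: the right end of the first pair is capped with the left end of the second
pair.\<close>

lemma pair_spacing_comp:
  assumes "pair_spacing L x n y" "pair_spacing L (inv_color y) m z"
  shows "pair_spacing L x (n + m) z"
proof -
  obtain v v' where v: "color_sum v = n" "color_sum v' = - n - charge x - charge y"
    "[(x, Some 0)] @ singles v @ [(y, Some 0)] @ singles v' \<in> L" using assms(1) by (rule pair_spacingE)
  obtain u u' where u: "color_sum u = m" "color_sum u' = - m - charge (inv_color y) - charge z"
    "[(inv_color y, Some 1)] @ singles u @ [(z, Some 1)] @ singles u' \<in> L"
    using assms(2) by (rule pair_spacingE)
  have "([(x, Some 0)] @ singles v @ [(y, Some 0)]) @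
      ([(inv_color y, Some 1)] @ singles u @ [(z, Some 1)] @ singles u') @ singles v' \<in> L"
    using v(3) u(3) by - (rule insert_in; auto)
  then have "([(x, Some 0)] @ singles v) @ [(y, Some 0), (inv_color y, Some 1)] @
      (singles u @ [(z, Some 1)] @ singles u' @ singles v') \<in> L" by simp
  from cap_Some[OF this]
  have "[(x, Some 1)] @ singles (v @ u) @ [(z, Some 1)] @ singles (u' @ v') \<in> L" by simp
  then show ?thesis using pair_spacing_iff[of "u' @ v'" "v @ u" x z 1] v u by simp
qed

text \<open>A word of singletons in the category can be inserted anywhere, in particular between the two points
of a pair.\<close>

lemma pair_spacing_of_single_sum:
  assumes "n \<in> single_sums L"
  shows "pair_spacing L x n (inv_color x)"
proof -
  obtain v where v: "color_sum v = n" using ex_color_sum by blast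
  have "[(x, Some 0)] @ singles v @ [(inv_color x, Some 0)] \<in> L"
    using insert_in[of "[(x, Some 0)]" "[(inv_color x, Some 0)]" "singles v"] pair_in[of x 0]
      assms v single_sums_iff by auto
  moreover have "singles (opposite v) \<in> L" using assms v single_sums_iff reflect_in by fastforce
  ultimately have "([(x, Some 0)] @ singles v @ [(inv_color x, Some 0)]) @ singles (opposite v) \<in> L"
    by - (rule append_in; auto)
  then show ?thesis using pair_spacing_iff[of "opposite v" v x "inv_color x" 0] v by simp
qed

lemma pair_spacing_zero: "pair_spacing L x 0 (inv_color x)"
  by (rule pair_spacing_of_single_sum[OF zero_in_single_sums])

text \<open>All letters except the two under consideration are cut. The total color sum of the result is that of
a word of singletons, which can be compensated.\<close>

lemma pair_spacing_of_block:
  assumes "u @ [(x, Some a)] @ m @ [(y, Some a)] @ v \<in> L"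
  shows "pair_spacing L x (color_sum (map fst m)) y"
proof -
  let ?m = "map fst m" and ?r = "map fst (v @ u)"
  have "([(x, Some a)] @ m @ [(y, Some a)]) @ (v @ u) \<in> L"
    using rotate[of u "[(x, Some a)] @ m @ [(y, Some a)] @ v"] assms by simp
  then have "[(x, Some a)] @ m @ [(y, Some a)] @ (v @ u) \<in> L" by simp
  from cut_word[OF this] have "([(x, Some a)] @ singles ?m @ [(y, Some a)]) @ (v @ u) @ [] \<in> L" by simp
  from cut_word[OF this] have *: "[(x, Some a)] @ singles ?m @ [(y, Some a)] @ singles ?r \<in> L" by simp
  let ?t = "opposite ([x] @ ?m @ [y] @ ?r)"
  have "color_sum ([x] @ ?m @ [y] @ ?r) \<in> single_sums L"
    using total_in_single_sums[OF *] by (simp add: singles_def comp_def)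
  then have "singles ?t \<in> L" using single_sums_iff reflect_in by fastforce
  then have "([(x, Some a)] @ singles ?m @ [(y, Some a)] @ singles ?r) @ singles ?t \<in> L"
    using * by - (rule append_in; auto)
  then have "[(x, Some a)] @ singles ?m @ [(y, Some a)] @ singles (?r @ ?t) \<in> L" by simp
  then show ?thesis using pair_spacing_iff[of "?r @ ?t" ?m x y a] by simp
qed

text \<open>Insert the pair with the right spacing in front; the singletons that follow it cancel against the
two letters that have been cut and everything between them.\<close>

lemma restore_pair:
  assumes "u @ [(x, None)] @ singles m @ [(y, None)] @ v \<in> L"
    and "pair_spacing L x (color_sum m) y" and "a \<notin> labels (u @ v)"
  shows "u @ [(x, Some a)] @ singles m @ [(y, Some a)] @ v \<in> L"
proof -
  let ?t = "opposite ([x] @ m @ [y])"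
  have "[(x, Some a)] @ singles m @ [(y, Some a)] @ singles ?t \<in> L"
    using assms(2) pair_spacing_iff[of ?t m x y a] by simp
  then have "u @ ([(x, Some a)] @ singles m @ [(y, Some a)] @ singles ?t) @
      ([(x, None)] @ singles m @ [(y, None)] @ v) \<in> L"
    using assms by - (rule insert_in; auto)
  then have "(u @ [(x, Some a)] @ singles m @ [(y, Some a)]) @ singles (?t @ [x] @ m @ [y]) @ v \<in> L"
    by simp
  then have "(u @ [(x, Some a)] @ singles m @ [(y, Some a)]) @ v \<in> L"
    by (rule singles_remove[rotated]) simp
  then show ?thesis by simp
qed

text \<open>As for pairs, but the block of \<open>y\<close> must be kept. So a block of three points
with colors \<open>x\<close>, \<open>y\<close> and the inverse of \<open>y\<close> is inserted in front, and its last point is finally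
capped with \<open>y\<close>, which joins the two blocks.\<close>

lemma restore_point:
  assumes block: "solid 0 [White, Black, White, Black] \<in> L"
    and p: "u @ [(x, None)] @ singles m @ [(y, Some a)] @ v \<in> L"
    and "pair_spacing L x (color_sum m) y"
  shows "u @ [(x, Some a)] @ singles m @ [(y, Some a)] @ v \<in> L"
proof -
  let ?y = "inv_color y"
  obtain c where c: "c \<notin> labels (u @ [(y, Some a)] @ v)" using ex_fresh by blast
  \<comment> \<open>The label \<open>d\<close> is for the four-block that turns the last point of the inserted pair into three points.\<close>
  obtain d where d: "d \<notin> labels [(y, Some c)]" using ex_fresh by blast
  let ?t = "opposite ([x] @ m @ [y])"
  have pair: "[(x, Some c)] @ singles m @ [(y, Some c)] @ singles ?t \<in> L"
    using assms(3) pair_spacing_iff[of ?t m x y c] by simp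
  have "solid 0 [y, ?y, y, ?y] \<in> L" using block alternating_rotate[of y] by simp
  then have "solid d [y, ?y, y, ?y] \<in> L" using solid_in_iff[of 0 "[y, ?y, y, ?y]" d] by simp
  then have "([(x, Some c)] @ singles m) @ solid d [y, ?y, y, ?y] @ ([(y, Some c)] @ singles ?t) \<in> L"
    using pair d by - (rule insert_in; auto)
  then have "([(x, Some c)] @ singles m @ solid d [y, ?y, y]) @
      [(?y, Some d), (inv_color ?y, Some c)] @ singles ?t \<in> L" by simp
  from cap_Some[OF this] have triple: "[(x, Some c)] @ singles m @ solid c [y, ?y, y] @ singles ?t \<in> L"
    using d by simp
  have "u @ ([(x, Some c)] @ singles m @ solid c [y, ?y, y] @ singles ?t) @
      ([(x, None)] @ singles m @ [(y, Some a)] @ v) \<in> L"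
    using p triple c by - (rule insert_in; auto)
  then have "(u @ [(x, Some c)] @ singles m @ solid c [y, ?y]) @ [(y, Some c)] @
      (singles ?t @ [(x, None)] @ singles m @ [(y, Some a)] @ v) \<in> L" by simp
  from cut[OF this]
  have "(u @ [(x, Some c)] @ singles m @ solid c [y, ?y]) @ singles ([y] @ ?t @ [x] @ m) @ [(y, Some a)] @ v \<in> L"
    by simp
  then have "(u @ [(x, Some c)] @ singles m @ solid c [y, ?y]) @ [(y, Some a)] @ v \<in> L"
    by (rule singles_remove[rotated]) simp
  then have "(u @ [(x, Some c)] @ singles m @ [(y, Some c)]) @ [(?y, Some c), (inv_color ?y, Some a)] @ v \<in> L"
    by simp
  from cap_Some[OF this] show ?thesis
    using c by (auto split: if_splits)
qed

text \<open>Projecting onto \<open>x m y\<close> gives a block of four points, two of which are separated from the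
others by \<open>m\<close> and its reflection. Joining two copies makes the two occurrences of \<open>m\<close> and of its
reflection adjacent, so that they cancel.\<close>

lemma alternating_if_triple:
  assumes p: "u @ [(x, Some a)] @ singles m @ [(y, Some a)] @ v \<in> L" and "a \<in> labels (u @ v)"
  shows "solid 0 [White, Black, White, Black] \<in> L"
proof -
  let ?x = "inv_color x" and ?y = "inv_color y"
  have "(v @ u) @ [(x, Some a)] @ singles m @ [(y, Some a)] \<in> L"
    using rotate[of "u @ [(x, Some a)] @ singles m @ [(y, Some a)]" v] p by simp
  from project[OF this] have "[(?y, Some a)] @ singles (opposite m) @ [(?x, Some a), (x, Some a)] @
      singles m @ [(y, Some a)] \<in> L" using assms(2) by auto
  then have q: "[(?y, Some b)] @ singles (opposite m) @ [(?x, Some b), (x, Some b)] @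
      singles m @ [(y, Some b)] \<in> L" for b
    using relabel_in[of _ "\<lambda>_. b"] by fastforce
  have A: "[(y, Some 0), (?y, Some 0)] @ singles (opposite m) @ [(?x, Some 0), (x, Some 0)] @ singles m \<in> L"
    using rotate[of "[(?y, Some 0)] @ singles (opposite m) @ [(?x, Some 0), (x, Some 0)] @ singles m"
      "[(y, Some 0)]"] q[of 0] by simp
  have B: "singles (opposite m) @ [(?x, Some 1), (x, Some 1)] @ singles m @ [(y, Some 1), (?y, Some 1)] \<in> L"
    using rotate[of "[(?y, Some 1)]" "singles (opposite m) @ [(?x, Some 1), (x, Some 1)] @ singles m @ [(y, Some 1)]"]
      q[of 1] by simp
  have "([(y, Some 0), (?y, Some 0)] @ singles (opposite m) @ [(?x, Some 0), (x, Some 0)]) @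
      singles (m @ opposite m) @ [(?x, Some 1), (x, Some 1)] @ singles m @ [(y, Some 1), (?y, Some 1)] \<in> L"
    using append_in[OF A B] by simp
  then have "([(y, Some 0), (?y, Some 0)] @ singles (opposite m) @ [(?x, Some 0), (x, Some 0)]) @
      [(?x, Some 1), (x, Some 1)] @ singles m @ [(y, Some 1), (?y, Some 1)] \<in> L"
    by (rule singles_remove[rotated]) simp
  then have "([(y, Some 0), (?y, Some 0)] @ singles (opposite m) @ [(?x, Some 0)]) @
      [(x, Some 0), (?x, Some 1)] @ [(x, Some 1)] @ singles m @ [(y, Some 1), (?y, Some 1)] \<in> L" by simp
  from cap_Some[OF this]
  have "([(y, Some 1), (?y, Some 1)] @ singles (opposite m)) @ [(?x, Some 1), (inv_color ?x, Some 1)] @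
      singles m @ [(y, Some 1), (?y, Some 1)] \<in> L" by simp
  from cap_equal[OF this]
  have "[(y, Some 1), (?y, Some 1)] @ singles (opposite m @ m) @ [(y, Some 1), (?y, Some 1)] \<in> L" by simp
  then have "[(y, Some 1), (?y, Some 1)] @ [(y, Some 1), (?y, Some 1)] \<in> L"
    by (rule singles_remove[rotated]) simp
  then have "solid 0 [y, ?y, y, ?y] \<in> L" using solid_in_iff[of 0 "[y, ?y, y, ?y]" 1] by simp
  then show ?thesis using alternating_rotate by blast
qed

end

lemma word_decomp:
  assumes "i < length w" "snd (w ! i) = Some a"
  shows "w = take i w @ [(fst (w ! i), Some a)] @ drop (Suc i) w"
proof -
  have "w ! i = (fst (w ! i), Some a)" using assms by (simp add: prod_eq_iff)
  then show ?thesis using id_take_nth_drop[OF assms(1)] by simp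
qed

text \<open>The induction measure: cutting a labelled letter off its block lowers it.\<close>

definition linked :: "letter list \<Rightarrow> nat" where
  "linked w = length (filter (\<lambda>p. snd p \<noteq> None) w)"

lemma linked_simps [simp]:
  "linked [] = 0" "linked ((x, None) # w) = linked w" "linked ((x, Some a) # w) = Suc (linked w)"
  "linked (u @ w) = linked u + linked w" "linked (singles v) = 0"
  by (simp_all add: linked_def singles_def filter_empty_conv)

text \<open>Of two letters of one block with only singletons between them, cut the first one, or both if they
are the whole block. Their spacing is also a spacing of \<open>L'\<close>, so they can be restored there.\<close>

lemma singleton_category_subset:
  assumes "singleton_category L" "singleton_category L'"
    and nc: "\<And>w. w \<in> L \<Longrightarrow> crossing_free w"
    and block: "solid 0 [White, Black, White, Black] \<in> L \<Longrightarrow> solid 0 [White, Black, White, Black] \<in> L'"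
    and sums: "single_sums L \<subseteq> single_sums L'"
    and spacing: "\<And>x n y. pair_spacing L x n y \<Longrightarrow> pair_spacing L' x n y"
  shows "L \<subseteq> L'"
proof
  interpret L: singleton_category L by fact
  interpret L': singleton_category L' by fact
  fix w assume "w \<in> L"
  then show "w \<in> L'"
  proof (induction "linked w" arbitrary: w rule: less_induct)
    case less
    consider "labels w = {}"
      | u x a v where "w = u @ [(x, Some a)] @ v" "a \<notin> labels (u @ v)"
      | u x a m y v where "w = u @ [(x, Some a)] @ singles m @ [(y, Some a)] @ v"
    proof (cases "\<forall>i a. i < length w \<longrightarrow> snd (w ! i) = Some a \<longrightarrow>
        (\<exists>j < length w. j \<noteq> i \<and> snd (w ! j) = Some a)")
      case True
      then show ?thesis using ex_nearest_pair[OF nc[OF less.prems]] that by metis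
    next
      case False
      then obtain i a where i: "i < length w" "snd (w ! i) = Some a"
        "\<And>j. j < length w \<Longrightarrow> j \<noteq> i \<Longrightarrow> snd (w ! j) \<noteq> Some a" by blast
      have "a \<notin> labels (take i w)"
      proof
        assume "a \<in> labels (take i w)"
        then obtain k where "k < i" "k < length w" "snd (w ! k) = Some a"
          by (force simp: labels_def in_set_conv_nth)
        then show False using i(3)[of k] by simp
      qed
      moreover have "a \<notin> labels (drop (Suc i) w)"
      proof
        assume "a \<in> labels (drop (Suc i) w)"
        then obtain k where k: "k < length w - Suc i" "snd (w ! (Suc i + k)) = Some a"
          by (force simp: labels_def in_set_conv_nth)
        then have "Suc i + k < length w" by simp
        then show False using i(3)[of "Suc i + k"] k(2) by simp
      qed
      ultimately show ?thesis using that(2)[OF word_decomp[OF i(1,2)]] by simp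
    qed
    then show ?case
    proof cases
      case 1
      have "w = singles (map fst w)"
      proof (rule all_None_singles)
        fix p assume "p \<in> set w"
        then show "snd p = None" using 1 by (cases "snd p") (force simp: labels_def)+
      qed
      then show ?thesis using less.prems L.single_sums_iff L'.single_sums_iff sums by (metis subsetD)
    next
      case (2 u x a v)
      have "u @ [(x, None)] @ v \<in> L" using L.singleton_iff[OF 2(2)] less.prems 2(1) by simp
      then have "u @ [(x, None)] @ v \<in> L'" using less.hyps 2(1) by simp
      then show ?thesis using L'.singleton_iff[OF 2(2)] 2(1) by simp
    next
      case (3 u x a m y v)
      have w: "u @ [(x, Some a)] @ singles m @ [(y, Some a)] @ v \<in> L" using less.prems 3 by simp
      have sp: "pair_spacing L' x (color_sum m) y"
        using spacing[OF L.pair_spacing_of_block[OF w]] by (simp add: singles_def comp_def)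
      have cutx: "u @ [(x, None)] @ singles m @ [(y, Some a)] @ v \<in> L" by (rule L.cut[OF w])
      show ?thesis
      proof (cases "a \<in> labels (u @ v)")
        case True
        have "u @ [(x, None)] @ singles m @ [(y, Some a)] @ v \<in> L'"
          using less.hyps[OF _ cutx] 3 by simp
        then show ?thesis unfolding 3
          by (rule L'.restore_point[OF block[OF L.alternating_if_triple[OF w True]] _ sp])
      next
        case False
        have "u @ [(x, None)] @ singles m @ [(y, None)] @ v \<in> L"
          using L.cut[of "u @ [(x, None)] @ singles m" y "Some a" v] cutx by simp
        from less.hyps[OF _ this] have "u @ [(x, None)] @ singles m @ [(y, None)] @ v \<in> L'"
          using 3 by simp
        then show ?thesis unfolding 3 by (rule L'.restore_pair[OF _ sp False])
      qed
    qed
  qed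
qed

section \<open>Pair spacings\<close>

context singleton_category
begin

text \<open>Moving a string past some singletons and then another string back gives the difference.\<close>

lemma spacing_multiples: "\<exists>d::nat. {n. pair_spacing L White n Black} = {n. int d dvd n}"
proof (rule int_subgroup_multiples)
  show "0 \<in> {n. pair_spacing L White n Black}" using pair_spacing_zero[of White] by simp
  fix n m assume "n \<in> {n. pair_spacing L White n Black}" "m \<in> {n. pair_spacing L White n Black}"
  then show "n - m \<in> {n. pair_spacing L White n Black}"
    using pair_spacing_comp[of White n Black "- m" Black] pair_spacing_reflect[of White m Black] by simp
qed

lemma spacing_Black_White: "pair_spacing L Black n White \<longleftrightarrow> pair_spacing L White (- n) Black"
  using pair_spacing_rotate[of Black n White] pair_spacing_rotate[of White "- n" Black] by auto

lemma spacing_Black_Black: "pair_spacing L Black n Black \<longleftrightarrow> pair_spacing L White (- n) White"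
  using pair_spacing_reflect[of Black n Black] pair_spacing_reflect[of White "- n" White] by auto

lemma spacing_White_White_diff:
  assumes "pair_spacing L White n White" "pair_spacing L White m White"
  shows "pair_spacing L White (n - m) Black"
  using pair_spacing_comp[OF assms(1), of "- m" Black] assms(2) by (simp add: spacing_Black_Black)

lemma spacing_White_White_shift:
  assumes "pair_spacing L White n White" "pair_spacing L White m Black"
  shows "pair_spacing L White (n - m) White"
  using pair_spacing_comp[OF assms(1), of "- m" White] assms(2) by (simp add: spacing_Black_White)

text \<open>Rotation exchanges the words before and after the second letter, so it replaces the spacing \<open>n\<close> by
\<open>- n - 2\<close>.\<close>

lemma spacing_White_White_double:
  assumes "pair_spacing L White n White"
  shows "pair_spacing L White (2 * (n + 1)) Black"
  using spacing_White_White_diff[OF assms, of "- n - 2"] pair_spacing_rotate[OF assms]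
  by (simp add: algebra_simps)

lemma global_if_spacing_zero:
  assumes "pair_spacing L White 0 White"
  shows "solid 0 [White, White] @ solid 1 [Black, Black] \<in> L"
proof -
  have p: "[(White, Some a)] @ singles [] @ [(White, Some a)] @ singles [Black, Black] \<in> L" for a
    using assms pair_spacing_iff[of "[Black, Black]" "[]" White White a] by simp
  have "singles [White, White] @ solid 1 [Black, Black] \<in> L" using reflect_in[OF p[of 1]] by simp
  then have "(solid 0 [White, White] @ singles [Black, Black]) @ singles [White, White] @ solid 1 [Black, Black] \<in> L"
    using p[of 0] by - (rule append_in; auto)
  then have "solid 0 [White, White] @ singles [Black, Black, White, White] @ solid 1 [Black, Black] \<in> L"
    by simp
  then show ?thesis by (rule singles_remove[rotated]) simp
qed

lemma lambda_word_iff: "singles (replicate d White) @ [(White, Some 0)] @ singles (replicate d Black) @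
    [(Black, Some 0)] \<in> L \<longleftrightarrow> pair_spacing L White (- int d) Black"
  using pair_spacing_iff[of "replicate d White" "replicate d Black" White Black 0]
    rotate_iff[of "singles (replicate d White)"
      "[(White, Some 0)] @ singles (replicate d Black) @ [(Black, Some 0)]"] by simp

text \<open>Rotated and reflected, \<open>\<mu>\<^sub>r\<close> becomes a pair of white points with spacing \<open>r - 1\<close>; the formula also
covers the separately defined \<open>\<mu>\<^sub>0\<close>.\<close>

lemma mu_word_iff: "singles (replicate (r + 1) White) @ [(Black, Some 0)] @
    singles (if r = 0 then [White] else replicate (r - 1) Black) @ [(Black, Some 0)] \<in> L \<longleftrightarrow>
    pair_spacing L White (int r - 1) White"
proof -
  let ?t = "if r = 0 then [White] else replicate (r - 1) Black"
  have "color_sum ?t = 1 - int r" by (auto simp: of_nat_diff)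
  then show ?thesis
    using pair_spacing_iff[of "replicate (r + 1) White" ?t Black Black 0] spacing_Black_Black[of "1 - int r"]
      rotate_iff[of "singles (replicate (r + 1) White)" "[(Black, Some 0)] @ singles ?t @ [(Black, Some 0)]"]
    by simp
qed

end

lemma pair_spacing_subset:
  assumes "singleton_category L" "singleton_category L'"
    and D: "\<And>n. pair_spacing L White n Black \<Longrightarrow> pair_spacing L' White n Black"
    and E: "\<And>n. pair_spacing L White n White \<Longrightarrow>
      \<exists>m. pair_spacing L White m White \<and> pair_spacing L' White m White"
    and "pair_spacing L x n y"
  shows "pair_spacing L' x n y"
proof -
  interpret L: singleton_category L by fact
  interpret L': singleton_category L' by fact
  have WW: "pair_spacing L' White n White" if n: "pair_spacing L White n White" for n
  proof -
    obtain m where m: "pair_spacing L White m White" "pair_spacing L' White m White" using E[OF n] by blast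
    show ?thesis using L'.spacing_White_White_shift[OF m(2) D[OF L.spacing_White_White_diff[OF m(1) n]]] by simp
  qed
  show ?thesis using assms(5) D[of n] D[of "- n"] WW[of n] WW[of "- n"]
    by (cases x; cases y)
      (simp_all add: L.spacing_Black_White L'.spacing_Black_White L.spacing_Black_Black L'.spacing_Black_Black)
qed

section \<open>The special partitions as words\<close>

lemma one_block_word: "one_block cs = word_part (solid a cs)"
proof (cases "cs = []")
  case True
  then show ?thesis by (simp add: one_block_def word_part_def kernel_part_def pts_def)
next
  case False
  then show ?thesis
    unfolding one_block_kernel[OF False]
    by (intro kernel_part_eq_word_part) (auto simp: same_block_def solid_def comp_def)
qed

lemma sigma_word: "sigma x = word_part (singles [x])"
  unfolding sigma_def one_block_word[of _ 0] using word_singleton[of 0 "[]" "[]" x] by simp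

lemma empty_word: "empty_part = word_part []"
  by (simp add: empty_part_def word_part_def kernel_part_def pts_def)

lemma tensor_word:
  assumes "labels u \<inter> labels v = {}"
  shows "word_part u \<otimes> word_part v = word_part (u @ v)"
proof -
  have "word_part u \<otimes> word_part v =
      kernel_part ([] @ []) (map fst u @ map fst v) (word_label (u @ v))"
    unfolding word_part_def
  proof (rule tensor_kernel_part)
    fix x y assume "x \<in> pts [] (map fst u)" "y \<in> pts [] (map fst u)"
    then show "word_label (u @ v) x = word_label (u @ v) y \<longleftrightarrow> word_label u x = word_label u y"
      by (elim in_ptsE) (auto simp: nth_append)
  next
    fix x y assume "x \<in> pts [] (map fst v)" "y \<in> pts [] (map fst v)"
    then obtain i j where "x = Lo i" "y = Lo j" "i < length v" "j < length v"
      by (elim in_ptsE) auto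
    then show "word_label (u @ v) (shift (length ([] :: color list)) (length (map fst u)) x) =
        word_label (u @ v) (shift (length ([] :: color list)) (length (map fst u)) y) \<longleftrightarrow>
        word_label v x = word_label v y"
      by (simp add: word_label_eq_iff same_block_def del: word_label.simps)
  next
    fix x y assume "x \<in> pts [] (map fst u)" "y \<in> pts [] (map fst v)"
    then obtain i j where ij: "x = Lo i" "y = Lo j" "i < length u" "j < length v"
      by (elim in_ptsE) auto
    have "snd (u ! i) \<noteq> snd (v ! j) \<or> snd (u ! i) = None"
      using labelsI[OF ij(3)] labelsI[OF ij(4)] assms by (metis disjoint_iff option.exhaust)
    then show "word_label (u @ v) x \<noteq>
        word_label (u @ v) (shift (length ([] :: color list)) (length (map fst u)) y)"
      using ij by (auto simp: word_label_eq_iff same_block_def nth_append simp del: word_label.simps)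
  qed
  then show ?thesis by (simp add: word_part_def)
qed

lemma tensor_pow_sigma_word: "tensor_pow (sigma x) k = word_part (singles (replicate k x))"
proof (induction k)
  case (Suc k)
  have "tensor_pow (sigma x) (Suc k) = word_part (singles (replicate k x)) \<otimes> sigma x"
    by (simp only: tensor_pow.simps Suc)
  also have "\<dots> = word_part (singles (replicate k x) @ singles [x])"
    by (simp add: sigma_word tensor_word)
  also have "singles (replicate k x) @ singles [x] = singles (replicate (Suc k) x)"
    by (simp add: singles_def replicate_append_same)
  finally show ?case .
qed (simp add: empty_word)

lemma verticolor_bpart: "verticolor (bpart d) = one_block (replicate d Black)"
proof -
  have "mirror (bpart d) ` Lo ` {..<d} = Lo ` {..<d}"
  proof -
    have "(\<lambda>i. d - 1 - i) ` {..<d} = {..<d}"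
    proof
      show "{..<d} \<subseteq> (\<lambda>i. d - 1 - i) ` {..<d}"
      proof
        fix i assume "i \<in> {..<d}"
        then show "i \<in> (\<lambda>i. d - 1 - i) ` {..<d}" by (intro image_eqI[of _ _ "d - 1 - i"]) auto
      qed
    qed auto
    moreover have "mirror (bpart d) ` Lo ` {..<d} = Lo ` (\<lambda>i. d - 1 - i) ` {..<d}"
      by (simp add: image_image mirror_def bpart_def one_block_def)
    ultimately show ?thesis by simp
  qed
  then have "(`) (mirror (bpart d)) ` ({Lo ` {..<d}} - {{}}) = {Lo ` {..<d}} - {{}}"
    by (cases "d = 0") auto
  then show ?thesis
    by (simp add: verticolor_def bpart_def one_block_def)
qed

lemma opposite_replicate [simp]: "opposite (replicate n x) = replicate n (inv_color x)"
  by (simp add: opposite_def)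

lemma bpart_tensor_word: "bpart d \<otimes> verticolor (bpart d) =
    word_part (solid 0 (replicate d White) @ solid 1 (opposite (replicate d White)))"
  unfolding verticolor_bpart unfolding bpart_def one_block_word[of "replicate d White" 0]
    one_block_word[of "replicate d Black" 1]
  by (simp add: tensor_word labels_solid)

lemma one_pair_word:
  "one_pair (s @ [x] @ t @ [y]) (length s) (length s + length t + 1) =
    word_part (singles s @ [(x, Some 0)] @ singles t @ [(y, Some 0)])"
proof -
  let ?cs = "s @ [x] @ t @ [y]" and ?a = "length s" and ?b = "length s + length t + 1"
  let ?w = "singles s @ [(x, Some 0)] @ singles t @ [(y, Some 0)]"
  define f where "f p = (if p \<in> {Lo ?a, Lo ?b} then None else Some p)" for p
  have pts: "pts [] ?cs = insert (Lo ?a) (insert (Lo ?b) (Lo ` ({..<length ?cs} - {?a, ?b})))"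
    by (auto simp: pts_def)
  have "one_pair ?cs ?a ?b = kernel_part [] ?cs f"
  proof -
    have "{p \<in> pts [] ?cs. f p = f (Lo ?a)} = {Lo ?a, Lo ?b}"
      "{p \<in> pts [] ?cs. f p = f (Lo ?b)} = {Lo ?a, Lo ?b}"
      by (auto simp: f_def pts_def)
    moreover have "(\<lambda>i. {p \<in> pts [] ?cs. f p = f (Lo i)}) ` ({..<length ?cs} - {?a, ?b}) =
        (\<lambda>i. {Lo i}) ` ({..<length ?cs} - {?a, ?b})"
      by (rule image_cong) (auto simp: f_def pts_def)
    ultimately have "(\<lambda>q. {p \<in> pts [] ?cs. f p = f q}) ` pts [] ?cs =
        insert {Lo ?a, Lo ?b} ((\<lambda>i. {Lo i}) ` ({..<length ?cs} - {?a, ?b}))"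
      by (subst (2) pts) (simp add: image_image)
    then show ?thesis by (simp add: one_pair_def kernel_part_def)
  qed
  also have "\<dots> = word_part ?w"
  proof (rule kernel_part_eq_word_part)
    show "map fst ?w = ?cs" by (simp add: singles_def comp_def)
    have len: "length ?w = length ?cs" by (simp add: singles_def)
    have snd: "snd (?w ! i) = (if i = ?a \<or> i = ?b then Some 0 else None)" if "i < length ?w" for i
    proof -
      have "i < ?a \<or> i = ?a \<or> (?a < i \<and> i < ?b) \<or> i = ?b" using that len by auto
      then show ?thesis by (auto simp: singles_def nth_append nth_Cons split: nat.split)
    qed
    fix i j assume "i < length ?w" "j < length ?w"
    then show "f (Lo i) = f (Lo j) \<longleftrightarrow> same_block ?w i j"
      using snd[of i] snd[of j] by (simp add: f_def same_block_def)
  qed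
  finally show ?thesis .
qed

lemma lambda_part_word: "lambda_part d = word_part (singles (replicate d White) @
    [(White, Some 0)] @ singles (replicate d Black) @ [(Black, Some 0)])"
  using one_pair_word[of "replicate d White" White "replicate d Black" Black]
  by (simp add: lambda_part_def mult_2)

lemma mu_part_word: "mu_part r = word_part (singles (replicate (r + 1) White) @ [(Black, Some 0)] @
    singles (if r = 0 then [White] else replicate (r - 1) Black) @ [(Black, Some 0)])"
proof (cases "r = 0")
  case True
  then show ?thesis using one_pair_word[of "[White]" Black "[White]" Black]
    by (simp add: mu_part_def numeral_3_eq_3)
next
  case False
  then have "length (replicate (r + 1) White) + length (replicate (r - 1) Black) + 1 = 2 * r + 1"
    by simp
  then show ?thesis
    using one_pair_word[of "replicate (r + 1) White" Black "replicate (r - 1) Black" Black] False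
    by (simp add: mu_part_def mult_2)
qed

lemma beta_word: "beta x y z w = word_part (solid 0 [x, y, z, w])"
  unfolding beta_def by (rule one_block_word)

lemma sigma_pair_word: "sigma White \<otimes> sigma Black = word_part (singles [White, Black])"
  by (simp add: sigma_word tensor_word)

lemma pair_pair_word: "pair_part White White \<otimes> pair_part Black Black =
    word_part (solid 0 [White, White] @ solid 1 [Black, Black])"
  unfolding pair_part_def one_block_word[of "[White, White]" 0] one_block_word[of "[Black, Black]" 1]
  by (simp add: tensor_word)

section \<open>Classification\<close>

text \<open>The generated category is the intersection of all categories containing the generators, so it
contains \<open>C\<close> iff each of them does; and this is tested on words.\<close>

lemma eq_generatedI:
  assumes "category C" "G \<subseteq> C"
    and "\<And>D. category D \<Longrightarrow> G \<subseteq> D \<Longrightarrow> words C \<subseteq> words D"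
  shows "C = generated G"
proof
  show "generated G \<subseteq> C" unfolding generated_def by (rule hull_minimal) fact+
  show "C \<subseteq> generated G"
    unfolding generated_def hull_def
  proof (rule Inter_greatest)
    fix D assume "D \<in> {D. category D \<and> G \<subseteq> D}"
    then show "C \<subseteq> D" using category_subset_if_words_subset[OF assms(1)] assms(3)[of D] by simp
  qed
qed

lemma word_category_words: "category C \<Longrightarrow> word_category (words C)"
  by (rule partition_category.word_category_words) (rule partition_category.intro)

lemma singleton_category_words:
  "category C \<Longrightarrow> sigma White \<otimes> sigma Black \<in> C \<Longrightarrow> singleton_category (words C)"
  by (intro singleton_category.intro singleton_category_axioms.intro word_category_words)
    (simp_all only: words_def mem_Collect_eq sigma_pair_word)

lemma merging_category_words:
  assumes "category C" "beta White Black White Black \<in> C" "beta White White Black Black \<in> C"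
  shows "merging_category (words C)"
proof -
  interpret word_category "words C" using assms(1) by (rule word_category_words)
  have "solid 0 [White, Black, White, Black] \<in> words C" "solid 0 [White, White, Black, Black] \<in> words C"
    using assms by (simp_all only: words_def mem_Collect_eq beta_word)
  then have blocks: "solid 0 [x, inv_color x, x, inv_color x] \<in> words C"
    "solid 0 [x, x, inv_color x, inv_color x] \<in> words C" for x
    using alternating_rotate double_rotate by blast+
  show ?thesis
  proof
    fix x y
    show "solid 0 [x, y, inv_color y, inv_color x] \<in> words C"
    proof (cases "x = y")
      case False
      then have "y = inv_color x" by (simp add: neq_iff_inv_color)
      then show ?thesis using blocks(1)[of x] by simp
    qed (use blocks(2)[of x] in simp)
  qed
qed

locale local_NC_category =
  fixes C :: "tpart set"
  assumes is_category: "category C" and NC: "C \<subseteq> NC" and locally: "locally_colorized C"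
begin

sublocale word_category "words C"
  using is_category by (rule word_category_words)

lemma in_words_iff: "w \<in> words C \<longleftrightarrow> word_part w \<in> C"
  by (simp add: words_def)

lemma crossing_free: "w \<in> words C \<Longrightarrow> crossing_free w"
  using NC by (auto simp: words_def intro: crossing_free_if_NC)

lemma not_global: "solid 0 [White, White] @ solid 1 [Black, Black] \<notin> words C"
  using locally unfolding locally_colorized_def globally_colorized_def pair_pair_word words_def by simp

lemma case_O_classification:
  assumes "case_O C"
  shows "C = O_loc"
  unfolding O_loc_def
proof (rule eq_generatedI[OF is_category])
  fix D assume "category D"
  have "singles [White, Black] \<notin> words C" "solid 0 [White, Black, White, Black] \<notin> words C"
    using assms unfolding case_O_def in_words_iff sigma_pair_word beta_word by blast+
  then show "words C \<subseteq> words D"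
    using pairings_subset[OF word_category_axioms word_category_words[OF \<open>category D\<close>] crossing_free]
      not_global by blast
qed simp

lemma case_H_classification:
  assumes "case_H C"
  shows "C = H'_loc \<or> (\<exists>k d. k \<notin> {1, 2} \<and> d \<notin> {1, 2} \<and> d dvd k \<and> C = H_loc k d)"
proof (cases "beta White White Black Black \<in> C")
  case False
  have no_singles: "singles [White, Black] \<notin> words C" and block: "beta White Black White Black \<in> C"
    using assms unfolding case_H_def in_words_iff sigma_pair_word by blast+
  have "C = H'_loc"
    unfolding H'_loc_def
  proof (rule eq_generatedI[OF is_category])
    fix D assume D: "category D" "{beta White Black White Black} \<subseteq> D"
    then have "solid 0 [White, Black, White, Black] \<in> words D"
      unfolding words_def beta_word by simp
    then show "words C \<subseteq> words D"
      using alternating_blocks_subset[OF word_category_axioms word_category_words[OF D(1)] crossing_free]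
        no_singles block False unfolding in_words_iff beta_word by blast
  qed (use block in simp)
  then show ?thesis by blast
next
  case True
  have no_singles: "singles [White, Black] \<notin> words C" and block: "beta White Black White Black \<in> C"
    using assms unfolding case_H_def in_words_iff sigma_pair_word by blast+
  interpret merging_category "words C"
    using is_category block True by (rule merging_category_words)
  obtain k :: nat where k: "block_sums (words C) = {n. int k dvd n}" using block_sums_multiples by blast
  obtain d :: nat where d: "opposite_block_sums (words C) = {n. int d dvd n}"
    using opposite_block_sums_multiples by blast
  have "int k \<in> block_sums (words C)" unfolding k by simp
  then have "int k \<in> opposite_block_sums (words C)" by (rule subsetD[OF block_sums_subset_opposite])
  then have "d dvd k" by (simp add: d)
  have sum_k: "solid 0 (replicate j White) \<in> words C \<longleftrightarrow> k dvd j" if "j \<noteq> 0" for j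
    using block_sums_iff[of "replicate j White"] that k by simp
  have sum_d: "solid 0 (replicate j White) @ solid 1 (opposite (replicate j White)) \<in> words C \<longleftrightarrow> d dvd j"
    if "j \<noteq> 0" for j
    using opposite_block_sums_iff[of "replicate j White"] that d by simp
  have "d \<noteq> 1"
  proof
    assume "d = 1"
    then have "[(White, Some 0)] @ [(Black, Some 1)] @ [] \<in> words C" using sum_d[of 1] by simp
    then have "[(White, Some 0)] @ [(Black, None)] @ [] \<in> words C"
      by (subst (asm) singleton_iff) auto
    then show False using singleton_pair_in no_singles by blast
  qed
  moreover have "d \<noteq> 2"
  proof
    assume "d = 2"
    then show False using sum_d[of 2] not_global by (simp add: numeral_2_eq_2)
  qed
  moreover have "k \<noteq> 1" using \<open>d dvd k\<close> \<open>d \<noteq> 1\<close> by auto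
  moreover have "k \<noteq> 2"
  proof
    assume "k = 2"
    then have "d \<le> 2" using \<open>d dvd k\<close> by (auto dest: dvd_imp_le)
    moreover have "d \<noteq> 0" using \<open>d dvd k\<close> \<open>k = 2\<close> by (metis dvd_0_left_iff zero_neq_numeral)
    ultimately have "d = 1 \<or> d = 2" by linarith
    then show False using \<open>d \<noteq> 1\<close> \<open>d \<noteq> 2\<close> by blast
  qed
  moreover have "C = H_loc k d"
    unfolding H_loc_def
  proof (rule eq_generatedI[OF is_category])
    have "bpart k \<in> C"
      using sum_k[of k] Nil_in by (cases "k = 0") (auto simp: bpart_def one_block_word[of _ 0] in_words_iff)
    moreover have "bpart d \<otimes> verticolor (bpart d) \<in> C"
      unfolding bpart_tensor_word using sum_d[of d] Nil_in
      by (cases "d = 0") (auto simp: in_words_iff)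
    ultimately show "{bpart k, bpart d \<otimes> verticolor (bpart d), beta White White Black Black,
        beta White Black White Black} \<subseteq> C"
      using True block by simp
  next
    fix D assume D: "category D" "{bpart k, bpart d \<otimes> verticolor (bpart d), beta White White Black Black,
        beta White Black White Black} \<subseteq> D"
    interpret D: merging_category "words D"
      using D by (intro merging_category_words) auto
    obtain k' :: nat where k': "block_sums (words D) = {n. int k' dvd n}" using D.block_sums_multiples by blast
    obtain d' :: nat where d': "opposite_block_sums (words D) = {n. int d' dvd n}"
      using D.opposite_block_sums_multiples by blast
    have "k' dvd k"
    proof (cases "k = 0")
      case False
      have "solid 0 (replicate k White) \<in> words D"
        using D(2) by (auto simp: words_def bpart_def one_block_word[of _ 0])
      then show ?thesis using D.block_sums_iff[of "replicate k White"] False k' by simp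
    qed simp
    moreover have "d' dvd d"
    proof (cases "d = 0")
      case False
      have "solid 0 (replicate d White) @ solid 1 (opposite (replicate d White)) \<in> words D"
        using D(2) unfolding bpart_tensor_word by (simp add: words_def)
      then show ?thesis using D.opposite_block_sums_iff[of "replicate d White"] False d' by simp
    qed simp
    ultimately have "block_sums (words C) \<subseteq> block_sums (words D)"
      "opposite_block_sums (words C) \<subseteq> opposite_block_sums (words D)"
      unfolding k k' d d' by (auto intro: dvd_trans[OF of_nat_dvd_iff[THEN iffD2]])
    then show "words C \<subseteq> words D"
      by (intro merging_subset[OF merging_category_axioms D.merging_category_axioms crossing_free no_singles])
  qed
  ultimately show ?thesis using \<open>d dvd k\<close> by blast
qed

end

locale local_NC_singleton_category = local_NC_category +
  assumes singletons: "sigma White \<otimes> sigma Black \<in> C"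
begin

sublocale singleton_category "words C"
  using is_category singletons by (rule singleton_category_words)

text \<open>The parameter \<open>k\<close> of the classification; as the nonnegative generator of a subgroup of the integers
it is unique.\<close>

definition k :: nat where "k = (SOME k. single_sums (words C) = {n. int k dvd n})"

text \<open>Likewise the parameter \<open>d\<close>.\<close>

definition d :: nat where "d = (SOME d. {n. pair_spacing (words C) White n Black} = {n. int d dvd n})"

lemma single_sums_eq: "single_sums (words C) = {n. int k dvd n}"
  unfolding k_def by (rule someI_ex[OF single_sums_multiples])

lemma spacing_White_Black_iff: "pair_spacing (words C) White n Black \<longleftrightarrow> int d dvd n"
  using someI_ex[OF spacing_multiples] unfolding d_def by blast

lemma d_dvd_k: "d dvd k"
proof -
  have "int k \<in> single_sums (words C)" by (simp add: single_sums_eq)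
  from pair_spacing_of_single_sum[OF this, of White] show ?thesis
    by (simp add: spacing_White_Black_iff)
qed

lemma no_zero_spacing: "\<not> pair_spacing (words C) White 0 White"
  using global_if_spacing_zero not_global by blast

lemma spacing_White_White_iff:
  assumes "pair_spacing (words C) White m White"
  shows "pair_spacing (words C) White n White \<longleftrightarrow> int d dvd n - m"
  using spacing_White_White_diff[OF _ assms, of n] spacing_White_White_shift[OF assms, of "m - n"]
  by (auto simp: spacing_White_Black_iff dvd_diff_commute)

lemma d_k_neq_1:
  assumes "pair_spacing (words C) White m White"
  shows "d \<noteq> 1" "k \<noteq> 1"
proof -
  show "d \<noteq> 1" using spacing_White_White_iff[OF assms, of 0] no_zero_spacing by auto
  then show "k \<noteq> 1" using d_dvd_k by auto
qed

lemma sigma_pow_in: "tensor_pow (sigma White) k \<in> C"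
proof -
  have "singles (replicate k White) \<in> words C"
    using single_sums_iff[of "replicate k White"] single_sums_eq by simp
  then show ?thesis by (simp add: tensor_pow_sigma_word in_words_iff)
qed

lemma lambda_part_in: "lambda_part d \<in> C"
  unfolding lambda_part_word in_words_iff[symmetric] lambda_word_iff spacing_White_Black_iff by simp

lemma mu_part_in_iff: "mu_part r \<in> C \<longleftrightarrow> pair_spacing (words C) White (int r - 1) White"
  unfolding mu_part_word in_words_iff[symmetric] mu_word_iff ..

text \<open>The groups of color sums and of spacings of \<open>C\<close> are generated by the numbers that \<open>\<sigma>\<^sup>k\<close> and \<open>\<lambda>\<^sub>d\<close>
express, and the white-white spacings of \<open>C\<close>, if there are any, form a coset of which one element
suffices.\<close>

lemma words_subset:
  assumes D: "category D" "sigma White \<otimes> sigma Black \<in> D"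
    and "tensor_pow (sigma White) k \<in> D" "lambda_part d \<in> D"
    and block: "beta White Black White Black \<in> C \<Longrightarrow> beta White Black White Black \<in> D"
    and E: "\<And>n. pair_spacing (words C) White n White \<Longrightarrow>
      \<exists>m. pair_spacing (words C) White m White \<and> pair_spacing (words D) White m White"
  shows "words C \<subseteq> words D"
proof -
  interpret D: singleton_category "words D" using D by (rule singleton_category_words)
  obtain k' :: nat where k': "single_sums (words D) = {n. int k' dvd n}" using D.single_sums_multiples by blast
  obtain d' :: nat where d': "{n. pair_spacing (words D) White n Black} = {n. int d' dvd n}"
    using D.spacing_multiples by blast
  have "singles (replicate k White) \<in> words D"
    using assms(3) by (simp add: tensor_pow_sigma_word words_def)
  then have "int k' dvd int k" using D.single_sums_iff[of "replicate k White"] k' by simp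
  then have sums: "single_sums (words C) \<subseteq> single_sums (words D)"
    unfolding single_sums_eq k' by (auto intro: dvd_trans)
  have "pair_spacing (words D) White (- int d) Black"
    using assms(4) unfolding lambda_part_word D.lambda_word_iff[symmetric] by (simp add: words_def)
  then have "- int d \<in> {n. int d' dvd n}" unfolding d'[symmetric] by simp
  then have "int d' dvd int d" by simp
  then have "n \<in> {n. pair_spacing (words D) White n Black}" if "pair_spacing (words C) White n Black" for n
    using that unfolding spacing_White_Black_iff d' mem_Collect_eq by (rule dvd_trans)
  then have DD: "pair_spacing (words D) White n Black" if "pair_spacing (words C) White n Black" for n
    using that by blast
  have "pair_spacing (words D) x n y" if "pair_spacing (words C) x n y" for x n y
    by (rule pair_spacing_subset[OF singleton_category_axioms D.singleton_category_axioms DD E that])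
  then show ?thesis
    using block sums unfolding beta_word
    by (intro singleton_category_subset[OF singleton_category_axioms D.singleton_category_axioms crossing_free])
      (simp_all only: words_def mem_Collect_eq)
qed

text \<open>Cutting two points of the four-block shows that \<open>-1\<close> is a white-white spacing; so there is no choice for
these spacings.\<close>

lemma case_S_classification:
  assumes block: "beta White Black White Black \<in> C"
  shows "k \<noteq> 1 \<and> d \<noteq> 1 \<and> d dvd k \<and> C = S_loc k d"
proof -
  have spacing: "pair_spacing (words D) White (- 1) White"
    if D: "category D" "sigma White \<otimes> sigma Black \<in> D" "beta White Black White Black \<in> D" for D
  proof -
    interpret D: singleton_category "words D" using D(1,2) by (rule singleton_category_words)
    have "[(White, Some 0)] @ [(Black, Some 0)] @ [(White, Some 0), (Black, Some 0)] \<in> words D"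
      using D(3) unfolding beta_word by (simp add: words_def)
    from D.cut[OF this]
    have "([(White, Some 0)] @ [(Black, None)] @ [(White, Some 0)]) @ [(Black, Some 0)] @ [] \<in> words D" by simp
    from D.cut[OF this]
    have "[(White, Some 0)] @ singles [Black] @ [(White, Some 0)] @ singles [Black] \<in> words D" by simp
    then show ?thesis using D.pair_spacing_iff[of "[Black]" "[Black]" White White 0] by simp
  qed
  have "C = S_loc k d"
    unfolding S_loc_def
  proof (rule eq_generatedI[OF is_category])
    show "{tensor_pow (sigma White) k, lambda_part d, beta White Black White Black,
        sigma White \<otimes> sigma Black} \<subseteq> C"
      using sigma_pow_in lambda_part_in block singletons by simp
    fix D assume "category D" "{tensor_pow (sigma White) k, lambda_part d, beta White Black White Black,
        sigma White \<otimes> sigma Black} \<subseteq> D"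
    then show "words C \<subseteq> words D"
      using spacing[OF is_category singletons block] spacing[of D] by (intro words_subset) auto
  qed
  then show ?thesis using d_k_neq_1[OF spacing[OF is_category singletons block]] d_dvd_k by blast
qed

lemma eq_B'_loc:
  assumes no_block: "beta White Black White Black \<notin> C"
    and r: "pair_spacing (words C) White (int r - 1) White"
  shows "C = B'_loc k d r"
  unfolding B'_loc_def
proof (rule eq_generatedI[OF is_category])
  show "{tensor_pow (sigma White) k, lambda_part d, mu_part r, sigma White \<otimes> sigma Black} \<subseteq> C"
    using sigma_pow_in lambda_part_in mu_part_in_iff r singletons by simp
  fix D assume D: "category D" "{tensor_pow (sigma White) k, lambda_part d, mu_part r,
      sigma White \<otimes> sigma Black} \<subseteq> D"
  interpret D: singleton_category "words D" using D by (intro singleton_category_words) auto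
  have "pair_spacing (words D) White (int r - 1) White"
    using D(2) unfolding mu_part_word D.mu_word_iff[symmetric] by (simp add: words_def)
  then show "words C \<subseteq> words D"
    using D no_block r by (intro words_subset) auto
qed

text \<open>Let \<open>n\<close> be a white-white spacing. As \<open>d\<close> divides \<open>2(n + 1)\<close>, either it divides \<open>n + 1\<close>, or \<open>d\<close> is
even and \<open>n + 1\<close> is an odd multiple of \<open>r = d/2\<close>; then \<open>r - 1\<close> is a white-white spacing.\<close>

lemma case_B_classification:
  assumes no_block: "beta White Black White Black \<notin> C"
  shows "(\<exists>k d. d dvd k \<and> C = B_loc k d) \<or>
    (\<exists>k d. k \<noteq> 1 \<and> d \<noteq> 1 \<and> d dvd k \<and> C = B'_loc k d 0) \<or>
    (\<exists>k d. k \<noteq> 1 \<and> even d \<and> d \<notin> {0, 2} \<and> d dvd k \<and> C = B'_loc k d (d div 2))"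
proof (cases "\<exists>n. pair_spacing (words C) White n White")
  case False
  have "C = B_loc k d"
    unfolding B_loc_def
  proof (rule eq_generatedI[OF is_category])
    show "{tensor_pow (sigma White) k, lambda_part d, sigma White \<otimes> sigma Black} \<subseteq> C"
      using sigma_pow_in lambda_part_in singletons by simp
    fix D assume "category D" "{tensor_pow (sigma White) k, lambda_part d, sigma White \<otimes> sigma Black} \<subseteq> D"
    then show "words C \<subseteq> words D" using False no_block by (intro words_subset) auto
  qed
  then show ?thesis using d_dvd_k by blast
next
  case True
  then obtain n where n: "pair_spacing (words C) White n White" by blast
  note iff = spacing_White_White_iff[OF n]
  note neq_1 = d_k_neq_1[OF n]
  have double: "int d dvd 2 * (n + 1)"
    using spacing_White_White_double[OF n] spacing_White_Black_iff by blast
  show ?thesis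
  proof (cases "int d dvd n + 1")
    case True
    then have "pair_spacing (words C) White (int 0 - 1) White"
      using iff[of "- 1"] by (simp add: dvd_diff_commute[of _ "- 1" n])
    from eq_B'_loc[OF no_block this] show ?thesis using neq_1 d_dvd_k by blast
  next
    case False
    have "even d"
    proof (rule ccontr)
      assume "odd d"
      then have "coprime (int d) 2" by simp
      from coprime_dvd_mult_right_iff[OF this, of "n + 1"] show False using double False by blast
    qed
    then obtain r where r: "d = 2 * r" by (elim evenE)
    have "2 * int r dvd 2 * (n + 1)" using double by (simp only: r of_nat_mult of_nat_numeral)
    then have "int r dvd n + 1" by (simp only: dvd_mult_cancel_left) simp
    then obtain q where q: "n + 1 = int r * q" by (elim dvdE)
    have "odd q"
    proof
      assume "even q"
      then show False using False q r by (auto elim!: evenE)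
    qed
    then obtain q' where "q = 2 * q' + 1" by (elim oddE)
    then have "n - (int r - 1) = int d * q'" using q r by (simp add: algebra_simps)
    then have "int d dvd (int r - 1) - n" by (metis dvd_diff_commute dvd_triv_left)
    then have mu: "pair_spacing (words C) White (int r - 1) White" using iff by simp
    have "d \<noteq> 0"
    proof
      assume "d = 0"
      then have "2 * (n + 1) = 0" using double by (simp only: of_nat_0 dvd_0_left_iff)
      then show False using False \<open>d = 0\<close> by simp
    qed
    moreover have "d \<noteq> 2"
    proof
      assume "d = 2"
      then show False using mu no_zero_spacing r by simp
    qed
    moreover have "C = B'_loc k d (d div 2)" using eq_B'_loc[OF no_block mu] r by simp
    ultimately show ?thesis using neq_1 d_dvd_k \<open>even d\<close>
      by (intro disjI2 exI[of _ k] exI[of _ d]) simp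
  qed
qed

end

theorem theorem7p2:
  fixes C :: "tpart set"
  assumes "category C"
    and "C \<subseteq> NC"
    and "locally_colorized C"
  shows "(case_O C \<longrightarrow> C = O_loc) \<and>
    (case_H C \<longrightarrow>
       C = H'_loc \<or>
       (\<exists>k d. k \<notin> {1, 2} \<and> d \<notin> {1, 2} \<and> d dvd k \<and> C = H_loc k d)) \<and>
    (case_S C \<longrightarrow>
       (\<exists>k d. k \<noteq> 1 \<and> d \<noteq> 1 \<and> d dvd k \<and> C = S_loc k d)) \<and>
    (case_B C \<longrightarrow>
       (\<exists>k d. d dvd k \<and> C = B_loc k d) \<or>
       (\<exists>k d. k \<noteq> 1 \<and> d \<noteq> 1 \<and> d dvd k \<and> C = B'_loc k d 0) \<or>
       (\<exists>k d. k \<noteq> 1 \<and> even d \<and> d \<notin> {0, 2} \<and> d dvd k \<and> C = B'_loc k d (d div 2)))"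
proof -
  interpret local_NC_category C by unfold_locales fact+
  have singletons: "local_NC_singleton_category C" if "sigma White \<otimes> sigma Black \<in> C"
    by unfold_locales fact
  show ?thesis
    using case_O_classification case_H_classification
      local_NC_singleton_category.case_S_classification[OF singletons]
      local_NC_singleton_category.case_B_classification[OF singletons]
    unfolding case_S_def case_B_def by blast
qed

end
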